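(* Let $H$ be a weak bialgebra over a commutative ring $k$. Then the category ${}_H^H\mathcal{YD}$ of left-left Yetter-Drinfeld modules over $H$ is isomorphic to the weak left center $\mathcal{W}_l({}_H\mathcal{M})$ of the monoidal category ${}_H\mathcal{M}$ of left $H$-modules. If $H$ is a weak Hopf algebra with bijective antipode, then ${}_H^H\mathcal{YD}$ is isomorphic to the left center $\mathcal{Z}_l({}_H\mathcal{M})$.
   Context: All modules are over the commutative ring $k$, $\otimes=\otimes_k$. A weak $k$-bialgebra is a $k$-module $H$ with a unital associative $k$-algebra structure and a coassociative counital $k$-coalgebra structure $(\Delta,\varepsilon)$, written $\Delta(h)=h_{(1)}\otimes h_{(2)}$ (primes denote further copies), such that $\Delta(hk)=\Delta(h)\Delta(k)$, $$(\Delta\otimes H)\Delta(1)=1_{(1)}\otimes 1_{(2)}1_{(1')}\otimes 1_{(2')}=1_{(1)}\otimes 1_{(1')}1_{(2)}\otimes 1_{(2')},$$ $$\varepsilon(hkl)=\varepsilon(hk_{(1)})\varepsilon(k_{(2)}l)=\varepsilon(hk_{(2)})\varepsilon(k_{(1)}l)$$ for all $h,k,l\in H$. Put $\varepsilon_t(h)=\varepsilon(1_{(1)}h)1_{(2)}$, $\varepsilon_s(h)=1_{(1)}\varepsilon(h1_{(2)})$, $\overline{\varepsilon}_s(h)=\varepsilon(1_{(2)}h)1_{(1)}$, $H_t=\mathrm{Im}(\varepsilon_t)$, $H_s=\mathrm{Im}(\varepsilon_s)$. A weak Hopf algebra is a weak bialgebra with a $k$-linear map $S:H\to H$ (antipode)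 such that $S(h_{(1)})h_{(2)}=\varepsilon_s(h)$, $h_{(1)}S(h_{(2)})=\varepsilon_t(h)$, $S(h_{(1)})h_{(2)}S(h_{(3)})=S(h)$ for all $h$. Monoidal structure on ${}_H\mathcal{M}$: for left $H$-modules $M,N$, $M\otimes_t N=\Delta(1)(M\otimes N)\subset M\otimes N$ (generated by the elements $1_{(1)}m\otimes 1_{(2)}n$) with diagonal action $h\cdot(m\otimes n)=h_{(1)}m\otimes h_{(2)}n$; the associativity constraints are the natural ones. The unit object is $H_t$ with action $h\rightharpoonup z=\varepsilon_t(hz)$; the unit constraints are $l_M:H_t\otimes_t M\to M$, $l_M(1_{(1)}\rightharpoonup z\otimes 1_{(2)}m)=zm$, and $r_M:M\otimes_t H_t\to M$, $r_M(1_{(1)}m\otimes 1_{(2)}\rightharpoonup z)=\overline{\varepsilon}_s(z)m$. A left-left Yetter-Drinfeld module is a $k$-module $M$ with a left $H$-action and a (coassociative, counital) left $H$-coaction $\lambda:M\to H\otimes M$, $\lambda(m)=m_{[-1]}\otimes m_{[0]}$, such that for all $m\in M$, $h\in H$: $\lambda(m)\in H\otimes_t M$ and $$h_{(1)}m_{[-1]}\otimes h_{(2)}m_{[0]}=(h_{(1)}m)_{[-1]}h_{(2)}\otimes (h_{(1)}m)_{[0]}.$$ Morphisms in ${}_H^H\mathcal{YD}$ are the left $H$-linear, left $H$-colinear maps. For a monoidal category $(\mathcal{C},\otimes,I,a,l,r)$, objects of the weak left center $\mathcal{W}_l(\mathcal{C})$ are pairs $(M,\sigma_{M,-})$ with $M\in\mathcal{C}$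 and $\sigma_{M,-}:M\otimes -\to -\otimes M$ a natural transformation such that $$(X\otimes\sigma_{M,Y})\circ a_{X,M,Y}\circ(\sigma_{M,X}\otimes Y)=a_{X,Y,M}\circ\sigma_{M,X\otimes Y}\circ a_{M,X,Y}$$ for all $X,Y\in\mathcal{C}$, and such that $\sigma_{M,I}$ is the composition of the natural isomorphisms $M\otimes I\cong M\cong I\otimes M$. A morphism $(M,\sigma_{M,-})\to(M',\sigma_{M',-})$ is a morphism $\vartheta:M\to M'$ in $\mathcal{C}$ with $(X\otimes\vartheta)\circ\sigma_{M,X}=\sigma_{M',X}\circ(\vartheta\otimes X)$ for all $X$. The left center $\mathcal{Z}_l(\mathcal{C})$ is the full subcategory of objects for which $\sigma_{M,-}$ is a natural isomorphism. *)

theory Defs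
  imports "HOL-Algebra.Module"
begin

section \<open>Modules over a commutative ring and their tensor products\<close>

text \<open>
  All carriers (of the ground ring \<open>k\<close>, of \<open>H\<close>, and of all modules) are sets of elements of one
  type \<open>'u\<close>, which plays the role of a universe. If \<open>'u\<close> is infinite, then for all \<open>k\<close>-modules with
  carriers in \<open>'u\<close> a tensor product with carrier in \<open>'u\<close> exists, so the modules
  with carriers in \<open>'u\<close> are closed under the constructions below.

  The type of \<open>k\<close>-modules is the library record, which inherits from rings the fields
  \<^const>\<open>mult\<close> and \<^const>\<open>one\<close>. These two fields are only meaningful for algebras.
\<close>

context
  fixes k :: "'u ring"
begin

definition linear_map :: "('u, 'u, 'm) module_scheme \<Rightarrow> ('u, 'u, 'n) module_scheme \<Rightarrow> ('u \<Rightarrow> 'u) \<Rightarrow> bool"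
  where "linear_map M N f \<longleftrightarrow>
    f \<in> carrier M \<rightarrow> carrier N \<and>
    (\<forall>x\<in>carrier M. \<forall>y\<in>carrier M. f (x \<oplus>\<^bsub>M\<^esub> y) = f x \<oplus>\<^bsub>N\<^esub> f y) \<and>
    (\<forall>a\<in>carrier k. \<forall>x\<in>carrier M. f (a \<odot>\<^bsub>M\<^esub> x) = a \<odot>\<^bsub>N\<^esub> f x)"

definition bilinear_map ::
  "('u, 'u, 'm) module_scheme \<Rightarrow> ('u, 'u, 'n) module_scheme \<Rightarrow> ('u, 'u, 'p) module_scheme
    \<Rightarrow> ('u \<Rightarrow> 'u \<Rightarrow> 'u) \<Rightarrow> bool"
  where "bilinear_map M N P f \<longleftrightarrow>
    (\<forall>x\<in>carrier M. linear_map N P (f x)) \<and>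
    (\<forall>y\<in>carrier N. linear_map M P (\<lambda>x. f x y))"

definition ring_as_module :: "('u, 'u) module"
  where "ring_as_module =
    \<lparr>carrier = carrier k, mult = mult k, one = one k, zero = zero k, add = add k, smult = mult k\<rparr>"

text \<open>\<open>g\<close> is the linear map on \<open>T\<close> induced by the bilinear map \<open>f\<close>, where \<open>t\<close> is the
  universal bilinear map into \<open>T\<close>.\<close>

definition induced_map ::
  "('u, 'u, 'm) module_scheme \<Rightarrow> ('u, 'u, 'n) module_scheme \<Rightarrow> ('u, 'u) module \<Rightarrow> ('u \<Rightarrow> 'u \<Rightarrow> 'u)
    \<Rightarrow> ('u, 'u, 'p) module_scheme \<Rightarrow> ('u \<Rightarrow> 'u \<Rightarrow> 'u) \<Rightarrow> ('u \<Rightarrow> 'u) \<Rightarrow> bool"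
  where "induced_map M N T t P f g \<longleftrightarrow>
    g \<in> extensional (carrier T) \<and> linear_map T P g \<and>
    (\<forall>x\<in>carrier M. \<forall>y\<in>carrier N. g (t x y) = f x y)"

definition is_tensor_product ::
  "('u, 'u, 'm) module_scheme \<Rightarrow> ('u, 'u, 'n) module_scheme \<Rightarrow> ('u, 'u) module \<Rightarrow> ('u \<Rightarrow> 'u \<Rightarrow> 'u) \<Rightarrow> bool"
  where "is_tensor_product M N T t \<longleftrightarrow>
    module k T \<and> bilinear_map M N T t \<and>
    (\<forall>(P :: ('u, 'u) module) f. module k P \<and> bilinear_map M N P f \<longrightarrow> (\<exists>!g. induced_map M N T t P f g))"

text \<open>A fixed choice of the tensor product \<open>M \<boxtimes> N\<close>, of its universal bilinear map
  \<open>tens M N\<close>, and of the induced linear maps \<open>tlift M N P f\<close>, so that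
  \<open>tlift M N P f\<close> sends \<open>\<Sum>\<^sub>i tens M N x\<^sub>i y\<^sub>i\<close> to \<open>\<Sum>\<^sub>i f x\<^sub>i y\<^sub>i\<close>.\<close>

definition tensor_product ::
  "('u, 'u, 'm) module_scheme \<Rightarrow> ('u, 'u, 'n) module_scheme \<Rightarrow> ('u, 'u) module \<times> ('u \<Rightarrow> 'u \<Rightarrow> 'u)"
  where "tensor_product M N = (SOME (T, t). is_tensor_product M N T t)"

definition tmod ::
  "('u, 'u, 'm) module_scheme \<Rightarrow> ('u, 'u, 'n) module_scheme \<Rightarrow> ('u, 'u) module" (infixr \<open>\<boxtimes>\<close> 75)
  where "M \<boxtimes> N = fst (tensor_product M N)"

definition tens ::
  "('u, 'u, 'm) module_scheme \<Rightarrow> ('u, 'u, 'n) module_scheme \<Rightarrow> 'u \<Rightarrow> 'u \<Rightarrow> 'u"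
  where "tens M N = snd (tensor_product M N)"

definition tlift ::
  "('u, 'u, 'm) module_scheme \<Rightarrow> ('u, 'u, 'n) module_scheme \<Rightarrow> ('u, 'u, 'p) module_scheme
    \<Rightarrow> ('u \<Rightarrow> 'u \<Rightarrow> 'u) \<Rightarrow> 'u \<Rightarrow> 'u"
  where "tlift M N P f = (THE g. induced_map M N (M \<boxtimes> N) (tens M N) P f g)"

end


section \<open>Weak bialgebras and weak Hopf algebras\<close>

record 'u bialgebra = "('u, 'u) module" +
  comult :: "'u \<Rightarrow> 'u"
  counit :: "'u \<Rightarrow> 'u"

context
  fixes k :: "'u ring" and H :: "'u bialgebra" (structure)
begin

abbreviation tmod_k (infixr \<open>\<boxtimes>\<close> 75) where "M \<boxtimes> N \<equiv> tmod k M N"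

text \<open>Sweedler notation: \<open>sweedler P f h\<close> is \<open>f h\<^sub>1 h\<^sub>2\<close> (with summation understood),
  for \<open>f\<close> bilinear with values in \<open>P\<close>. Threefold tensors are bracketed to the right.\<close>

definition sweedler :: "('u, 'u, 'p) module_scheme \<Rightarrow> ('u \<Rightarrow> 'u \<Rightarrow> 'u) \<Rightarrow> 'u \<Rightarrow> 'u"
  where "sweedler P f h = tlift k H H P f (comult H h)"

definition unital_algebra :: bool
  where "unital_algebra \<longleftrightarrow> module k H \<and> ring H \<and> bilinear_map k H H H (mult H)"

definition coalgebra :: bool
  where "coalgebra \<longleftrightarrow>
    module k H \<and> linear_map k H (H \<boxtimes> H) (comult H) \<and> linear_map k H (ring_as_module k) (counit H) \<and>
    (\<forall>h\<in>carrier H.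
       sweedler (H \<boxtimes> H \<boxtimes> H)
         (\<lambda>a b. sweedler (H \<boxtimes> H \<boxtimes> H) (\<lambda>c d. tens k H (H \<boxtimes> H) c (tens k H H d b)) a) h
       = sweedler (H \<boxtimes> H \<boxtimes> H) (\<lambda>a b. tens k H (H \<boxtimes> H) a (comult H b)) h) \<and>
    (\<forall>h\<in>carrier H. sweedler H (\<lambda>a b. counit H a \<odot> b) h = h) \<and>
    (\<forall>h\<in>carrier H. sweedler H (\<lambda>a b. counit H b \<odot> a) h = h)"

definition weak_bialgebra :: bool
  where "weak_bialgebra \<longleftrightarrow>
    unital_algebra \<and> coalgebra \<and>
    (\<forall>g\<in>carrier H. \<forall>h\<in>carrier H.
       comult H (g \<otimes> h) =
       sweedler (H \<boxtimes> H) (\<lambda>a b. sweedler (H \<boxtimes> H) (\<lambda>c d. tens k H H (a \<otimes> c) (b \<otimes> d)) h) g) \<and>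
    sweedler (H \<boxtimes> H \<boxtimes> H)
      (\<lambda>a b. sweedler (H \<boxtimes> H \<boxtimes> H) (\<lambda>c d. tens k H (H \<boxtimes> H) c (tens k H H d b)) a) \<one>
    = sweedler (H \<boxtimes> H \<boxtimes> H)
      (\<lambda>a b. sweedler (H \<boxtimes> H \<boxtimes> H) (\<lambda>c d. tens k H (H \<boxtimes> H) a (tens k H H (b \<otimes> c) d)) \<one>) \<one> \<and>
    sweedler (H \<boxtimes> H \<boxtimes> H)
      (\<lambda>a b. sweedler (H \<boxtimes> H \<boxtimes> H) (\<lambda>c d. tens k H (H \<boxtimes> H) c (tens k H H d b)) a) \<one>
    = sweedler (H \<boxtimes> H \<boxtimes> H)
      (\<lambda>a b. sweedler (H \<boxtimes> H \<boxtimes> H) (\<lambda>c d. tens k H (H \<boxtimes> H) a (tens k H H (c \<otimes> b) d)) \<one>) \<one> \<and>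
    (\<forall>f\<in>carrier H. \<forall>g\<in>carrier H. \<forall>h\<in>carrier H.
       counit H (f \<otimes> g \<otimes> h) =
         sweedler (ring_as_module k) (\<lambda>a b. counit H (f \<otimes> a) \<otimes>\<^bsub>k\<^esub> counit H (b \<otimes> h)) g \<and>
       counit H (f \<otimes> g \<otimes> h) =
         sweedler (ring_as_module k) (\<lambda>a b. counit H (f \<otimes> b) \<otimes>\<^bsub>k\<^esub> counit H (a \<otimes> h)) g)"

definition eps_t :: "'u \<Rightarrow> 'u"
  where "eps_t h = sweedler H (\<lambda>a b. counit H (a \<otimes> h) \<odot> b) \<one>"

definition eps_s :: "'u \<Rightarrow> 'u"
  where "eps_s h = sweedler H (\<lambda>a b. counit H (h \<otimes> b) \<odot> a) \<one>"

definition eps_s_bar :: "'u \<Rightarrow> 'u"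
  where "eps_s_bar h = sweedler H (\<lambda>a b. counit H (b \<otimes> h) \<odot> a) \<one>"

definition is_antipode :: "('u \<Rightarrow> 'u) \<Rightarrow> bool"
  where "is_antipode S \<longleftrightarrow>
    linear_map k H H S \<and>
    (\<forall>h\<in>carrier H.
       sweedler H (\<lambda>a b. S a \<otimes> b) h = eps_s h \<and>
       sweedler H (\<lambda>a b. a \<otimes> S b) h = eps_t h \<and>
       sweedler H (\<lambda>a b. sweedler H (\<lambda>c d. S a \<otimes> c \<otimes> S d) b) h = S h)"

definition weak_hopf_algebra :: "('u \<Rightarrow> 'u) \<Rightarrow> bool"
  where "weak_hopf_algebra S \<longleftrightarrow> weak_bialgebra \<and> is_antipode S"

end


section \<open>Categories\<close>

record ('o, 'a) category_data =
  Obj :: "'o set"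
  Arr :: "'a set"
  Dom :: "'a \<Rightarrow> 'o"
  Cod :: "'a \<Rightarrow> 'o"
  Ident :: "'o \<Rightarrow> 'a"
  Comp :: "'a \<Rightarrow> 'a \<Rightarrow> 'a" (infixl \<open>\<cdot>\<index>\<close> 65)

definition in_hom :: "('o, 'a, 'm) category_data_scheme \<Rightarrow> 'a \<Rightarrow> 'o \<Rightarrow> 'o \<Rightarrow> bool"
  where "in_hom C f A B \<longleftrightarrow> f \<in> Arr C \<and> Dom C f = A \<and> Cod C f = B"

locale category =
  fixes C :: "('o, 'a, 'm) category_data_scheme" (structure)
  assumes dom_closed: "f \<in> Arr C \<Longrightarrow> Dom C f \<in> Obj C"
    and cod_closed: "f \<in> Arr C \<Longrightarrow> Cod C f \<in> Obj C"
    and id_in_hom: "A \<in> Obj C \<Longrightarrow> in_hom C (Ident C A) A A"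
    and comp_in_hom: "\<lbrakk>in_hom C f A B; in_hom C g B D\<rbrakk> \<Longrightarrow> in_hom C (g \<cdot> f) A D"
    and comp_assoc:
      "\<lbrakk>in_hom C f A B; in_hom C g B D; in_hom C h D E\<rbrakk> \<Longrightarrow> (h \<cdot> g) \<cdot> f = h \<cdot> (g \<cdot> f)"
    and comp_id_left: "in_hom C f A B \<Longrightarrow> Ident C B \<cdot> f = f"
    and comp_id_right: "in_hom C f A B \<Longrightarrow> f \<cdot> Ident C A = f"

definition is_functor ::
  "('o, 'a, 'm) category_data_scheme \<Rightarrow> ('p, 'b, 'n) category_data_scheme
    \<Rightarrow> ('o \<Rightarrow> 'p) \<Rightarrow> ('a \<Rightarrow> 'b) \<Rightarrow> bool"
  where "is_functor C D Fo Fa \<longleftrightarrow>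
    (\<forall>A\<in>Obj C. Fo A \<in> Obj D \<and> Fa (Ident C A) = Ident D (Fo A)) \<and>
    (\<forall>f\<in>Arr C. in_hom D (Fa f) (Fo (Dom C f)) (Fo (Cod C f))) \<and>
    (\<forall>f\<in>Arr C. \<forall>g\<in>Arr C. Dom C g = Cod C f \<longrightarrow> Fa (g \<cdot>\<^bsub>C\<^esub> f) = Fa g \<cdot>\<^bsub>D\<^esub> Fa f)"

definition isomorphic_categories ::
  "('o, 'a, 'm) category_data_scheme \<Rightarrow> ('p, 'b, 'n) category_data_scheme \<Rightarrow> bool"
  where "isomorphic_categories C D \<longleftrightarrow>
    category C \<and> category D \<and>
    (\<exists>Fo Fa Go Ga. is_functor C D Fo Fa \<and> is_functor D C Go Ga \<and>
      (\<forall>A\<in>Obj C. Go (Fo A) = A) \<and> (\<forall>f\<in>Arr C. Ga (Fa f) = f) \<and>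
      (\<forall>B\<in>Obj D. Fo (Go B) = B) \<and> (\<forall>g\<in>Arr D. Fa (Ga g) = g))"

definition is_inverse :: "('o, 'a, 'm) category_data_scheme \<Rightarrow> 'a \<Rightarrow> 'a \<Rightarrow> bool"
  where "is_inverse C f g \<longleftrightarrow>
    f \<in> Arr C \<and> in_hom C g (Cod C f) (Dom C f) \<and>
    g \<cdot>\<^bsub>C\<^esub> f = Ident C (Dom C f) \<and> f \<cdot>\<^bsub>C\<^esub> g = Ident C (Cod C f)"

definition is_iso :: "('o, 'a, 'm) category_data_scheme \<Rightarrow> 'a \<Rightarrow> bool"
  where "is_iso C f \<longleftrightarrow> (\<exists>g. is_inverse C f g)"

definition inverse_arrow :: "('o, 'a, 'm) category_data_scheme \<Rightarrow> 'a \<Rightarrow> 'a"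
  where "inverse_arrow C f = (THE g. is_inverse C f g)"

definition full_subcategory :: "('o, 'a) category_data \<Rightarrow> ('o \<Rightarrow> bool) \<Rightarrow> ('o, 'a) category_data"
  where "full_subcategory C P =
    C\<lparr>Obj := {A \<in> Obj C. P A}, Arr := {f \<in> Arr C. P (Dom C f) \<and> P (Cod C f)}\<rparr>"

text \<open>An arrow given by a map between underlying structures, together with its domain and codomain.\<close>

datatype ('o, 'f) arrow = Arrow (src: 'o) (tgt: 'o) (mor: 'f)

definition concrete_category ::
  "'o set \<Rightarrow> ('o \<Rightarrow> 'u set) \<Rightarrow> ('o \<Rightarrow> 'o \<Rightarrow> ('u \<Rightarrow> 'u) set) \<Rightarrow> ('o, ('o, 'u \<Rightarrow> 'u) arrow) category_data"
  where "concrete_category Ob car homs =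
    \<lparr>Obj = Ob,
     Arr = {Arrow A B f | A B f. A \<in> Ob \<and> B \<in> Ob \<and> f \<in> homs A B},
     Dom = src, Cod = tgt,
     Ident = (\<lambda>A. Arrow A A (\<lambda>x\<in>car A. x)),
     Comp = (\<lambda>g f. Arrow (src f) (tgt g) (compose (car (src f)) (mor g) (mor f)))\<rparr>"


section \<open>Monoidal categories and their left centers\<close>

record ('o, 'a) monoidal_data = "('o, 'a) category_data" +
  tens_obj :: "'o \<Rightarrow> 'o \<Rightarrow> 'o" (infixr \<open>\<otimes>o\<index>\<close> 75)
  tens_arr :: "'a \<Rightarrow> 'a \<Rightarrow> 'a" (infixr \<open>\<otimes>a\<index>\<close> 75)
  unit_obj :: "'o"
  associator :: "'o \<Rightarrow> 'o \<Rightarrow> 'o \<Rightarrow> 'a"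
  left_unitor :: "'o \<Rightarrow> 'a"
  right_unitor :: "'o \<Rightarrow> 'a"

context
  fixes C :: "('o, 'a) monoidal_data" (structure)
begin

definition half_braiding :: "'o \<Rightarrow> ('o \<Rightarrow> 'a) \<Rightarrow> bool"
  where "half_braiding M \<sigma> \<longleftrightarrow>
    \<sigma> \<in> extensional (Obj C) \<and>
    (\<forall>X\<in>Obj C. in_hom C (\<sigma> X) (M \<otimes>o X) (X \<otimes>o M)) \<and>
    (\<forall>f\<in>Arr C. (f \<otimes>a Ident C M) \<cdot> \<sigma> (Dom C f) = \<sigma> (Cod C f) \<cdot> (Ident C M \<otimes>a f)) \<and>
    (\<forall>X\<in>Obj C. \<forall>Y\<in>Obj C.
       (Ident C X \<otimes>a \<sigma> Y) \<cdot> associator C X M Y \<cdot> (\<sigma> X \<otimes>a Ident C Y) =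
       associator C X Y M \<cdot> \<sigma> (X \<otimes>o Y) \<cdot> associator C M X Y) \<and>
    \<sigma> (unit_obj C) = inverse_arrow C (left_unitor C M) \<cdot> right_unitor C M"

definition weak_left_center :: "('o \<times> ('o \<Rightarrow> 'a), ('o \<times> ('o \<Rightarrow> 'a), 'a) arrow) category_data"
  where "weak_left_center =
    \<lparr>Obj = {(M, \<sigma>). M \<in> Obj C \<and> half_braiding M \<sigma>},
     Arr = {Arrow (M, \<sigma>) (M', \<sigma>') \<theta> | M \<sigma> M' \<sigma>' \<theta>.
       M \<in> Obj C \<and> half_braiding M \<sigma> \<and> M' \<in> Obj C \<and> half_braiding M' \<sigma>' \<and>
       in_hom C \<theta> M M' \<and>
       (\<forall>X\<in>Obj C. (Ident C X \<otimes>a \<theta>) \<cdot> \<sigma> X = \<sigma>' X \<cdot> (\<theta> \<otimes>a Ident C X))},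
     Dom = src, Cod = tgt,
     Ident = (\<lambda>A. Arrow A A (Ident C (fst A))),
     Comp = (\<lambda>g f. Arrow (src f) (tgt g) (mor g \<cdot> mor f))\<rparr>"

definition left_center :: "('o \<times> ('o \<Rightarrow> 'a), ('o \<times> ('o \<Rightarrow> 'a), 'a) arrow) category_data"
  where "left_center = full_subcategory weak_left_center (\<lambda>(M, \<sigma>). \<forall>X\<in>Obj C. is_iso C (\<sigma> X))"

end


section \<open>The monoidal category of left modules over a weak bialgebra\<close>

record 'u hmod = "('u, 'u) module" +
  act :: "'u \<Rightarrow> 'u \<Rightarrow> 'u"

context
  fixes k :: "'u ring" and H :: "'u bialgebra" (structure)
begin

abbreviation tmod_k' (infixr \<open>\<boxtimes>\<close> 75) where "M \<boxtimes> N \<equiv> tmod k M N"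

text \<open>The structure on \<open>C\<close> with the addition and scalar multiplication of \<open>T\<close> and the action
  \<open>\<alpha>\<close>. It is normalized: everything is \<^const>\<open>undefined\<close> outside the carriers, and so are the
  fields \<^const>\<open>mult\<close> and \<^const>\<open>one\<close>. Only normalized records are objects of the category of
  modules, so that every module is represented by exactly one record.\<close>

definition hmod_on :: "'u set \<Rightarrow> ('u, 'u, 't) module_scheme \<Rightarrow> ('u \<Rightarrow> 'u \<Rightarrow> 'u) \<Rightarrow> 'u hmod"
  where "hmod_on C T \<alpha> =
    \<lparr>carrier = C, mult = undefined, one = undefined, zero = \<zero>\<^bsub>T\<^esub>,
     add = (\<lambda>x\<in>C. \<lambda>y\<in>C. x \<oplus>\<^bsub>T\<^esub> y),
     smult = (\<lambda>a\<in>carrier k. \<lambda>x\<in>C. a \<odot>\<^bsub>T\<^esub> x),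
     act = (\<lambda>h\<in>carrier H. \<lambda>x\<in>C. \<alpha> h x)\<rparr>"

definition left_module :: "'u hmod \<Rightarrow> bool"
  where "left_module M \<longleftrightarrow>
    module k M \<and> bilinear_map k H M M (act M) \<and>
    (\<forall>g\<in>carrier H. \<forall>h\<in>carrier H. \<forall>m\<in>carrier M. act M (g \<otimes> h) m = act M g (act M h m)) \<and>
    (\<forall>m\<in>carrier M. act M \<one> m = m) \<and>
    hmod_on (carrier M) M (act M) = M"

definition H_linear_maps :: "'u hmod \<Rightarrow> 'u hmod \<Rightarrow> ('u \<Rightarrow> 'u) set"
  where "H_linear_maps M N =
    {f \<in> extensional (carrier M). linear_map k M N f \<and>
      (\<forall>h\<in>carrier H. \<forall>m\<in>carrier M. f (act M h m) = act N h (f m))}"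

text \<open>The action of \<open>H \<boxtimes> H\<close> on \<open>M \<boxtimes> N\<close> by \<open>(a \<otimes> b)(m \<otimes> n) = am \<otimes> bn\<close>.\<close>

definition act2 :: "'u hmod \<Rightarrow> 'u hmod \<Rightarrow> 'u \<Rightarrow> 'u \<Rightarrow> 'u"
  where "act2 M N u x =
    tlift k H H (M \<boxtimes> N)
      (\<lambda>a b. tlift k M N (M \<boxtimes> N) (\<lambda>m n. tens k M N (act M a m) (act N b n)) x) u"

definition tensor_t :: "'u hmod \<Rightarrow> 'u hmod \<Rightarrow> 'u hmod" (infixr \<open>\<otimes>\<^sub>t\<close> 75)
  where "M \<otimes>\<^sub>t N =
    hmod_on (act2 M N (comult H \<one>) ` carrier (M \<boxtimes> N)) (M \<boxtimes> N) (\<lambda>h. act2 M N (comult H h))"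

definition tensor_t_arr ::
  "('u hmod, 'u \<Rightarrow> 'u) arrow \<Rightarrow> ('u hmod, 'u \<Rightarrow> 'u) arrow \<Rightarrow> ('u hmod, 'u \<Rightarrow> 'u) arrow"
  where "tensor_t_arr f g =
    Arrow (src f \<otimes>\<^sub>t src g) (tgt f \<otimes>\<^sub>t tgt g)
      (restrict
        (tlift k (src f) (src g) (tgt f \<boxtimes> tgt g) (\<lambda>m n. tens k (tgt f) (tgt g) (mor f m) (mor g n)))
        (carrier (src f \<otimes>\<^sub>t src g)))"

definition unit_t :: "'u hmod"
  where "unit_t = hmod_on (eps_t k H ` carrier H) H (\<lambda>h z. eps_t k H (h \<otimes> z))"

text \<open>The associativity constraint is induced by the canonical isomorphism
  \<open>(M \<boxtimes> N) \<boxtimes> P \<rightarrow> M \<boxtimes> (N \<boxtimes> P)\<close>: \<open>x\<close> and \<open>y\<close> correspond if their images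
  in \<open>M \<boxtimes> (N \<boxtimes> P)\<close> agree.\<close>

definition assoc_t :: "'u hmod \<Rightarrow> 'u hmod \<Rightarrow> 'u hmod \<Rightarrow> ('u hmod, 'u \<Rightarrow> 'u) arrow"
  where "assoc_t M N P =
    Arrow ((M \<otimes>\<^sub>t N) \<otimes>\<^sub>t P) (M \<otimes>\<^sub>t (N \<otimes>\<^sub>t P))
      (\<lambda>x\<in>carrier ((M \<otimes>\<^sub>t N) \<otimes>\<^sub>t P).
         THE y. y \<in> carrier (M \<otimes>\<^sub>t (N \<otimes>\<^sub>t P)) \<and>
           tlift k M (N \<otimes>\<^sub>t P) (M \<boxtimes> N \<boxtimes> P) (\<lambda>m u. tens k M (N \<boxtimes> P) m u) y =
           tlift k (M \<otimes>\<^sub>t N) P (M \<boxtimes> N \<boxtimes> P)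
             (\<lambda>u p. tlift k M N (M \<boxtimes> N \<boxtimes> P) (\<lambda>m n. tens k M (N \<boxtimes> P) m (tens k N P n p)) u) x)"

definition lunit_t :: "'u hmod \<Rightarrow> ('u hmod, 'u \<Rightarrow> 'u) arrow"
  where "lunit_t M =
    Arrow (unit_t \<otimes>\<^sub>t M) M
      (THE f. f \<in> extensional (carrier (unit_t \<otimes>\<^sub>t M)) \<and> linear_map k (unit_t \<otimes>\<^sub>t M) M f \<and>
        (\<forall>z\<in>carrier unit_t. \<forall>m\<in>carrier M.
           f (act2 unit_t M (comult H \<one>) (tens k unit_t M z m)) = act M z m))"

definition runit_t :: "'u hmod \<Rightarrow> ('u hmod, 'u \<Rightarrow> 'u) arrow"
  where "runit_t M =
    Arrow (M \<otimes>\<^sub>t unit_t) M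
      (THE f. f \<in> extensional (carrier (M \<otimes>\<^sub>t unit_t)) \<and> linear_map k (M \<otimes>\<^sub>t unit_t) M f \<and>
        (\<forall>m\<in>carrier M. \<forall>z\<in>carrier unit_t.
           f (act2 M unit_t (comult H \<one>) (tens k M unit_t m z)) = act M (eps_s_bar k H z) m))"

definition left_modules_category :: "('u hmod, ('u hmod, 'u \<Rightarrow> 'u) arrow) category_data"
  where "left_modules_category = concrete_category {M. left_module M} carrier H_linear_maps"

definition left_modules :: "('u hmod, ('u hmod, 'u \<Rightarrow> 'u) arrow) monoidal_data"
  where "left_modules =
    \<lparr>Obj = Obj left_modules_category, Arr = Arr left_modules_category,
     Dom = Dom left_modules_category, Cod = Cod left_modules_category,
     Ident = Ident left_modules_category, Comp = Comp left_modules_category,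
     tens_obj = tensor_t, tens_arr = tensor_t_arr, unit_obj = unit_t,
     associator = assoc_t, left_unitor = lunit_t, right_unitor = runit_t\<rparr>"


section \<open>Yetter-Drinfeld modules\<close>

text \<open>\<open>H\<close> as a left module over itself.\<close>

definition regular :: "'u hmod"
  where "regular = hmod_on (carrier H) H (mult H)"

definition left_coaction :: "'u hmod \<Rightarrow> ('u \<Rightarrow> 'u) \<Rightarrow> bool"
  where "left_coaction M \<rho> \<longleftrightarrow>
    \<rho> \<in> extensional (carrier M) \<and> linear_map k M (regular \<boxtimes> M) \<rho> \<and>
    (\<forall>m\<in>carrier M.
       tlift k regular M (regular \<boxtimes> regular \<boxtimes> M)
         (\<lambda>h n. sweedler k H (regular \<boxtimes> regular \<boxtimes> M)
            (\<lambda>a b. tens k regular (regular \<boxtimes> M) a (tens k regular M b n)) h) (\<rho> m)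
       = tlift k regular M (regular \<boxtimes> regular \<boxtimes> M)
         (\<lambda>h n. tens k regular (regular \<boxtimes> M) h (\<rho> n)) (\<rho> m)) \<and>
    (\<forall>m\<in>carrier M. tlift k regular M M (\<lambda>h n. counit H h \<odot>\<^bsub>M\<^esub> n) (\<rho> m) = m)"

definition yetter_drinfeld_module :: "'u hmod \<times> ('u \<Rightarrow> 'u) \<Rightarrow> bool"
  where "yetter_drinfeld_module = (\<lambda>(M, \<rho>).
    left_module M \<and> left_coaction M \<rho> \<and>
    (\<forall>m\<in>carrier M. \<rho> m \<in> carrier (regular \<otimes>\<^sub>t M)) \<and>
    (\<forall>m\<in>carrier M. \<forall>h\<in>carrier H.
       act2 regular M (comult H h) (\<rho> m) =
       sweedler k H (regular \<boxtimes> M)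
         (\<lambda>a b. tlift k regular M (regular \<boxtimes> M) (\<lambda>g n. tens k regular M (g \<otimes> b) n) (\<rho> (act M a m))) h))"

definition H_linear_colinear_maps :: "'u hmod \<times> ('u \<Rightarrow> 'u) \<Rightarrow> 'u hmod \<times> ('u \<Rightarrow> 'u) \<Rightarrow> ('u \<Rightarrow> 'u) set"
  where "H_linear_colinear_maps = (\<lambda>(M, \<rho>) (M', \<rho>').
    {f \<in> H_linear_maps M M'. \<forall>m\<in>carrier M.
       tlift k regular M (regular \<boxtimes> M') (\<lambda>h n. tens k regular M' h (f n)) (\<rho> m) = \<rho>' (f m)})"

definition yetter_drinfeld_modules ::
  "('u hmod \<times> ('u \<Rightarrow> 'u), ('u hmod \<times> ('u \<Rightarrow> 'u), 'u \<Rightarrow> 'u) arrow) category_data"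
  where "yetter_drinfeld_modules =
    concrete_category {A. yetter_drinfeld_module A} (\<lambda>A. carrier (fst A)) H_linear_colinear_maps"

end

end

theory Submission
  imports Defs
begin

text \<open>
  A Yetter-Drinfeld module \<open>(M, \<rho>)\<close> with \<open>\<rho>(m) = m\<^sub>- \<otimes> m\<^sub>0\<close> has the half-braiding
  \<open>\<sigma>\<^sub>X(m \<otimes> x) = m\<^sub>- x \<otimes> m\<^sub>0\<close>. Conversely, a half-braiding \<open>\<sigma>\<close> on \<open>M\<close> defines
  \<open>\<rho>(m) = \<sigma>\<^sub>H(1\<^sub>1 m \<otimes> 1\<^sub>2)\<close>, and naturality along the module maps \<open>H \<rightarrow> X, h \<mapsto> h x\<close> shows
  that \<open>\<sigma>\<close> is given by the formula above. Under this correspondence the compatibility condition is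
  the \<open>H\<close>-linearity of \<open>\<sigma>\<^sub>H\<close>, coassociativity is the hexagon evaluated at
  \<open>1\<^sub>1 m \<otimes> 1\<^sub>2 \<otimes> 1\<^sub>3\<close>, and counitality is the unit condition.

  If the antipode \<open>S\<close> is bijective, put \<open>\<tau>(x \<otimes> m) = m\<^sub>0 \<otimes> S\<^sup>-\<^sup>1(m\<^sub>-) x\<close>. Then \<open>\<sigma>\<tau>\<close> and \<open>\<tau>\<sigma>\<close>
  are the actions of \<open>\<Delta>(1)\<close>, because \<open>S\<close> is antimultiplicative and restricts to \<open>\<epsilon>\<^sub>s\<close> on \<open>H\<^sub>t\<close> and
  to \<open>\<epsilon>\<^sub>t\<close> on \<open>H\<^sub>s\<close>. Hence every half-braiding is invertible, and the two centers coincide.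

  All Sweedler computations are carried out with multilinear test maps: \<open>SW P f h\<close> stands for
  \<open>f h\<^sub>1 h\<^sub>2\<close> and \<open>CO P f m\<close> for \<open>f m\<^sub>- m\<^sub>0\<close>.
\<close>

section \<open>Existence of tensor products\<close>

text \<open>Two obstacles shape the proof. First, \<open>M \<otimes>\<^sub>t X\<close> is only the
  image of the idempotent action of \<Delta>(1), so a pure tensor need not belong to it. The
  compatibility condition at \<open>\<one>\<close>, combined with the requirement that the coaction
  take values in the image of \<Delta>(1), gives \<open>(1\<^sub>1 m)\<^sub>- 1\<^sub>2 \<otimes>
  (1\<^sub>1 m)\<^sub>0 = m\<^sub>- \<otimes> m\<^sub>0\<close>. So the formula for \<sigma>, read
  on all of \<open>M \<boxtimes> X\<close>, does not see the projection, identities can be checked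
  on pure tensors, and the copies of the unit that the hexagon inserts are absorbed. Second,
  tensoring over a ring need not preserve inclusions, so the two bracketings of a triple product are
  not visibly submodules of one module; the splitting by the idempotent repairs this. The unit
  condition is not symmetric in difficulty: counitality follows from its value at
  \<open>z = \<one>\<close>, while the converse needs
  \<open>\<epsilon>(m\<^sub>- z) m\<^sub>0 = esb(z) m\<close> for all \<open>z\<close>. The passages
  between coactions and half-braidings are literally inverse, which gives an isomorphism of
  categories, because both kinds of maps are extensional.\<close>

lemma infinite_list_inj:
  assumes "infinite (UNIV :: 'u set)"
  obtains J :: "('u \<times> 'u) list \<Rightarrow> 'u" where "inj J"
proof -
  have "\<exists>p. bij_betw p ((UNIV :: 'u set) \<times> (UNIV :: 'u set)) (UNIV :: 'u set)"
    using card_of_Times_same_infinite[OF assms] card_of_ordIso by blast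
  then obtain p :: "'u \<times> 'u \<Rightarrow> 'u" where p: "inj p"
    using bij_betw_imp_inj_on by (metis UNIV_Times_UNIV)
  obtain s :: "nat \<Rightarrow> 'u" where s: "inj s"
    using infinite_countable_subset[OF assms] by blast
  \<comment> \<open>\<open>K\<close> nests pairs and ends in the constant \<open>s 0\<close>, so it
    does not reveal where a list stops. It is injective only among lists of equal length, and the
    final code therefore records the length through \<open>s\<close>.\<close>
  define K where "K = (\<lambda>xs. foldr (\<lambda>x r. p (p x, r)) xs (s 0))"
  have K: "K xs = K ys \<Longrightarrow> length xs = length ys \<Longrightarrow> xs = ys" for xs ys
  proof (induction xs arbitrary: ys)
    case Nil
    then show ?case by simp
  next
    case (Cons x xs)
    then show ?case
      by (cases ys) (use p in \<open>auto simp: K_def dest!: injD[OF p]\<close>)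
  qed
  have "inj (\<lambda>xs. p (s (length xs), K xs))"
    by (rule injI) (auto dest!: injD[OF p] injD[OF s] intro: K)
  then show thesis by (rule that)
qed

text \<open>A tensor product of modules with carriers in \<open>'u\<close> must again live in
  \<open>'u\<close>. Infinity of the universe provides this: finite lists of pairs can then be coded
  by single elements.\<close>

locale tensor_base =
  fixes k :: "'u ring"
  assumes cring_k: "cring k"
    and inf_univ: "infinite (UNIV :: 'u set)"
begin

abbreviation lin where "lin \<equiv> linear_map k"
abbreviation bil where "bil \<equiv> bilinear_map k"
abbreviation tmodk (infixr \<open>\<boxtimes>\<close> 75) where "M \<boxtimes> N \<equiv> tmod k M N"

lemma linI:
  assumes "\<And>x. x \<in> carrier M \<Longrightarrow> f x \<in> carrier N"
    and "\<And>x y. x \<in> carrier M \<Longrightarrow> y \<in> carrier M \<Longrightarrow> f (x \<oplus>\<^bsub>M\<^esub> y) = f x \<oplus>\<^bsub>N\<^esub> f y"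
    and "\<And>a x. a \<in> carrier k \<Longrightarrow> x \<in> carrier M \<Longrightarrow> f (a \<odot>\<^bsub>M\<^esub> x) = a \<odot>\<^bsub>N\<^esub> f x"
  shows "lin M N f"
  using assms by (simp add: linear_map_def)

lemma lin_closed: "lin M N f \<Longrightarrow> x \<in> carrier M \<Longrightarrow> f x \<in> carrier N"
  by (auto simp: linear_map_def)

lemma lin_add:
  "lin M N f \<Longrightarrow> x \<in> carrier M \<Longrightarrow> y \<in> carrier M \<Longrightarrow> f (x \<oplus>\<^bsub>M\<^esub> y) = f x \<oplus>\<^bsub>N\<^esub> f y"
  by (auto simp: linear_map_def)

lemma lin_smult:
  "lin M N f \<Longrightarrow> a \<in> carrier k \<Longrightarrow> x \<in> carrier M \<Longrightarrow> f (a \<odot>\<^bsub>M\<^esub> x) = a \<odot>\<^bsub>N\<^esub> f x"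
  by (auto simp: linear_map_def)

lemma lin_cong:
  assumes "module k M" "\<And>x. x \<in> carrier M \<Longrightarrow> f x = g x"
  shows "lin M N f = lin M N g"
proof -
  interpret module k M by fact
  show ?thesis using assms(2) by (simp add: linear_map_def Pi_iff)
qed

lemma bilI:
  assumes "\<And>x. x \<in> carrier M \<Longrightarrow> lin N P (f x)" "\<And>y. y \<in> carrier N \<Longrightarrow> lin M P (\<lambda>x. f x y)"
  shows "bil M N P f"
  using assms by (simp add: bilinear_map_def)

lemma bil1: "bil M N P f \<Longrightarrow> x \<in> carrier M \<Longrightarrow> lin N P (f x)"
  by (simp add: bilinear_map_def)

lemma bil2: "bil M N P f \<Longrightarrow> y \<in> carrier N \<Longrightarrow> lin M P (\<lambda>x. f x y)"
  by (simp add: bilinear_map_def)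

lemma lin_zero:
  assumes "module k M" "module k N" "lin M N f"
  shows "f \<zero>\<^bsub>M\<^esub> = \<zero>\<^bsub>N\<^esub>"
proof -
  interpret M: module k M by fact
  interpret N: module k N by fact
  have "f (\<zero>\<^bsub>k\<^esub> \<odot>\<^bsub>M\<^esub> \<zero>\<^bsub>M\<^esub>) = \<zero>\<^bsub>k\<^esub> \<odot>\<^bsub>N\<^esub> f \<zero>\<^bsub>M\<^esub>"
    by (rule lin_smult[OF assms(3)]) auto
  then show ?thesis using lin_closed[OF assms(3)] by simp
qed

end

section \<open>A model of the tensor product: formal sums of pairs modulo bilinear test maps\<close>

locale tensor_words = tensor_base k
  for k :: "'u ring" +
  fixes M :: "('u, 'u, 'm) module_scheme" and N :: "('u, 'u, 'n) module_scheme"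
  assumes mod_M: "module k M" and mod_N: "module k N"
begin

definition word where "word L \<longleftrightarrow> set L \<subseteq> carrier M \<times> carrier N"

definition wsum :: "('u, 'u) module \<Rightarrow> ('u \<Rightarrow> 'u \<Rightarrow> 'u) \<Rightarrow> ('u \<times> 'u) list \<Rightarrow> 'u"
  where "wsum P f L = foldr (\<lambda>(x, y) r. f x y \<oplus>\<^bsub>P\<^esub> r) L \<zero>\<^bsub>P\<^esub>"

text \<open>Two formal sums of pairs are identified if no bilinear map into a module with carrier in the
  universe separates them, which makes the universal property of the quotient immediate.\<close>

definition weq where
  "weq L L' \<longleftrightarrow> (\<forall>P f. module k P \<and> bil M N P f \<longrightarrow> wsum P f L = wsum P f L')"

lemma weqI:
  "(\<And>P f. module k P \<Longrightarrow> bil M N P f \<Longrightarrow> wsum P f L = wsum P f L') \<Longrightarrow> weq L L'"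
  by (simp add: weq_def)

lemma weqD:
  "weq L L' \<Longrightarrow> module k P \<Longrightarrow> bil M N P f \<Longrightarrow> wsum P f L = wsum P f L'"
  by (simp add: weq_def)

definition list_code :: "('u \<times> 'u) list \<Rightarrow> 'u" where "list_code = (SOME J. inj J)"

lemma inj_list_code: "inj list_code"
proof -
  obtain J :: "('u \<times> 'u) list \<Rightarrow> 'u" where "inj J" using infinite_list_inj[OF inf_univ] .
  then show ?thesis unfolding list_code_def by (rule someI[where P = inj])
qed

text \<open>An equivalence class is a set and cannot be an element of \<open>'u\<close>, so it is
  coded by one chosen member. That member need not be a word, because \<open>weq\<close> compares
  arbitrary lists; this is why \<open>rep\<close> chooses a word anew.\<close>

definition cls where "cls L = list_code (SOME L'. weq L L')"
definition rep where "rep u = (SOME L. word L \<and> cls L = u)"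

lemma cls_eq: "cls L = cls L' \<longleftrightarrow> weq L L'"
proof
  have refl: "weq L L" for L by (simp add: weq_def)
  assume "cls L = cls L'"
  then have "(SOME K. weq L K) = (SOME K. weq L' K)"
    unfolding cls_def using inj_list_code by (simp add: inj_eq)
  moreover have "weq L (SOME K. weq L K)" "weq L' (SOME K. weq L' K)"
    by (rule someI[of _ L], rule refl) (rule someI[of _ L'], rule refl)
  ultimately show "weq L L'" by (simp add: weq_def)
next
  assume "weq L L'"
  then have "weq L = weq L'" by (auto simp: weq_def fun_eq_iff)
  then show "cls L = cls L'" by (simp add: cls_def)
qed

lemma rep: "word L \<Longrightarrow> word (rep (cls L)) \<and> cls (rep (cls L)) = cls L"
  unfolding rep_def by (rule someI[of _ L]) simp

lemma word_simps [simp]: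
  "word []" "word ((x, y) # L) \<longleftrightarrow> x \<in> carrier M \<and> y \<in> carrier N \<and> word L"
  "word (L @ L') \<longleftrightarrow> word L \<and> word L'"
  by (auto simp: word_def)

lemma bil_closed: "bil M N P f \<Longrightarrow> x \<in> carrier M \<Longrightarrow> y \<in> carrier N \<Longrightarrow> f x y \<in> carrier P"
  using bil1 lin_closed by blast

lemma wsum_simps [simp]: "wsum P f [] = \<zero>\<^bsub>P\<^esub>" "wsum P f ((x, y) # L) = f x y \<oplus>\<^bsub>P\<^esub> wsum P f L"
  by (simp_all add: wsum_def)

lemma wsum_closed:
  assumes "module k P" "bil M N P f" "word L"
  shows "wsum P f L \<in> carrier P"
proof -
  interpret P: module k P by fact
  show ?thesis using assms(3)
  proof (induction L)
    case (Cons a L)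
    then show ?case by (cases a) (auto intro!: P.add.m_closed bil_closed[OF assms(2)])
  qed simp
qed

lemma wsum_append:
  assumes "module k P" "bil M N P f" "word L" "word L'"
  shows "wsum P f (L @ L') = wsum P f L \<oplus>\<^bsub>P\<^esub> wsum P f L'"
proof -
  interpret P: module k P by fact
  show ?thesis using assms(3)
  proof (induction L)
    case Nil
    show ?case using wsum_closed[OF assms(1,2,4)] by simp
  next
    case (Cons a L)
    then show ?case using assms
      by (cases a) (auto simp: P.add.m_assoc bil_closed wsum_closed)
  qed
qed

definition wscale where "wscale a L = map (\<lambda>(x, y). (a \<odot>\<^bsub>M\<^esub> x, y)) L"

lemma wscale_simps [simp]:
  "wscale a [] = []" "wscale a ((x, y) # L) = (a \<odot>\<^bsub>M\<^esub> x, y) # wscale a L"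
  by (simp_all add: wscale_def)

lemma word_wscale: "a \<in> carrier k \<Longrightarrow> word L \<Longrightarrow> word (wscale a L)"
proof (induction L)
  case (Cons p L)
  interpret M: module k M by (rule mod_M)
  from Cons show ?case by (cases p) auto
qed simp

lemma wsum_wscale:
  assumes "module k P" "bil M N P f" "word L" "a \<in> carrier k"
  shows "wsum P f (wscale a L) = a \<odot>\<^bsub>P\<^esub> wsum P f L"
proof -
  interpret P: module k P by fact
  show ?thesis using assms(3)
  proof (induction L)
    case Nil
    show ?case using assms(4) by simp
  next
    case (Cons p L)
    then show ?case using assms
      by (cases p)
        (auto simp: P.smult_r_distr bil_closed wsum_closed lin_smult[OF bil2[OF assms(2)]])
  qed
qed

definition wmod :: "('u, 'u) module" where
  "wmod = \<lparr>carrier = cls ` Collect word, mult = undefined, one = undefined, zero = cls [],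
     add = (\<lambda>u v. cls (rep u @ rep v)), smult = (\<lambda>a u. cls (wscale a (rep u)))\<rparr>"

lemma weq_rep: "word L \<Longrightarrow> weq (rep (cls L)) L"
  using rep cls_eq by blast

lemma wmod_add:
  assumes "word L" "word L'"
  shows "cls L \<oplus>\<^bsub>wmod\<^esub> cls L' = cls (L @ L')"
  unfolding wmod_def using assms
  by (auto simp: cls_eq rep wsum_append intro!: weqI weqD[OF weq_rep]
      arg_cong2[of _ _ _ _ "add _"])

lemma wmod_smult:
  assumes "word L" "a \<in> carrier k"
  shows "a \<odot>\<^bsub>wmod\<^esub> cls L = cls (wscale a L)"
  unfolding wmod_def using assms
  by (auto simp: cls_eq rep wsum_wscale intro!: weqI weqD[OF weq_rep]
      arg_cong2[of _ _ _ _ "smult _"])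

lemma wmod_zero: "\<zero>\<^bsub>wmod\<^esub> = cls []"
  by (simp add: wmod_def)

lemma carrier_wmod: "u \<in> carrier wmod \<longleftrightarrow> (\<exists>L. word L \<and> u = cls L)"
  by (auto simp: wmod_def)

lemma cls_in: "word L \<Longrightarrow> cls L \<in> carrier wmod"
  by (auto simp: carrier_wmod)

text \<open>An equation between classes is tested by each bilinear map \<open>f\<close> into a
  module \<open>P\<close>. Under \<open>wsum P f\<close>, concatenation becomes addition and
  \<open>wscale\<close> becomes scalar multiplication, so the axioms are inherited from all the
  modules \<open>P\<close>.\<close>

lemma module_wmod: "module k wmod"
proof -
  interpret k: cring k by (rule cring_k)
  have ag: "abelian_group wmod"
  proof (rule abelian_groupI)
    fix x assume "x \<in> carrier wmod"
    then obtain L where L: "word L" "x = cls L" by (auto simp: carrier_wmod)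
    \<comment> \<open>Formal sums carry no signs; scaling by minus one supplies the additive
      inverse.\<close>
    have "cls (wscale (\<ominus>\<^bsub>k\<^esub> \<one>\<^bsub>k\<^esub>) L) \<oplus>\<^bsub>wmod\<^esub> x = \<zero>\<^bsub>wmod\<^esub>"
      unfolding L(2) wmod_zero
    proof (subst wmod_add, simp_all add: L word_wscale cls_eq, rule weqI)
      fix P :: "('u, 'u) module" and f assume P: "module k P" "bil M N P f"
      interpret P: module k P by fact
      show "wsum P f (wscale (\<ominus>\<^bsub>k\<^esub> \<one>\<^bsub>k\<^esub>) L @ L) = wsum P f []"
        using P L wsum_closed[OF P L(1)]
        by (simp add: wsum_append word_wscale wsum_wscale P.smult_l_minus P.l_neg)
    qed
    then show "\<exists>y\<in>carrier wmod. y \<oplus>\<^bsub>wmod\<^esub> x = \<zero>\<^bsub>wmod\<^esub>"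
      using cls_in[OF word_wscale[OF _ L(1)]] by auto
  next
    fix x y assume "x \<in> carrier wmod" "y \<in> carrier wmod"
    then obtain L L' where L: "word L" "x = cls L" "word L'" "y = cls L'" by (auto simp: carrier_wmod)
    show "x \<oplus>\<^bsub>wmod\<^esub> y = y \<oplus>\<^bsub>wmod\<^esub> x"
      unfolding L
    proof (simp add: wmod_add L cls_eq, rule weqI)
      fix P :: "('u, 'u) module" and f assume P: "module k P" "bil M N P f"
      interpret P: module k P by fact
      show "wsum P f (L @ L') = wsum P f (L' @ L)"
        using P L wsum_closed[OF P]
        by (simp add: wsum_append P.a_comm)
    qed
  qed (auto simp: carrier_wmod wmod_zero wmod_add intro: exI[of _ "[]"] exI[of _ "_ @ _"])
  show ?thesis
  proof (rule moduleI[OF cring_k ag])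
    fix a b x assume ab: "a \<in> carrier k" "b \<in> carrier k" and "x \<in> carrier wmod"
    then obtain L where L: "word L" "x = cls L" by (auto simp: carrier_wmod)
    show "(a \<oplus>\<^bsub>k\<^esub> b) \<odot>\<^bsub>wmod\<^esub> x = a \<odot>\<^bsub>wmod\<^esub> x \<oplus>\<^bsub>wmod\<^esub> b \<odot>\<^bsub>wmod\<^esub> x"
      unfolding L
    proof (simp add: wmod_add wmod_smult word_wscale L cls_eq ab, rule weqI)
      fix P :: "('u, 'u) module" and f assume P: "module k P" "bil M N P f"
      interpret P: module k P by fact
      show "wsum P f (wscale (a \<oplus>\<^bsub>k\<^esub> b) L) = wsum P f (wscale a L @ wscale b L)"
        using P L ab by (simp add: wsum_append wsum_wscale wsum_closed word_wscale P.smult_l_distr)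
    qed
    show "(a \<otimes>\<^bsub>k\<^esub> b) \<odot>\<^bsub>wmod\<^esub> x = a \<odot>\<^bsub>wmod\<^esub> (b \<odot>\<^bsub>wmod\<^esub> x)"
      unfolding L
    proof (simp add: wmod_add wmod_smult word_wscale L cls_eq ab, rule weqI)
      fix P :: "('u, 'u) module" and f assume P: "module k P" "bil M N P f"
      interpret P: module k P by fact
      show "wsum P f (wscale (a \<otimes>\<^bsub>k\<^esub> b) L) = wsum P f (wscale a (wscale b L))"
        using P L ab by (simp add: wsum_append wsum_wscale wsum_closed word_wscale P.smult_assoc1)
    qed
  next
    fix a x assume a: "a \<in> carrier k" and "x \<in> carrier wmod"
    then obtain L where L: "word L" "x = cls L" by (auto simp: carrier_wmod)
    then show "a \<odot>\<^bsub>wmod\<^esub> x \<in> carrier wmod"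
      using a by (simp add: wmod_smult cls_in word_wscale)
  next
    fix a x y assume a: "a \<in> carrier k" and "x \<in> carrier wmod" "y \<in> carrier wmod"
    then obtain L L' where L: "word L" "x = cls L" "word L'" "y = cls L'" by (auto simp: carrier_wmod)
    show "a \<odot>\<^bsub>wmod\<^esub> (x \<oplus>\<^bsub>wmod\<^esub> y) = a \<odot>\<^bsub>wmod\<^esub> x \<oplus>\<^bsub>wmod\<^esub> a \<odot>\<^bsub>wmod\<^esub> y"
      unfolding L using L a
      by (simp add: wmod_add wmod_smult word_wscale) (simp add: wscale_def)
  next
    fix x assume "x \<in> carrier wmod"
    then obtain L where L: "word L" "x = cls L" by (auto simp: carrier_wmod)
    show "\<one>\<^bsub>k\<^esub> \<odot>\<^bsub>wmod\<^esub> x = x"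
      unfolding L
    proof (simp add: wmod_smult L cls_eq, rule weqI)
      fix P :: "('u, 'u) module" and f assume P: "module k P" "bil M N P f"
      interpret P: module k P by fact
      show "wsum P f (wscale \<one>\<^bsub>k\<^esub> L) = wsum P f L"
        using P L by (simp add: wsum_wscale wsum_closed)
    qed
  qed
qed

definition wtens where "wtens x y = cls [(x, y)]"

lemma bil_wtens: "bil M N wmod wtens"
proof (rule bilI)
  interpret M: module k M by (rule mod_M)
  interpret N: module k N by (rule mod_N)
  fix x assume x: "x \<in> carrier M"
  show "lin N wmod (wtens x)"
  proof (rule linI)
    fix y assume y: "y \<in> carrier N"
    show "wtens x y \<in> carrier wmod" using x y by (simp add: wtens_def cls_in)
    fix a assume a: "a \<in> carrier k"
    show "wtens x (a \<odot>\<^bsub>N\<^esub> y) = a \<odot>\<^bsub>wmod\<^esub> wtens x y"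
      unfolding wtens_def
    proof (simp add: wmod_smult x y a cls_eq, rule weqI)
      fix P :: "('u, 'u) module" and f assume P: "module k P" "bil M N P f"
      interpret P: module k P by fact
      show "wsum P f [(x, a \<odot>\<^bsub>N\<^esub> y)] = wsum P f [(a \<odot>\<^bsub>M\<^esub> x, y)]"
        using x y a by (simp add: lin_smult[OF bil2[OF P(2)]] lin_smult[OF bil1[OF P(2)]])
    qed
  next
    fix y y' assume y: "y \<in> carrier N" "y' \<in> carrier N"
    show "wtens x (y \<oplus>\<^bsub>N\<^esub> y') = wtens x y \<oplus>\<^bsub>wmod\<^esub> wtens x y'"
      unfolding wtens_def
    proof (simp add: wmod_add x y cls_eq, rule weqI)
      fix P :: "('u, 'u) module" and f assume P: "module k P" "bil M N P f"
      interpret P: module k P by fact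
      show "wsum P f [(x, y \<oplus>\<^bsub>N\<^esub> y')] = wsum P f [(x, y), (x, y')]"
        using x y P by (simp add: lin_add[OF bil1[OF P(2)]] bil_closed)
    qed
  qed
next
  interpret M: module k M by (rule mod_M)
  fix y assume y: "y \<in> carrier N"
  show "lin M wmod (\<lambda>x. wtens x y)"
  proof (rule linI)
    fix x assume x: "x \<in> carrier M"
    show "wtens x y \<in> carrier wmod" using x y by (simp add: wtens_def cls_in)
    fix a assume a: "a \<in> carrier k"
    show "wtens (a \<odot>\<^bsub>M\<^esub> x) y = a \<odot>\<^bsub>wmod\<^esub> wtens x y"
      unfolding wtens_def by (simp add: wmod_smult x y a cls_eq)
  next
    fix x x' assume x: "x \<in> carrier M" "x' \<in> carrier M"
    show "wtens (x \<oplus>\<^bsub>M\<^esub> x') y = wtens x y \<oplus>\<^bsub>wmod\<^esub> wtens x' y"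
      unfolding wtens_def
    proof (simp add: wmod_add x y cls_eq, rule weqI)
      fix P :: "('u, 'u) module" and f assume P: "module k P" "bil M N P f"
      interpret P: module k P by fact
      show "wsum P f [(x \<oplus>\<^bsub>M\<^esub> x', y)] = wsum P f [(x, y), (x', y)]"
        using x y P by (simp add: lin_add[OF bil2[OF P(2)]] bil_closed)
    qed
  qed
qed

text \<open>Every word is a concatenation of one-pair words, whose classes are the pure tensors, so
  linearity fixes \<open>g\<close>. This is the uniqueness half of the universal property.\<close>

lemma induced_cls:
  assumes "module k P" "induced_map k M N wmod wtens P f g" "word L"
  shows "g (cls L) = wsum P f L"
proof -
  interpret P: module k P by fact
  have g: "lin wmod P g" and gt: "\<And>x y. x \<in> carrier M \<Longrightarrow> y \<in> carrier N \<Longrightarrow> g (cls [(x, y)]) = f x y"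
    using assms(2) by (auto simp: induced_map_def wtens_def)
  show ?thesis using assms(3)
  proof (induction L)
    case Nil
    show ?case using lin_zero[OF module_wmod assms(1) g] by (simp add: wmod_zero)
  next
    case (Cons p L)
    obtain x y where p: "p = (x, y)" by (cases p)
    have "cls (p # L) = cls [(x, y)] \<oplus>\<^bsub>wmod\<^esub> cls L"
      using Cons.prems by (subst wmod_add) (auto simp: p)
    then show ?case using Cons g gt
      by (simp add: p lin_add cls_in)
  qed
qed

lemma is_tensor_product_wmod: "is_tensor_product k M N wmod wtens"
  unfolding is_tensor_product_def
proof (intro conjI allI impI)
  fix P :: "('u, 'u) module" and f
  assume "module k P \<and> bil M N P f"
  then have P: "module k P" "bil M N P f" by auto
  interpret P: module k P by (rule P)
  interpret M: module k M by (rule mod_M)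
  interpret N: module k N by (rule mod_N)
  \<comment> \<open>The choice made by \<open>rep\<close> does not matter: equivalent words have the
    same sum under every bilinear map, in particular under \<open>f\<close>.\<close>
  define g where "g = (\<lambda>u\<in>carrier wmod. wsum P f (rep u))"
  have g: "g (cls L) = wsum P f L" if "word L" for L
    using that P weqD[OF weq_rep[OF that]] by (simp add: g_def cls_in)
  have "lin wmod P g"
    by (rule linI)
      (auto simp: carrier_wmod g wsum_closed[OF P] wmod_add wmod_smult word_wscale
        wsum_append[OF P] wsum_wscale[OF P])
  then have ind: "induced_map k M N wmod wtens P f g"
    unfolding induced_map_def using bil_closed[OF P(2)]
    by (auto simp: wtens_def g) (simp add: g_def)
  show "\<exists>!g. induced_map k M N wmod wtens P f g"
  proof (rule ex1I)
    show "induced_map k M N wmod wtens P f g" by (rule ind)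
    fix g' assume g': "induced_map k M N wmod wtens P f g'"
    show "g' = g"
    proof (rule extensionalityI[of _ "carrier wmod"])
      show "g' \<in> extensional (carrier wmod)" using g' by (simp add: induced_map_def)
      show "g \<in> extensional (carrier wmod)" by (simp add: g_def)
      show "g' u = g u" if "u \<in> carrier wmod" for u
        using that induced_cls[OF P(1) g'] by (auto simp: carrier_wmod g)
    qed
  qed
qed (simp_all add: module_wmod bil_wtens)

end

section \<open>The chosen tensor product and the linear maps out of it\<close>

context tensor_base
begin

lemma tensor_product_is:
  assumes "module k M" "module k N"
  shows "is_tensor_product k M N (M \<boxtimes> N) (tens k M N)"
proof -
  interpret tensor_words k M N
    by (intro tensor_words.intro tensor_base_axioms tensor_words_axioms.intro assms)
  have "case tensor_product k M N of (T, t) \<Rightarrow> is_tensor_product k M N T t"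
    unfolding tensor_product_def by (rule someI[of _ "(wmod, wtens)"]) (simp add: is_tensor_product_wmod)
  then show ?thesis by (simp add: tmod_def tens_def case_prod_beta)
qed

lemma module_tensor: "module k M \<Longrightarrow> module k N \<Longrightarrow> module k (M \<boxtimes> N)"
  using tensor_product_is[of M N] by (simp add: is_tensor_product_def)

lemma bil_tens: "module k M \<Longrightarrow> module k N \<Longrightarrow> bil M N (M \<boxtimes> N) (tens k M N)"
  using tensor_product_is[of M N] by (simp add: is_tensor_product_def)

text \<open>The universal property in \<open>is_tensor_product\<close> speaks only of plain module
  records \<open>P\<close>, whereas algebras and \<open>H\<close>-modules are extended records.
  Truncation forgets the additional fields and leaves linearity unchanged, so the property reaches
  the extended records in \<open>ex1_induced\<close>.\<close>

lemma trunc_ops: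
  "carrier (module.truncate P) = carrier P" "add (module.truncate P) = add P"
  "zero (module.truncate P) = zero P" "smult (module.truncate P) = smult P"
  by (simp_all add: module.defs)

lemma module_trunc: "module k P \<Longrightarrow> module k (module.truncate P)"
proof -
  assume "module k P"
  then interpret P: module k P .
  have "abelian_group (module.truncate P)"
    by (rule abelian_groupI) (use P.M.l_neg in \<open>auto simp: trunc_ops P.M.a_assoc P.M.a_comm P.M.a_lcomm\<close>)
  then show ?thesis
    by (rule moduleI[OF cring_k])
      (simp_all add: trunc_ops P.smult_l_distr P.smult_r_distr P.smult_assoc1)
qed

lemma lin_trunc: "lin M (module.truncate P) = lin M P"
  by (simp add: linear_map_def trunc_ops fun_eq_iff)

lemma ex1_induced:
  fixes P :: "('u, 'u, 'p) module_scheme"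
  assumes "module k M" "module k N" "module k P" "bil M N P f"
  shows "\<exists>!g. induced_map k M N (M \<boxtimes> N) (tens k M N) P f g"
proof -
  have "module k (module.truncate P)" using assms(3) by (rule module_trunc)
  moreover have "bil M N (module.truncate P) f" using assms(4) by (simp add: bilinear_map_def lin_trunc)
  ultimately have "\<exists>!g. induced_map k M N (M \<boxtimes> N) (tens k M N) (module.truncate P) f g"
    using tensor_product_is[OF assms(1,2)] by (simp add: is_tensor_product_def)
  then show ?thesis by (simp add: induced_map_def lin_trunc)
qed

lemma induced_tlift:
  assumes "module k M" "module k N" "module k P" "bil M N P f"
  shows "induced_map k M N (M \<boxtimes> N) (tens k M N) P f (tlift k M N P f)"
  unfolding tlift_def using theI'[OF ex1_induced[OF assms]] .

lemma lin_tlift: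
  "module k M \<Longrightarrow> module k N \<Longrightarrow> module k P \<Longrightarrow> bil M N P f \<Longrightarrow> lin (M \<boxtimes> N) P (tlift k M N P f)"
  using induced_tlift by (auto simp: induced_map_def)

lemma tlift_tens:
  "module k M \<Longrightarrow> module k N \<Longrightarrow> module k P \<Longrightarrow> bil M N P f \<Longrightarrow> x \<in> carrier M \<Longrightarrow> y \<in> carrier N \<Longrightarrow>
    tlift k M N P f (tens k M N x y) = f x y"
  using induced_tlift[of M N P f] by (auto simp: induced_map_def)

lemma tlift_unique:
  assumes "module k M" "module k N" "module k P" "lin (M \<boxtimes> N) P g"
    and "\<And>x y. x \<in> carrier M \<Longrightarrow> y \<in> carrier N \<Longrightarrow> g (tens k M N x y) = f x y"
    and "bil M N P f" and "u \<in> carrier (M \<boxtimes> N)"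
  shows "g u = tlift k M N P f u"
proof -
  interpret T: module k "M \<boxtimes> N" by (rule module_tensor) fact+
  have t: "x \<in> carrier M \<Longrightarrow> y \<in> carrier N \<Longrightarrow> tens k M N x y \<in> carrier (M \<boxtimes> N)" for x y
    using bil1[OF bil_tens[OF assms(1,2)]] lin_closed by blast
  \<comment> \<open>An induced map is required to be extensional, which \<open>g\<close> need not
    be; its restriction is compared instead.\<close>
  have "lin (M \<boxtimes> N) P (restrict g (carrier (M \<boxtimes> N)))"
    using lin_cong[OF module_tensor[OF assms(1,2)]] assms(4) by (metis (no_types, lifting) restrict_apply')
  then have "induced_map k M N (M \<boxtimes> N) (tens k M N) P f (restrict g (carrier (M \<boxtimes> N)))"
    using assms(5) t by (simp add: induced_map_def)
  then have "restrict g (carrier (M \<boxtimes> N)) = tlift k M N P f"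
    using ex1_induced[OF assms(1-3,6)] induced_tlift[OF assms(1-3,6)] by blast
  then show ?thesis using assms(7) by (metis restrict_apply')
qed

text \<open>The description of the induced map looks at \<open>f\<close> only on the carriers, so
  both sides are the same definite description. The equality therefore holds for every
  \<open>u\<close>, and it serves as the congruence rule under a Sweedler sum.\<close>

lemma tlift_cong:
  assumes "\<And>m n. m \<in> carrier M \<Longrightarrow> n \<in> carrier N \<Longrightarrow> f m n = g m n"
  shows "tlift k M N P f u = tlift k M N P g u"
  using assms by (simp add: tlift_def induced_map_def cong: ball_cong)

end

section \<open>Calculus of induced maps\<close>

text \<open>The rules \<open>tc\<close> reduce membership, linearity and multilinearity of composite expressions to
  their parts; side conditions are discharged by \<open>(assumption | rule tc)+\<close>.\<close>

named_theorems tc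

context tensor_base
begin

abbreviation tl where "tl \<equiv> tlift k"
abbreviation K where "K \<equiv> ring_as_module k"

lemma module_K [tc]: "module k K"
proof -
  interpret k: cring k by (rule cring_k)
  show ?thesis
    by (rule moduleI[OF cring_k abelian_groupI])
      (auto simp: ring_as_module_def k.a_assoc k.a_comm k.a_lcomm k.m_assoc k.l_distr k.r_distr intro: k.l_neg k.a_inv_closed)
qed

lemma carrier_K [simp]: "carrier K = carrier k"
  by (simp add: ring_as_module_def)

lemma in_K [tc]: "x \<in> carrier k \<Longrightarrow> x \<in> carrier K"
  by simp

declare bilI [tc] module_tensor [tc]

lemma tens_closed [tc]:
  "module k M \<Longrightarrow> module k N \<Longrightarrow> m \<in> carrier M \<Longrightarrow> n \<in> carrier N \<Longrightarrow> tens k M N m n \<in> carrier (M \<boxtimes> N)"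
  using bil1[OF bil_tens] lin_closed by blast

lemma tl_closed [tc]:
  "module k M \<Longrightarrow> module k N \<Longrightarrow> module k P \<Longrightarrow> bil M N P f \<Longrightarrow> u \<in> carrier (M \<boxtimes> N) \<Longrightarrow>
    tl M N P f u \<in> carrier P"
  using lin_tlift lin_closed by blast

lemma tl_K_closed [tc]:
  "module k M \<Longrightarrow> module k N \<Longrightarrow> bil M N K f \<Longrightarrow> u \<in> carrier (M \<boxtimes> N) \<Longrightarrow> tl M N K f u \<in> carrier k"
  using tl_closed[OF _ _ module_K] by simp

lemma smult_in [tc]: "module k M \<Longrightarrow> a \<in> carrier k \<Longrightarrow> x \<in> carrier M \<Longrightarrow> a \<odot>\<^bsub>M\<^esub> x \<in> carrier M"
  by (rule module.smult_closed)

lemma mult_k_in [tc]: "a \<in> carrier k \<Longrightarrow> b \<in> carrier k \<Longrightarrow> a \<otimes>\<^bsub>k\<^esub> b \<in> carrier k"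
  using cring_k by (simp add: cring.cring_simprules)

lemma lin_id [tc]: "lin M M (\<lambda>x. x)"
  by (simp add: linear_map_def)

lemma lin_comp: "lin N P f \<Longrightarrow> lin M N g \<Longrightarrow> lin M P (\<lambda>x. f (g x))"
  by (simp add: linear_map_def Pi_iff)

lemma bil_1: "bil M N P f \<Longrightarrow> lin Q M g \<Longrightarrow> n \<in> carrier N \<Longrightarrow> lin Q P (\<lambda>x. f (g x) n)"
  using lin_comp[OF bil2] .

lemma bil_2: "bil M N P f \<Longrightarrow> m \<in> carrier M \<Longrightarrow> lin Q N g \<Longrightarrow> lin Q P (\<lambda>x. f m (g x))"
  using lin_comp[OF bil1] .

lemma bil_in: "bil M N P f \<Longrightarrow> x \<in> carrier M \<Longrightarrow> y \<in> carrier N \<Longrightarrow> f x y \<in> carrier P"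
  using bil1 lin_closed by blast

lemma lin_tens1 [tc]:
  "module k M \<Longrightarrow> module k N \<Longrightarrow> lin Q M f \<Longrightarrow> n \<in> carrier N \<Longrightarrow> lin Q (M \<boxtimes> N) (\<lambda>x. tens k M N (f x) n)"
  by (rule bil_1[OF bil_tens])

lemma lin_tens2 [tc]:
  "module k M \<Longrightarrow> module k N \<Longrightarrow> lin Q N f \<Longrightarrow> m \<in> carrier M \<Longrightarrow> lin Q (M \<boxtimes> N) (\<lambda>x. tens k M N m (f x))"
  by (rule bil_2[OF bil_tens])

lemma bil_smult: "module k M \<Longrightarrow> bil K M M (smult M)"
proof -
  assume "module k M"
  then interpret module k M .
  show ?thesis
    by (intro bilI linI)
      (auto simp: ring_as_module_def smult_r_distr smult_l_distr smult_assoc1[symmetric] R.m_comm)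
qed

lemma lin_smult1 [tc]: "module k M \<Longrightarrow> lin Q K f \<Longrightarrow> m \<in> carrier M \<Longrightarrow> lin Q M (\<lambda>x. f x \<odot>\<^bsub>M\<^esub> m)"
  by (rule bil_1[OF bil_smult])

lemma lin_smult2 [tc]: "module k M \<Longrightarrow> a \<in> carrier k \<Longrightarrow> lin Q M f \<Longrightarrow> lin Q M (\<lambda>x. a \<odot>\<^bsub>M\<^esub> f x)"
  by (rule bil_2[OF bil_smult]) simp_all

lemma smult_K: "smult K = mult k"
  by (simp add: ring_as_module_def)

lemma lin_mult_k1 [tc]: "lin Q K f \<Longrightarrow> b \<in> carrier k \<Longrightarrow> lin Q K (\<lambda>x. f x \<otimes>\<^bsub>k\<^esub> b)"
  using lin_smult1[OF module_K] by (simp add: smult_K)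

lemma lin_mult_k2 [tc]: "a \<in> carrier k \<Longrightarrow> lin Q K f \<Longrightarrow> lin Q K (\<lambda>x. a \<otimes>\<^bsub>k\<^esub> f x)"
  using lin_smult2[OF module_K] by (simp add: smult_K)

lemma lin_tl1 [tc]:
  "module k M \<Longrightarrow> module k N \<Longrightarrow> module k P \<Longrightarrow> bil M N P f \<Longrightarrow> lin Q (M \<boxtimes> N) g \<Longrightarrow>
    lin Q P (\<lambda>x. tl M N P f (g x))"
  by (rule lin_comp[OF lin_tlift])

lemma lin_ext:
  assumes "module k M" "module k N" "module k P" "lin (M \<boxtimes> N) P f" "lin (M \<boxtimes> N) P g"
    and "\<And>x y. x \<in> carrier M \<Longrightarrow> y \<in> carrier N \<Longrightarrow> f (tens k M N x y) = g (tens k M N x y)"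
    and "u \<in> carrier (M \<boxtimes> N)"
  shows "f u = g u"
proof -
  have b: "bil M N P (\<lambda>x y. f (tens k M N x y))"
    by (intro tc lin_comp[OF assms(4)] assms)
  show ?thesis
    using tlift_unique[OF assms(1-4) _ b assms(7)] tlift_unique[OF assms(1-3,5) _ b assms(7)] assms(6)
    by simp
qed

lemma lin_sum:
  assumes "module k P" "lin Q P f" "lin Q P g"
  shows "lin Q P (\<lambda>x. f x \<oplus>\<^bsub>P\<^esub> g x)"
proof -
  interpret module k P by fact
  show ?thesis
    using assms(2,3)
    by (intro linI) (auto simp: lin_closed lin_add lin_smult smult_r_distr M.a_ac)
qed

text \<open>Both sides are linear in \<open>u\<close> and agree on pure tensors. In Sweedler
  notation: a linear map may be moved under the summation sign.\<close>

lemma tl_push: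
  assumes "module k M" "module k N" "module k P" "module k Q" "lin P Q g" "bil M N P f"
    and "u \<in> carrier (M \<boxtimes> N)"
  shows "g (tl M N P f u) = tl M N Q (\<lambda>m n. g (f m n)) u"
proof -
  have b: "bil M N Q (\<lambda>m n. g (f m n))"
    by (intro tc lin_comp[OF assms(5)] bil_1[OF assms(6)] bil_2[OF assms(6)])
  show ?thesis
    by (rule tlift_unique) (simp_all add: assms tlift_tens b, intro tc lin_comp[OF assms(5)] assms)
qed

text \<open>By uniqueness, the map induced by a sum or a multiple is the sum or the multiple of
  induced maps. With this rule and \<open>lin_tl1\<close> the rules \<open>tc\<close> can descend
  through nested Sweedler sums in either argument.\<close>

lemma lin_tl2 [tc]:
  assumes "module k M" "module k N" "module k P"
    and "\<And>m n. m \<in> carrier M \<Longrightarrow> n \<in> carrier N \<Longrightarrow> lin Q P (\<lambda>x. f x m n)"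
    and "\<And>x. x \<in> carrier Q \<Longrightarrow> bil M N P (f x)"
    and "u \<in> carrier (M \<boxtimes> N)"
    and "module k Q"
  shows "lin Q P (\<lambda>x. tl M N P (f x) u)"
proof (rule linI)
  interpret P: module k P by fact
  interpret Q: module k Q by fact
  show "tl M N P (f x) u \<in> carrier P" if "x \<in> carrier Q" for x
    using that by (intro tc assms)
  show "tl M N P (f (x \<oplus>\<^bsub>Q\<^esub> y)) u = tl M N P (f x) u \<oplus>\<^bsub>P\<^esub> tl M N P (f y) u"
    if "x \<in> carrier Q" "y \<in> carrier Q" for x y
  proof (rule tlift_unique[symmetric])
    show "lin (M \<boxtimes> N) P (\<lambda>u. tl M N P (f x) u \<oplus>\<^bsub>P\<^esub> tl M N P (f y) u)"
      using that by (intro tc lin_sum assms)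
    show "bil M N P (f (x \<oplus>\<^bsub>Q\<^esub> y))" using that by (intro assms) auto
  qed (use assms that in \<open>auto simp: tlift_tens lin_add[OF assms(4)]\<close>)
  show "tl M N P (f (a \<odot>\<^bsub>Q\<^esub> x)) u = a \<odot>\<^bsub>P\<^esub> tl M N P (f x) u"
    if "a \<in> carrier k" "x \<in> carrier Q" for a x
  proof (rule tlift_unique[symmetric])
    show "lin (M \<boxtimes> N) P (\<lambda>u. a \<odot>\<^bsub>P\<^esub> tl M N P (f x) u)"
      using that by (intro tc assms)
    show "bil M N P (f (a \<odot>\<^bsub>Q\<^esub> x))" using that by (intro assms) auto
  qed (use assms that in \<open>auto simp: tlift_tens lin_smult[OF assms(4)]\<close>)
qed

text \<open>Independent Sweedler sums may be interchanged: both sides are linear in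
  \<open>u\<close>, and on a pure tensor the sum over \<open>u\<close> disappears.\<close>

lemma tl_swap:
  assumes "module k M" "module k N" "module k P" "module k A" "module k B"
    and "\<And>m n. m \<in> carrier M \<Longrightarrow> n \<in> carrier N \<Longrightarrow> bil A B P (f m n)"
    and "\<And>a b. a \<in> carrier A \<Longrightarrow> b \<in> carrier B \<Longrightarrow> bil M N P (\<lambda>m n. f m n a b)"
    and "u \<in> carrier (M \<boxtimes> N)" "v \<in> carrier (A \<boxtimes> B)"
  shows "tl M N P (\<lambda>m n. tl A B P (f m n) v) u = tl A B P (\<lambda>a b. tl M N P (\<lambda>m n. f m n a b) u) v"
proof (rule tlift_unique[symmetric])
  have *: "bil A B P (\<lambda>a b. tl M N P (\<lambda>m n. f m n a b) u)" if "u \<in> carrier (M \<boxtimes> N)" for u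
    by (intro tc bil_1[OF assms(6)] bil_2[OF assms(6)] assms that)
  show "lin (M \<boxtimes> N) P (\<lambda>u. tl A B P (\<lambda>a b. tl M N P (\<lambda>m n. f m n a b) u) v)"
    by (intro tc * bil_1[OF assms(6)] bil_2[OF assms(6)] assms)
  show "bil M N P (\<lambda>m n. tl A B P (f m n) v)"
    by (intro tc assms bil_1[OF assms(7)] bil_2[OF assms(7)])
  show "tl A B P (\<lambda>a b. tl M N P (\<lambda>m n. f m n a b) (tens k M N x y)) v = tl A B P (f x y) v"
    if "x \<in> carrier M" "y \<in> carrier N" for x y
    using that assms by (intro tlift_cong) (simp add: tlift_tens)
qed (fact assms)+

definition tri where
  "tri A B C P F \<longleftrightarrow>
    (\<forall>b\<in>carrier B. \<forall>c\<in>carrier C. lin A P (\<lambda>a. F a b c)) \<and>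
    (\<forall>a\<in>carrier A. \<forall>c\<in>carrier C. lin B P (\<lambda>b. F a b c)) \<and>
    (\<forall>a\<in>carrier A. \<forall>b\<in>carrier B. lin C P (\<lambda>c. F a b c))"

lemma triI [tc]:
  assumes "\<And>b c. b \<in> carrier B \<Longrightarrow> c \<in> carrier C \<Longrightarrow> lin A P (\<lambda>a. F a b c)"
    and "\<And>a c. a \<in> carrier A \<Longrightarrow> c \<in> carrier C \<Longrightarrow> lin B P (\<lambda>b. F a b c)"
    and "\<And>a b. a \<in> carrier A \<Longrightarrow> b \<in> carrier B \<Longrightarrow> lin C P (\<lambda>c. F a b c)"
  shows "tri A B C P F"
  using assms by (simp add: tri_def)

lemma tri_1: "tri A B C P F \<Longrightarrow> lin Q A g \<Longrightarrow> b \<in> carrier B \<Longrightarrow> c \<in> carrier C \<Longrightarrow> lin Q P (\<lambda>x. F (g x) b c)"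
  by (rule lin_comp[of A _ "\<lambda>a. F a b c"]) (simp_all add: tri_def)
lemma tri_2: "tri A B C P F \<Longrightarrow> lin Q B g \<Longrightarrow> a \<in> carrier A \<Longrightarrow> c \<in> carrier C \<Longrightarrow> lin Q P (\<lambda>x. F a (g x) c)"
  by (rule lin_comp[of B _ "\<lambda>b. F a b c"]) (simp_all add: tri_def)
lemma tri_3: "tri A B C P F \<Longrightarrow> lin Q C g \<Longrightarrow> a \<in> carrier A \<Longrightarrow> b \<in> carrier B \<Longrightarrow> lin Q P (\<lambda>x. F a b (g x))"
  by (rule lin_comp[of C _ "\<lambda>c. F a b c"]) (simp_all add: tri_def)

lemma tri_in: "tri A B C P F \<Longrightarrow> a \<in> carrier A \<Longrightarrow> b \<in> carrier B \<Longrightarrow> c \<in> carrier C \<Longrightarrow> F a b c \<in> carrier P"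
  using lin_closed[of A P "\<lambda>a. F a b c" a] by (simp add: tri_def)

lemmas tri_tc = tri_1 tri_2 tri_3 tri_in
lemmas bil_tc = bil_1 bil_2 bil_in

definition t3 where
  "t3 A B C P F = tl A (B \<boxtimes> C) P (\<lambda>a. tl B C P (\<lambda>b c. F a b c))"

lemma lin_t3:
  assumes "module k A" "module k B" "module k C" "module k P" "tri A B C P F"
  shows "lin (A \<boxtimes> B \<boxtimes> C) P (t3 A B C P F)"
  unfolding t3_def by (intro tc assms tri_tc[OF assms(5)])

lemma t3_tens:
  assumes "module k A" "module k B" "module k C" "module k P" "tri A B C P F"
    and "a \<in> carrier A" "b \<in> carrier B" "c \<in> carrier C"
  shows "t3 A B C P F (tens k A (B \<boxtimes> C) a (tens k B C b c)) = F a b c"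
proof -
  have "bil A (B \<boxtimes> C) P (\<lambda>a. tl B C P (\<lambda>b c. F a b c))"
    by (intro tc assms tri_tc[OF assms(5)])
  moreover have "bil B C P (F a)"
    by (intro tc assms tri_tc[OF assms(5)])
  ultimately show ?thesis
    unfolding t3_def using assms by (simp add: tlift_tens module_tensor tens_closed)
qed

lemma t3_tens1:
  assumes "module k A" "module k B" "module k C" "module k P" "tri A B C P F"
    and "a \<in> carrier A" "v \<in> carrier (B \<boxtimes> C)"
  shows "t3 A B C P F (tens k A (B \<boxtimes> C) a v) = tl B C P (F a) v"
proof -
  have "bil A (B \<boxtimes> C) P (\<lambda>a. tl B C P (\<lambda>b c. F a b c))"
    by (intro tc assms tri_tc[OF assms(5)])
  moreover have "bil B C P (F a)"
    by (intro tc assms tri_tc[OF assms(5)])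
  ultimately show ?thesis
    unfolding t3_def using assms by (simp add: tlift_tens module_tensor tens_closed)
qed

lemma lin_ext3:
  assumes "module k A" "module k B" "module k C" "module k P"
    and f: "lin (A \<boxtimes> B \<boxtimes> C) P f" and g: "lin (A \<boxtimes> B \<boxtimes> C) P g"
    and "\<And>x y z. x \<in> carrier A \<Longrightarrow> y \<in> carrier B \<Longrightarrow> z \<in> carrier C \<Longrightarrow>
      f (tens k A (B \<boxtimes> C) x (tens k B C y z)) = g (tens k A (B \<boxtimes> C) x (tens k B C y z))"
    and "u \<in> carrier (A \<boxtimes> B \<boxtimes> C)"
  shows "f u = g u"
proof (rule lin_ext[OF assms(1) _ assms(4) f g _ assms(8)])
  fix x v assume x: "x \<in> carrier A" and v: "v \<in> carrier (B \<boxtimes> C)"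
  show "f (tens k A (B \<boxtimes> C) x v) = g (tens k A (B \<boxtimes> C) x v)"
    by (rule lin_ext[where f = "\<lambda>v. f (tens k A (B \<boxtimes> C) x v)", OF assms(2,3,4) _ _ _ v])
      (intro tc lin_comp[OF f] lin_comp[OF g] assms x | assumption)+
qed (intro tc assms)

lemma linear_map_cong_dom:
  assumes "carrier M = carrier M'"
    and "\<And>x y. x \<in> carrier M \<Longrightarrow> y \<in> carrier M \<Longrightarrow> x \<oplus>\<^bsub>M\<^esub> y = x \<oplus>\<^bsub>M'\<^esub> y"
    and "\<And>a x. a \<in> carrier k \<Longrightarrow> x \<in> carrier M \<Longrightarrow> a \<odot>\<^bsub>M\<^esub> x = a \<odot>\<^bsub>M'\<^esub> x"
  shows "lin M N = lin M' N"
  using assms by (auto simp: linear_map_def fun_eq_iff)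

lemma linear_map_cong_cod:
  assumes "carrier M = carrier M'"
    and "\<And>x y. x \<in> carrier M \<Longrightarrow> y \<in> carrier M \<Longrightarrow> x \<oplus>\<^bsub>M\<^esub> y = x \<oplus>\<^bsub>M'\<^esub> y"
    and "\<And>a x. a \<in> carrier k \<Longrightarrow> x \<in> carrier M \<Longrightarrow> a \<odot>\<^bsub>M\<^esub> x = a \<odot>\<^bsub>M'\<^esub> x"
  shows "lin N M = lin N M'"
  using assms by (auto simp: linear_map_def fun_eq_iff Pi_iff)

text \<open>The choice of a tensor product is made from a predicate that sees a factor only through
  its carrier and its operations there. Modules that agree on the carrier hence have literally equal
  tensor products. This identifies \<open>regular\<close> with \<open>H\<close>, although the two
  records differ.\<close>

lemma tensor_cong1:
  fixes M :: "('u, 'u, 'm) module_scheme" and M' :: "('u, 'u, 'n) module_scheme"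
    and N :: "('u, 'u, 'p) module_scheme"
  assumes "carrier M = carrier M'"
    and "\<And>x y. x \<in> carrier M \<Longrightarrow> y \<in> carrier M \<Longrightarrow> x \<oplus>\<^bsub>M\<^esub> y = x \<oplus>\<^bsub>M'\<^esub> y"
    and "\<And>a x. a \<in> carrier k \<Longrightarrow> x \<in> carrier M \<Longrightarrow> a \<odot>\<^bsub>M\<^esub> x = a \<odot>\<^bsub>M'\<^esub> x"
  shows "M \<boxtimes> N = M' \<boxtimes> N" "tens k M N = tens k M' N"
    "tlift k M N (P :: ('u, 'u, 'q) module_scheme) f = tlift k M' N P f"
    "N \<boxtimes> M = N \<boxtimes> M'" "tens k N M = tens k N M'" "tlift k N M P f = tlift k N M' P f"
proof -
  have l: "lin M (Q :: ('u, 'u, 'r) module_scheme) = lin M' Q" for Q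
    by (rule linear_map_cong_dom) (fact assms)+
  have b: "bil M N (Q :: ('u, 'u, 'r) module_scheme) = bil M' N Q"
     "bil N M Q = bil N M' Q" for Q
    by (simp_all add: bilinear_map_def fun_eq_iff l assms(1))
  have i: "induced_map k M N T t (Q :: ('u, 'u, 'r) module_scheme) = induced_map k M' N T t Q"
     "induced_map k N M T t Q = induced_map k N M' T t Q" for T t Q
    by (simp_all add: induced_map_def fun_eq_iff assms(1))
  have "is_tensor_product k M N T t = is_tensor_product k M' N T t"
    "is_tensor_product k N M T t = is_tensor_product k N M' T t" for T t
    by (simp_all add: is_tensor_product_def b i)
  then have tp: "tensor_product k M N = tensor_product k M' N" "tensor_product k N M = tensor_product k N M'"
    by (simp_all add: tensor_product_def)
  show tt: "M \<boxtimes> N = M' \<boxtimes> N" "tens k M N = tens k M' N" "N \<boxtimes> M = N \<boxtimes> M'" "tens k N M = tens k N M'"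
    by (simp_all add: tmod_def tens_def tp)
  show "tlift k M N P f = tlift k M' N P f" "tlift k N M P f = tlift k N M' P f"
    unfolding tlift_def tt i by (rule refl)+
qed

end

section \<open>Weak bialgebras\<close>

locale weak_bialg = tensor_base k for k :: "'u ring" +
  fixes H :: "'u bialgebra" (structure)
  assumes wb: "weak_bialgebra k H"
begin

abbreviation D where "D \<equiv> comult H"
abbreviation eps where "eps \<equiv> counit H"
abbreviation SW where "SW P f h \<equiv> tlift k H H P f (comult H h)"
abbreviation et where "et \<equiv> eps_t k H"
abbreviation es where "es \<equiv> eps_s k H"
abbreviation esb where "esb \<equiv> eps_s_bar k H"

lemma ua: "unital_algebra k H" and co: "coalgebra k H"
  using wb by (simp_all add: weak_bialgebra_def)

lemma module_H [tc]: "module k H"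
  using ua by (simp add: unital_algebra_def)

lemma ring_H: "ring H"
  using ua by (simp add: unital_algebra_def)

lemma bil_mult: "bil H H H (mult H)"
  using ua by (simp add: unital_algebra_def)

lemma mult_in [tc]: "a \<in> carrier H \<Longrightarrow> b \<in> carrier H \<Longrightarrow> a \<otimes> b \<in> carrier H"
  by (rule bil_in[OF bil_mult])

lemma one_in [tc]: "\<one> \<in> carrier H"
  using ring.ring_simprules(6)[OF ring_H] .

lemma mult_assoc: "a \<in> carrier H \<Longrightarrow> b \<in> carrier H \<Longrightarrow> c \<in> carrier H \<Longrightarrow> a \<otimes> b \<otimes> c = a \<otimes> (b \<otimes> c)"
  using monoid.m_assoc[OF ring.axioms(2)[OF ring_H]] .

lemma one_mult [simp]: "a \<in> carrier H \<Longrightarrow> \<one> \<otimes> a = a" "a \<in> carrier H \<Longrightarrow> a \<otimes> \<one> = a"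
  using monoid.l_one[OF ring.axioms(2)[OF ring_H]] monoid.r_one[OF ring.axioms(2)[OF ring_H]] by auto

lemma lin_mult1 [tc]: "lin Q H f \<Longrightarrow> b \<in> carrier H \<Longrightarrow> lin Q H (\<lambda>x. f x \<otimes> b)"
  by (rule bil_1[OF bil_mult])

lemma lin_mult2 [tc]: "lin Q H f \<Longrightarrow> a \<in> carrier H \<Longrightarrow> lin Q H (\<lambda>x. a \<otimes> f x)"
  by (rule bil_2[OF bil_mult])

lemma lin_D: "lin H (H \<boxtimes> H) D" and lin_eps: "lin H K eps"
  using co by (simp_all add: coalgebra_def)

lemma lin_D' [tc]: "lin Q H f \<Longrightarrow> lin Q (H \<boxtimes> H) (\<lambda>x. D (f x))"
  by (rule lin_comp[OF lin_D])

lemma lin_eps' [tc]: "lin Q H f \<Longrightarrow> lin Q K (\<lambda>x. eps (f x))"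
  by (rule lin_comp[OF lin_eps])

lemma D_in [tc]: "h \<in> carrier H \<Longrightarrow> D h \<in> carrier (H \<boxtimes> H)"
  by (rule lin_closed[OF lin_D])

lemma eps_in [tc]: "h \<in> carrier H \<Longrightarrow> eps h \<in> carrier k"
  using lin_closed[OF lin_eps] by simp

lemma mult_k_comm: "a \<in> carrier k \<Longrightarrow> b \<in> carrier k \<Longrightarrow> a \<otimes>\<^bsub>k\<^esub> b = b \<otimes>\<^bsub>k\<^esub> a"
  using cring_k by (simp add: cring.cring_simprules)

lemma smult_smult:
  "module k P \<Longrightarrow> a \<in> carrier k \<Longrightarrow> b \<in> carrier k \<Longrightarrow> x \<in> carrier P \<Longrightarrow>
    (a \<otimes>\<^bsub>k\<^esub> b) \<odot>\<^bsub>P\<^esub> x = a \<odot>\<^bsub>P\<^esub> (b \<odot>\<^bsub>P\<^esub> x)"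
  using module.smult_assoc1 by metis

lemma smult_comm:
  "module k P \<Longrightarrow> a \<in> carrier k \<Longrightarrow> b \<in> carrier k \<Longrightarrow> x \<in> carrier P \<Longrightarrow>
    a \<odot>\<^bsub>P\<^esub> (b \<odot>\<^bsub>P\<^esub> x) = b \<odot>\<^bsub>P\<^esub> (a \<odot>\<^bsub>P\<^esub> x)"
  by (metis smult_smult mult_k_comm)

lemma bil_smult_out:
  assumes "bil M N P F" "a \<in> carrier k" "x \<in> carrier M" "y \<in> carrier N"
  shows "F (a \<odot>\<^bsub>M\<^esub> x) y = a \<odot>\<^bsub>P\<^esub> F x y" "F x (a \<odot>\<^bsub>N\<^esub> y) = a \<odot>\<^bsub>P\<^esub> F x y"
  using assms lin_smult[OF bil1[OF assms(1)]] lin_smult[OF bil2[OF assms(1)]] by auto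

lemma SW_push:
  assumes "lin P Q g" "bil H H P f" "module k P" "module k Q" "h \<in> carrier H"
  shows "g (SW P f h) = SW Q (\<lambda>a b. g (f a b)) h"
  by (rule tl_push) (assumption | rule tc assms)+

abbreviation HHH where "HHH \<equiv> H \<boxtimes> (H \<boxtimes> H)"

text \<open>The bialgebra axioms are equations in the threefold tensor product. Applying the map
  induced by \<open>F\<close> turns them into iterated Sweedler sums of values of \<open>F\<close>.
  The parameter \<open>h\<close> is the element that is comultiplied second: a leg in the
  coassociativity law, \<open>\<one>\<close> in the axioms for the unit.\<close>

lemma t3_SW2:
  assumes F: "tri H H H P F" and P: "module k P" and g: "g \<in> carrier H"
    and h: "\<And>a b. a \<in> carrier H \<Longrightarrow> b \<in> carrier H \<Longrightarrow> h a b \<in> carrier H"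
    and X: "\<And>a b c d. a \<in> carrier H \<Longrightarrow> b \<in> carrier H \<Longrightarrow> c \<in> carrier H \<Longrightarrow> d \<in> carrier H \<Longrightarrow>
       x a b c d \<in> carrier H \<and> y a b c d \<in> carrier H \<and> z a b c d \<in> carrier H"
    and b1: "bil H H HHH (\<lambda>a b. SW HHH (\<lambda>c d. tens k H (H \<boxtimes> H) (x a b c d) (tens k H H (y a b c d) (z a b c d))) (h a b))"
    and b2: "\<And>a b. a \<in> carrier H \<Longrightarrow> b \<in> carrier H \<Longrightarrow>
      bil H H HHH (\<lambda>c d. tens k H (H \<boxtimes> H) (x a b c d) (tens k H H (y a b c d) (z a b c d)))"
  shows "t3 H H H P F (SW HHH (\<lambda>a b. SW HHH (\<lambda>c d. tens k H (H \<boxtimes> H) (x a b c d) (tens k H H (y a b c d) (z a b c d))) (h a b)) g)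
    = SW P (\<lambda>a b. SW P (\<lambda>c d. F (x a b c d) (y a b c d) (z a b c d)) (h a b)) g"
proof -
  have l: "lin HHH P (t3 H H H P F)" by (rule lin_t3) (assumption | rule tc F P)+
  show ?thesis
    by (rule trans[OF SW_push[OF l b1 _ P g]], (rule tc)+, rule tlift_cong, rule trans[OF SW_push[OF l b2 _ P h]],
      assumption+, (rule tc)+, assumption+, rule tlift_cong) (use X F P in \<open>simp add: t3_tens module_H\<close>)
qed

lemma coassoc:
  assumes F: "tri H H H P F" and P: "module k P" and h: "h \<in> carrier H"
  shows "SW P (\<lambda>a b. SW P (\<lambda>c d. F c d b) a) h = SW P (\<lambda>a b. SW P (\<lambda>c d. F a c d) b) h"
proof -
  have l: "lin HHH P (t3 H H H P F)" by (rule lin_t3) (assumption | rule tc F P)+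
  have "SW P (\<lambda>a b. SW P (\<lambda>c d. F c d b) a) h =
    t3 H H H P F (SW HHH (\<lambda>a b. SW HHH (\<lambda>c d. tens k H (H \<boxtimes> H) c (tens k H H d b)) a) h)"
    by (rule t3_SW2[symmetric]) (assumption | rule tc F P h conjI)+
  also have "(SW HHH (\<lambda>a b. SW HHH (\<lambda>c d. tens k H (H \<boxtimes> H) c (tens k H H d b)) a) h)
      = SW HHH (\<lambda>a b. tens k H (H \<boxtimes> H) a (D b)) h"
    using co h by (simp add: coalgebra_def sweedler_def)
  also have "t3 H H H P F \<dots> = SW P (\<lambda>a b. t3 H H H P F (tens k H (H \<boxtimes> H) a (D b))) h"
    by (rule SW_push[OF l]) (assumption | rule tc h P)+
  also have "\<dots> = SW P (\<lambda>a b. SW P (\<lambda>c d. F a c d) b) h"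
    by (rule tlift_cong) (simp add: t3_tens1 F P module_H D_in)
  finally show ?thesis .
qed

text \<open>In the axioms the first leg of \<Delta>(1) is comultiplied; coassociativity moves this
  to the second leg, which is the form used from here on.\<close>

lemma one_ax:
  assumes F: "tri H H H P F" and P: "module k P"
  shows "SW P (\<lambda>a b. SW P (\<lambda>c d. F a c d) b) \<one> = SW P (\<lambda>a b. SW P (\<lambda>c d. F a (b \<otimes> c) d) \<one>) \<one>"
    "SW P (\<lambda>a b. SW P (\<lambda>c d. F a c d) b) \<one> = SW P (\<lambda>a b. SW P (\<lambda>c d. F a (c \<otimes> b) d) \<one>) \<one>"
proof -
  have 0: "SW P (\<lambda>a b. SW P (\<lambda>c d. F a c d) b) \<one> =
    t3 H H H P F (SW HHH (\<lambda>a b. SW HHH (\<lambda>c d. tens k H (H \<boxtimes> H) c (tens k H H d b)) a) \<one>)"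
    by (subst t3_SW2) (assumption | rule tc F P conjI coassoc[symmetric])+
  have 1: "SW P (\<lambda>a b. SW P (\<lambda>c d. F a (b \<otimes> c) d) \<one>) \<one> =
    t3 H H H P F (SW HHH (\<lambda>a b. SW HHH (\<lambda>c d. tens k H (H \<boxtimes> H) a (tens k H H (b \<otimes> c) d)) \<one>) \<one>)"
    by (rule t3_SW2[symmetric]) (assumption | rule tc F P conjI)+
  have 2: "SW P (\<lambda>a b. SW P (\<lambda>c d. F a (c \<otimes> b) d) \<one>) \<one> =
    t3 H H H P F (SW HHH (\<lambda>a b. SW HHH (\<lambda>c d. tens k H (H \<boxtimes> H) a (tens k H H (c \<otimes> b) d)) \<one>) \<one>)"
    by (rule t3_SW2[symmetric]) (assumption | rule tc F P conjI)+
  show "SW P (\<lambda>a b. SW P (\<lambda>c d. F a c d) b) \<one> = SW P (\<lambda>a b. SW P (\<lambda>c d. F a (b \<otimes> c) d) \<one>) \<one>"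
    unfolding 0 1 by (rule arg_cong) (use wb in \<open>unfold weak_bialgebra_def sweedler_def, blast\<close>)
  show "SW P (\<lambda>a b. SW P (\<lambda>c d. F a c d) b) \<one> = SW P (\<lambda>a b. SW P (\<lambda>c d. F a (c \<otimes> b) d) \<one>) \<one>"
    unfolding 0 2 by (rule arg_cong) (use wb in \<open>unfold weak_bialgebra_def sweedler_def, blast\<close>)
qed

lemma counit1:
  assumes f: "lin H P f" and P: "module k P" and h: "h \<in> carrier H"
  shows "SW P (\<lambda>a b. eps a \<odot>\<^bsub>P\<^esub> f b) h = f h"
proof -
  have "f h = f (SW H (\<lambda>a b. eps a \<odot> b) h)"
    using co h by (simp add: coalgebra_def sweedler_def)
  also have "\<dots> = SW P (\<lambda>a b. f (eps a \<odot> b)) h"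
    by (rule SW_push[OF f]) (assumption | rule tc h P)+
  also have "\<dots> = SW P (\<lambda>a b. eps a \<odot>\<^bsub>P\<^esub> f b) h"
    by (rule tlift_cong) (simp add: lin_smult[OF f] eps_in)
  finally show ?thesis by simp
qed

lemma counit2:
  assumes f: "lin H P f" and P: "module k P" and h: "h \<in> carrier H"
  shows "SW P (\<lambda>a b. eps b \<odot>\<^bsub>P\<^esub> f a) h = f h"
proof -
  have "f h = f (SW H (\<lambda>a b. eps b \<odot> a) h)"
    using co h by (simp add: coalgebra_def sweedler_def)
  also have "\<dots> = SW P (\<lambda>a b. f (eps b \<odot> a)) h"
    by (rule SW_push[OF f]) (assumption | rule tc h P)+
  also have "\<dots> = SW P (\<lambda>a b. eps b \<odot>\<^bsub>P\<^esub> f a) h"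
    by (rule tlift_cong) (simp add: lin_smult[OF f] eps_in)
  finally show ?thesis by simp
qed

lemma SW_mult:
  assumes F: "bil H H P F" and P: "module k P" and g: "g \<in> carrier H" and h: "h \<in> carrier H"
  shows "SW P F (g \<otimes> h) = SW P (\<lambda>a b. SW P (\<lambda>c d. F (a \<otimes> c) (b \<otimes> d)) h) g"
proof -
  have l: "lin (H \<boxtimes> H) P (tl H H P F)" by (intro lin_tlift tc F P)
  have "D (g \<otimes> h) = SW (H \<boxtimes> H) (\<lambda>a b. SW (H \<boxtimes> H) (\<lambda>c d. tens k H H (a \<otimes> c) (b \<otimes> d)) h) g"
    using wb g h by (simp add: weak_bialgebra_def sweedler_def)
  then have "SW P F (g \<otimes> h) = tl H H P F (SW (H \<boxtimes> H) (\<lambda>a b. SW (H \<boxtimes> H) (\<lambda>c d. tens k H H (a \<otimes> c) (b \<otimes> d)) h) g)"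
    by simp
  also have "\<dots> = SW P (\<lambda>a b. tl H H P F (SW (H \<boxtimes> H) (\<lambda>c d. tens k H H (a \<otimes> c) (b \<otimes> d)) h)) g"
    by (rule SW_push[OF l]) (assumption | rule tc g h P)+
  also have "\<dots> = SW P (\<lambda>a b. SW P (\<lambda>c d. tl H H P F (tens k H H (a \<otimes> c) (b \<otimes> d))) h) g"
    by (rule tlift_cong, rule SW_push[OF l]) (assumption | rule tc g h P)+
  also have "\<dots> = SW P (\<lambda>a b. SW P (\<lambda>c d. F (a \<otimes> c) (b \<otimes> d)) h) g"
    by (intro tlift_cong) (simp add: tlift_tens module_H F P mult_in)
  finally show ?thesis .
qed

lemma eps_mult:
  assumes "f \<in> carrier H" "g \<in> carrier H" "h \<in> carrier H"
  shows "eps (f \<otimes> g \<otimes> h) = SW K (\<lambda>a b. eps (f \<otimes> a) \<otimes>\<^bsub>k\<^esub> eps (b \<otimes> h)) g"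
    "eps (f \<otimes> g \<otimes> h) = SW K (\<lambda>a b. eps (f \<otimes> b) \<otimes>\<^bsub>k\<^esub> eps (a \<otimes> h)) g"
  using wb assms unfolding weak_bialgebra_def sweedler_def by blast+

section \<open>The counital maps\<close>

lemma et_push:
  assumes f: "lin H P f" and P: "module k P" and h: "h \<in> carrier H"
  shows "f (et h) = SW P (\<lambda>a b. eps (a \<otimes> h) \<odot>\<^bsub>P\<^esub> f b) \<one>"
proof -
  have "f (et h) = SW P (\<lambda>a b. f (eps (a \<otimes> h) \<odot> b)) \<one>"
    unfolding eps_t_def sweedler_def by (rule SW_push[OF f]) (assumption | rule tc h P)+
  also have "\<dots> = SW P (\<lambda>a b. eps (a \<otimes> h) \<odot>\<^bsub>P\<^esub> f b) \<one>"
    by (rule tlift_cong) (simp add: lin_smult[OF f] eps_in mult_in h)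
  finally show ?thesis .
qed

lemma es_push:
  assumes f: "lin H P f" and P: "module k P" and h: "h \<in> carrier H"
  shows "f (es h) = SW P (\<lambda>a b. eps (h \<otimes> b) \<odot>\<^bsub>P\<^esub> f a) \<one>"
proof -
  have "f (es h) = SW P (\<lambda>a b. f (eps (h \<otimes> b) \<odot> a)) \<one>"
    unfolding eps_s_def sweedler_def by (rule SW_push[OF f]) (assumption | rule tc h P)+
  also have "\<dots> = SW P (\<lambda>a b. eps (h \<otimes> b) \<odot>\<^bsub>P\<^esub> f a) \<one>"
    by (rule tlift_cong) (simp add: lin_smult[OF f] eps_in mult_in h)
  finally show ?thesis .
qed

lemma esb_push:
  assumes f: "lin H P f" and P: "module k P" and h: "h \<in> carrier H"
  shows "f (esb h) = SW P (\<lambda>a b. eps (b \<otimes> h) \<odot>\<^bsub>P\<^esub> f a) \<one>"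
proof -
  have "f (esb h) = SW P (\<lambda>a b. f (eps (b \<otimes> h) \<odot> a)) \<one>"
    unfolding eps_s_bar_def sweedler_def by (rule SW_push[OF f]) (assumption | rule tc h P)+
  also have "\<dots> = SW P (\<lambda>a b. eps (b \<otimes> h) \<odot>\<^bsub>P\<^esub> f a) \<one>"
    by (rule tlift_cong) (simp add: lin_smult[OF f] eps_in mult_in h)
  finally show ?thesis .
qed

lemma lin_et: "lin H H et" and lin_es: "lin H H es" and lin_esb: "lin H H esb"
  unfolding eps_t_def[abs_def] eps_s_def[abs_def] eps_s_bar_def[abs_def] sweedler_def by (assumption | rule tc)+

lemma lin_et' [tc]: "lin Q H f \<Longrightarrow> lin Q H (\<lambda>x. et (f x))"
  by (rule lin_comp[OF lin_et])
lemma lin_es' [tc]: "lin Q H f \<Longrightarrow> lin Q H (\<lambda>x. es (f x))"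
  by (rule lin_comp[OF lin_es])
lemma lin_esb' [tc]: "lin Q H f \<Longrightarrow> lin Q H (\<lambda>x. esb (f x))"
  by (rule lin_comp[OF lin_esb])
lemma et_in [tc]: "h \<in> carrier H \<Longrightarrow> et h \<in> carrier H"
  by (rule lin_closed[OF lin_et])
lemma es_in [tc]: "h \<in> carrier H \<Longrightarrow> es h \<in> carrier H"
  by (rule lin_closed[OF lin_es])
lemma esb_in [tc]: "h \<in> carrier H \<Longrightarrow> esb h \<in> carrier H"
  by (rule lin_closed[OF lin_esb])

text \<open>This is weak multiplicativity of the counit with \<open>\<one>\<close> in the middle.
  The crossed version is the right one, because \<open>et\<close> pairs \<open>h\<close> with the
  first leg of \<Delta>(1) and returns the second. The same version yields
  \<open>eps_es_mult\<close>.\<close>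

lemma eps_mult_et:
  assumes g: "g \<in> carrier H" and h: "h \<in> carrier H"
  shows "eps (g \<otimes> et h) = eps (g \<otimes> h)"
proof -
  have "eps (g \<otimes> et h) = SW K (\<lambda>a b. eps (a \<otimes> h) \<odot>\<^bsub>K\<^esub> eps (g \<otimes> b)) \<one>"
    by (rule et_push[where f = "\<lambda>x. eps (g \<otimes> x)"]) (assumption | rule tc g h)+
  also have "\<dots> = SW K (\<lambda>a b. eps (g \<otimes> b) \<otimes>\<^bsub>k\<^esub> eps (a \<otimes> h)) \<one>"
    by (rule tlift_cong) (simp add: smult_K mult_k_comm eps_in mult_in g h)
  also have "\<dots> = eps (g \<otimes> h)"
    using eps_mult(2)[OF g one_in h] g by simp
  finally show ?thesis .
qed

lemma eps_es_mult:
  assumes g: "g \<in> carrier H" and h: "h \<in> carrier H"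
  shows "eps (es g \<otimes> h) = eps (g \<otimes> h)"
proof -
  have "eps (es g \<otimes> h) = SW K (\<lambda>a b. eps (g \<otimes> b) \<odot>\<^bsub>K\<^esub> eps (a \<otimes> h)) \<one>"
    by (rule es_push[where f = "\<lambda>x. eps (x \<otimes> h)"]) (assumption | rule tc g h)+
  also have "\<dots> = eps (g \<otimes> h)"
    using eps_mult(2)[OF g one_in h] g by (simp add: smult_K)
  finally show ?thesis .
qed

lemma et_mult_et:
  assumes g: "g \<in> carrier H" and h: "h \<in> carrier H"
  shows "et (g \<otimes> et h) = et (g \<otimes> h)"
  unfolding eps_t_def[of _ _ "g \<otimes> et h"] eps_t_def[of _ _ "g \<otimes> h"] sweedler_def
  by (rule tlift_cong) (simp add: mult_assoc[symmetric] eps_mult_et mult_in g h et_in)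

lemma es_es_mult:
  assumes g: "g \<in> carrier H" and h: "h \<in> carrier H"
  shows "es (es g \<otimes> h) = es (g \<otimes> h)"
  unfolding eps_s_def[of _ _ "es g \<otimes> h"] eps_s_def[of _ _ "g \<otimes> h"] sweedler_def
  by (rule tlift_cong) (simp add: mult_assoc eps_es_mult mult_in g h es_in)

lemma et_et: "h \<in> carrier H \<Longrightarrow> et (et h) = et h"
  using et_mult_et[OF one_in] by (simp add: et_in)

lemma et_one: "et \<one> = \<one>"
proof -
  have "et \<one> = SW H (\<lambda>a b. eps a \<odot> b) \<one>"
    unfolding eps_t_def sweedler_def by (rule tlift_cong) simp
  then show ?thesis using counit1[OF lin_id module_H one_in] by simp
qed

lemma es_one: "es \<one> = \<one>"
proof -
  have "es \<one> = SW H (\<lambda>a b. eps b \<odot> a) \<one>"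
    unfolding eps_s_def sweedler_def by (rule tlift_cong) simp
  then show ?thesis using counit2[OF lin_id module_H one_in] by simp
qed

lemma esb_one: "esb \<one> = \<one>"
proof -
  have "esb \<one> = SW H (\<lambda>a b. eps b \<odot> a) \<one>"
    unfolding eps_s_bar_def sweedler_def by (rule tlift_cong) simp
  then show ?thesis using counit2[OF lin_id module_H one_in] by simp
qed

text \<open>By definition \<open>\<Delta>(\<epsilon>\<^sub>t(h)) = \<epsilon>(1\<^sub>1 h) 1\<^sub>2
  \<otimes> 1\<^sub>3\<close>. The two axioms for the unit split the middle leg into a product of
  legs of two copies of \<Delta>(1), in either order, which puts \<open>et h\<close> on the right or
  on the left of the first leg.\<close>

lemma SW_et:
  assumes F: "bil H H P F" and P: "module k P" and h: "h \<in> carrier H"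
  shows "SW P F (et h) = SW P (\<lambda>a b. F (a \<otimes> et h) b) \<one>"
    "SW P F (et h) = SW P (\<lambda>a b. F (et h \<otimes> a) b) \<one>"
proof -
  note tcs = tc bil_tc[OF F] P h
  let ?G = "\<lambda>a c d. eps (a \<otimes> h) \<odot>\<^bsub>P\<^esub> F c d"
  have G: "tri H H H P ?G" by (assumption | rule tcs)+
  have "SW P F (et h) = SW P (\<lambda>a b. eps (a \<otimes> h) \<odot>\<^bsub>P\<^esub> SW P F b) \<one>"
    by (rule et_push[where f = "\<lambda>x. SW P F x"]) (assumption | rule tcs)+
  also have "\<dots> = SW P (\<lambda>a b. SW P (\<lambda>c d. ?G a c d) b) \<one>"
    by (rule tlift_cong, rule SW_push[where g = "\<lambda>x. _ \<odot>\<^bsub>P\<^esub> x"]) (assumption | rule tcs)+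
  finally have 1: "SW P F (et h) = SW P (\<lambda>a b. SW P (\<lambda>c d. ?G a c d) b) \<one>" .
  have "SW P (\<lambda>a b. F (et h \<otimes> a) b) \<one> = SW P (\<lambda>c d. SW P (\<lambda>a b. ?G a (b \<otimes> c) d) \<one>) \<one>"
    by (rule tlift_cong, rule et_push[where f = "\<lambda>x. F (x \<otimes> _) _"]) (assumption | rule tcs)+
  also have "\<dots> = SW P (\<lambda>a b. SW P (\<lambda>c d. ?G a (b \<otimes> c) d) \<one>) \<one>"
    by (rule tl_swap) (assumption | rule tcs)+
  finally show "SW P F (et h) = SW P (\<lambda>a b. F (et h \<otimes> a) b) \<one>"
    using 1 one_ax(1)[OF G P] by simp
  have "SW P (\<lambda>a b. F (a \<otimes> et h) b) \<one> = SW P (\<lambda>c d. SW P (\<lambda>a b. ?G a (c \<otimes> b) d) \<one>) \<one>"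
    by (rule tlift_cong, rule et_push[where f = "\<lambda>x. F (_ \<otimes> x) _"]) (assumption | rule tcs)+
  also have "\<dots> = SW P (\<lambda>a b. SW P (\<lambda>c d. ?G a (c \<otimes> b) d) \<one>) \<one>"
    by (rule tl_swap) (assumption | rule tcs)+
  finally show "SW P F (et h) = SW P (\<lambda>a b. F (a \<otimes> et h) b) \<one>"
    using 1 one_ax(2)[OF G P] by simp
qed

text \<open>After \<open>SW_et\<close> the remaining copy of the unit is absorbed by
  \<open>\<Delta>(g)\<Delta>(1) = \<Delta>(g)\<close>.\<close>

lemma SW_mult_et:
  assumes F: "bil H H P F" and P: "module k P" and g: "g \<in> carrier H" and h: "h \<in> carrier H"
  shows "SW P F (g \<otimes> et h) = SW P (\<lambda>a b. F (a \<otimes> et h) b) g"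
proof -
  note tcs = tc bil_tc[OF F] P g h
  have "SW P F (g \<otimes> et h) = SW P (\<lambda>a b. SW P (\<lambda>c d. F (a \<otimes> c) (b \<otimes> d)) (et h)) g"
    by (rule SW_mult) (assumption | rule tcs F)+
  also have "\<dots> = SW P (\<lambda>a b. SW P (\<lambda>c d. F (a \<otimes> (c \<otimes> et h)) (b \<otimes> d)) \<one>) g"
    by (rule tlift_cong, rule SW_et(1)[where F = "\<lambda>c d. F (_ \<otimes> c) (_ \<otimes> d)"]) (assumption | rule tcs)+
  also have "\<dots> = SW P (\<lambda>a b. SW P (\<lambda>c d. F ((a \<otimes> c) \<otimes> et h) (b \<otimes> d)) \<one>) g"
    by (intro tlift_cong) (simp add: mult_assoc et_in h)
  also have "\<dots> = SW P (\<lambda>a b. F (a \<otimes> et h) b) (g \<otimes> \<one>)"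
    by (rule SW_mult[symmetric]) (assumption | rule tcs)+
  finally show ?thesis using g by simp
qed

text \<open>Apply the counit to the first leg of \<open>\<Delta>(g \<epsilon>\<^sub>t(h)) =
  g\<^sub>1 \<epsilon>\<^sub>t(h) \<otimes> g\<^sub>2\<close>.\<close>

lemma mult_et:
  assumes g: "g \<in> carrier H" and h: "h \<in> carrier H"
  shows "g \<otimes> et h = SW H (\<lambda>a b. eps (a \<otimes> h) \<odot> b) g"
proof -
  have "g \<otimes> et h = SW H (\<lambda>a b. eps a \<odot> b) (g \<otimes> et h)"
    by (rule counit1[symmetric]) (assumption | rule tc g h)+
  also have "\<dots> = SW H (\<lambda>a b. eps (a \<otimes> et h) \<odot> b) g"
    by (rule SW_mult_et) (assumption | rule tc g h)+
  also have "\<dots> = SW H (\<lambda>a b. eps (a \<otimes> h) \<odot> b) g"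
    by (rule tlift_cong) (simp add: eps_mult_et h)
  finally show ?thesis .
qed

text \<open>Both sides equal \<open>\<epsilon>(g\<^sub>2 h) \<epsilon>\<^sub>t(g\<^sub>1) \<otimes>
  g\<^sub>3\<close>: on the left by \<open>mult_et\<close>, on the right by weak multiplicativity of
  the counit. The identity moves an element of \<open>H\<^sub>t\<close> from one tensor factor to
  the other; the unit constraint and the inverse of the half-braiding depend on it.\<close>

lemma SW_et_transfer:
  assumes F: "bil H H P F" and P: "module k P" and g: "g \<in> carrier H" and h: "h \<in> carrier H"
  shows "SW P (\<lambda>a b. F (et a) (b \<otimes> et h)) g = SW P (\<lambda>a b. F (et (a \<otimes> h)) b) g"
proof -
  note tcs = tc bil_tc[OF F] P g h
  have F2: "F x (b \<otimes> et h) = SW P (\<lambda>c d. eps (c \<otimes> h) \<odot>\<^bsub>P\<^esub> F x d) b"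
    if x: "x \<in> carrier H" and b: "b \<in> carrier H" for x b
  proof -
    have "F x (b \<otimes> et h) = SW P (\<lambda>c d. F x (eps (c \<otimes> h) \<odot> d)) b"
      unfolding mult_et[OF b h] by (rule SW_push[where g = "F x"]) (assumption | rule tcs bil1[OF F] x b)+
    also have "\<dots> = SW P (\<lambda>c d. eps (c \<otimes> h) \<odot>\<^bsub>P\<^esub> F x d) b"
      by (rule tlift_cong) (simp add: bil_smult_out[OF F] eps_in mult_in h x)
    finally show ?thesis .
  qed
  have F1: "F (et (a \<otimes> h)) b = SW P (\<lambda>c d. eps (d \<otimes> h) \<odot>\<^bsub>P\<^esub> F (et c) b) a"
    if a: "a \<in> carrier H" and b: "b \<in> carrier H" for a b
  proof -
    note tcs = tcs a b
    have "F (et (a \<otimes> h)) b = SW P (\<lambda>p q. eps (p \<otimes> (a \<otimes> h)) \<odot>\<^bsub>P\<^esub> F q b) \<one>"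
      by (rule et_push[where f = "\<lambda>x. F x b"]) (assumption | rule tcs)+
    also have "\<dots> = SW P (\<lambda>p q. SW P (\<lambda>c d. eps (d \<otimes> h) \<odot>\<^bsub>P\<^esub> (eps (p \<otimes> c) \<odot>\<^bsub>P\<^esub> F q b)) a) \<one>"
    proof (rule tlift_cong)
      fix p q assume p: "p \<in> carrier H" and q: "q \<in> carrier H"
      have "eps (p \<otimes> (a \<otimes> h)) \<odot>\<^bsub>P\<^esub> F q b
          = SW K (\<lambda>c d. eps (p \<otimes> c) \<otimes>\<^bsub>k\<^esub> eps (d \<otimes> h)) a \<odot>\<^bsub>P\<^esub> F q b"
        using eps_mult(1)[OF p a h] p a h by (simp add: mult_assoc)
      also have "\<dots> = SW P (\<lambda>c d. (eps (p \<otimes> c) \<otimes>\<^bsub>k\<^esub> eps (d \<otimes> h)) \<odot>\<^bsub>P\<^esub> F q b) a"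
        by (rule SW_push[where g = "\<lambda>x. x \<odot>\<^bsub>P\<^esub> F q b"]) (assumption | rule tcs p q)+
      also have "\<dots> = SW P (\<lambda>c d. eps (d \<otimes> h) \<odot>\<^bsub>P\<^esub> (eps (p \<otimes> c) \<odot>\<^bsub>P\<^esub> F q b)) a"
        by (rule tlift_cong)
          (simp add: mult_k_comm[of "eps (p \<otimes> _)"] smult_smult P eps_in mult_in p q b h bil_in[OF F])
      finally show "eps (p \<otimes> (a \<otimes> h)) \<odot>\<^bsub>P\<^esub> F q b
        = SW P (\<lambda>c d. eps (d \<otimes> h) \<odot>\<^bsub>P\<^esub> (eps (p \<otimes> c) \<odot>\<^bsub>P\<^esub> F q b)) a" .
    qed
    also have "\<dots> = SW P (\<lambda>c d. SW P (\<lambda>p q. eps (d \<otimes> h) \<odot>\<^bsub>P\<^esub> (eps (p \<otimes> c) \<odot>\<^bsub>P\<^esub> F q b)) \<one>) a"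
      by (rule tl_swap) (assumption | rule tcs)+
    also have "\<dots> = SW P (\<lambda>c d. eps (d \<otimes> h) \<odot>\<^bsub>P\<^esub> F (et c) b) a"
      by (rule tlift_cong, rule et_push[where f = "\<lambda>x. _ \<odot>\<^bsub>P\<^esub> F x b", symmetric, THEN trans[rotated]])
        (assumption | rule tcs | simp add: smult_comm P eps_in mult_in b h bil_in[OF F] cong: tlift_cong)+
    finally show ?thesis .
  qed
  have "SW P (\<lambda>a b. F (et a) (b \<otimes> et h)) g = SW P (\<lambda>a b. SW P (\<lambda>c d. eps (c \<otimes> h) \<odot>\<^bsub>P\<^esub> F (et a) d) b) g"
    by (rule tlift_cong) (simp add: F2 et_in)
  also have "\<dots> = SW P (\<lambda>a b. SW P (\<lambda>c d. eps (d \<otimes> h) \<odot>\<^bsub>P\<^esub> F (et c) b) a) g"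
    by (rule coassoc[symmetric]) (assumption | rule tcs)+
  also have "\<dots> = SW P (\<lambda>a b. F (et (a \<otimes> h)) b) g"
    by (rule tlift_cong) (simp add: F1)
  finally show ?thesis .
qed

lemma SW_es:
  assumes F: "bil H H P F" and P: "module k P" and h: "h \<in> carrier H"
  shows "SW P F (es h) = SW P (\<lambda>a b. F a (es h \<otimes> b)) \<one>"
proof -
  note tcs = tc bil_tc[OF F] P h
  let ?G = "\<lambda>c d b. eps (h \<otimes> b) \<odot>\<^bsub>P\<^esub> F c d"
  have G: "tri H H H P ?G" by (assumption | rule tcs)+
  have "SW P F (es h) = SW P (\<lambda>a b. eps (h \<otimes> b) \<odot>\<^bsub>P\<^esub> SW P F a) \<one>"
    by (rule es_push[where f = "\<lambda>x. SW P F x"]) (assumption | rule tcs)+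
  also have "\<dots> = SW P (\<lambda>a b. SW P (\<lambda>c d. ?G c d b) a) \<one>"
    by (rule tlift_cong, rule SW_push[where g = "\<lambda>x. _ \<odot>\<^bsub>P\<^esub> x"]) (assumption | rule tcs)+
  also have "\<dots> = SW P (\<lambda>a b. SW P (\<lambda>c d. ?G a (c \<otimes> b) d) \<one>) \<one>"
    using coassoc[OF G P one_in] one_ax(2)[OF G P] by simp
  also have "\<dots> = SW P (\<lambda>a b. F a (es h \<otimes> b)) \<one>"
    by (rule tlift_cong, rule es_push[where f = "\<lambda>x. F _ (x \<otimes> _)", symmetric]) (assumption | rule tcs)+
  finally show ?thesis .
qed

lemma SW_es_mult:
  assumes F: "bil H H P F" and P: "module k P" and g: "g \<in> carrier H" and h: "h \<in> carrier H"
  shows "SW P F (es h \<otimes> g) = SW P (\<lambda>a b. F a (es h \<otimes> b)) g"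
proof -
  note tcs = tc bil_tc[OF F] P g h
  have "SW P F (es h \<otimes> g) = SW P (\<lambda>a b. SW P (\<lambda>c d. F (a \<otimes> c) (b \<otimes> d)) g) (es h)"
    by (rule SW_mult) (assumption | rule tcs F)+
  also have "\<dots> = SW P (\<lambda>a b. SW P (\<lambda>c d. F (a \<otimes> c) ((es h \<otimes> b) \<otimes> d)) g) \<one>"
    by (rule SW_es[where F = "\<lambda>a b. SW P (\<lambda>c d. F (a \<otimes> c) (b \<otimes> d)) g"]) (assumption | rule tcs)+
  also have "\<dots> = SW P (\<lambda>a b. SW P (\<lambda>c d. F (a \<otimes> c) (es h \<otimes> (b \<otimes> d))) g) \<one>"
    by (intro tlift_cong) (simp add: mult_assoc es_in h)
  also have "\<dots> = SW P (\<lambda>a b. F a (es h \<otimes> b)) (\<one> \<otimes> g)"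
    by (rule SW_mult[symmetric]) (assumption | rule tcs)+
  finally show ?thesis using g by simp
qed

text \<open>Expanding both maps over two copies of \<Delta>(1), the two products differ only in the
  order of the inner legs, \<open>1\<^sub>2 1\<^sub>1'\<close> against
  \<open>1\<^sub>1' 1\<^sub>2\<close>. The two axioms for the unit say that this order is
  irrelevant.\<close>

lemma es_et_commute:
  assumes g: "g \<in> carrier H" and h: "h \<in> carrier H"
  shows "es g \<otimes> et h = et h \<otimes> es g"
proof -
  let ?F = "\<lambda>a x d. eps (a \<otimes> h) \<odot> (eps (g \<otimes> d) \<odot> x)"
  have F: "tri H H H H ?F" by (assumption | rule tc g h)+
  have "et h \<otimes> es g = SW H (\<lambda>a b. eps (a \<otimes> h) \<odot> (b \<otimes> es g)) \<one>"
    by (rule et_push[where f = "\<lambda>x. x \<otimes> es g"]) (assumption | rule tc g h)+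
  also have "\<dots> = SW H (\<lambda>a b. SW H (\<lambda>c d. eps (g \<otimes> d) \<odot> (eps (a \<otimes> h) \<odot> (b \<otimes> c))) \<one>) \<one>"
    by (rule tlift_cong, rule es_push[where f = "\<lambda>x. _ \<odot> (_ \<otimes> x)"]) (assumption | rule tc g h)+
  also have "\<dots> = SW H (\<lambda>a b. SW H (\<lambda>c d. ?F a (b \<otimes> c) d) \<one>) \<one>"
    by (intro tlift_cong) (simp add: smult_comm module_H eps_in mult_in g h)
  also have "\<dots> = SW H (\<lambda>a b. SW H (\<lambda>c d. ?F a (c \<otimes> b) d) \<one>) \<one>"
    using one_ax[OF F module_H] by simp
  also have "\<dots> = SW H (\<lambda>a b. SW H (\<lambda>c d. eps (g \<otimes> d) \<odot> (eps (a \<otimes> h) \<odot> (c \<otimes> b))) \<one>) \<one>"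
    by (intro tlift_cong) (simp add: smult_comm module_H eps_in mult_in g h)
  also have "\<dots> = SW H (\<lambda>a b. eps (a \<otimes> h) \<odot> (es g \<otimes> b)) \<one>"
    by (rule tlift_cong, rule es_push[where f = "\<lambda>x. _ \<odot> (x \<otimes> _)", symmetric]) (assumption | rule tc g h)+
  also have "\<dots> = es g \<otimes> et h"
    by (rule et_push[where f = "\<lambda>x. es g \<otimes> x", symmetric]) (assumption | rule tc g h)+
  finally show ?thesis by simp
qed

text \<open>The counit hidden in \<open>es\<close> falls on the middle leg of
  \<open>1\<^sub>1 \<otimes> 1\<^sub>2 \<otimes> 1\<^sub>3\<close> and is absorbed there. Together
  with \<open>SW_one_et\<close> this says that \<Delta>(1) lies in the image of
  \<open>H\<^sub>s \<otimes> H\<^sub>t\<close>.\<close>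

lemma SW_one_es:
  assumes F: "bil H H P F" and P: "module k P"
  shows "SW P (\<lambda>a b. F (es a) b) \<one> = SW P F \<one>"
proof -
  note tcs = tc bil_tc[OF F] P
  let ?G = "\<lambda>a x d. eps x \<odot>\<^bsub>P\<^esub> F a d"
  have G: "tri H H H P ?G" by (assumption | rule tcs)+
  have "SW P (\<lambda>a b. F (es a) b) \<one> = SW P (\<lambda>c d. SW P (\<lambda>a b. ?G a (c \<otimes> b) d) \<one>) \<one>"
    by (rule tlift_cong, rule es_push[where f = "\<lambda>x. F x _"]) (assumption | rule tcs)+
  also have "\<dots> = SW P (\<lambda>a b. SW P (\<lambda>c d. ?G a (c \<otimes> b) d) \<one>) \<one>"
    by (rule tl_swap) (assumption | rule tcs)+
  also have "\<dots> = SW P (\<lambda>a b. SW P (\<lambda>c d. ?G a c d) b) \<one>"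
    using one_ax[OF G P] by simp
  also have "\<dots> = SW P (\<lambda>a b. F a b) \<one>"
    by (rule tlift_cong, rule counit1) (assumption | rule tcs bil1[OF F])+
  finally show ?thesis .
qed

lemma SW_one_et:
  assumes F: "bil H H P F" and P: "module k P"
  shows "SW P (\<lambda>a b. F a (et b)) \<one> = SW P F \<one>"
proof -
  note tcs = tc bil_tc[OF F] P
  let ?G = "\<lambda>a x d. eps x \<odot>\<^bsub>P\<^esub> F a d"
  have G: "tri H H H P ?G" by (assumption | rule tcs)+
  have "SW P (\<lambda>a b. F a (et b)) \<one> = SW P (\<lambda>a b. SW P (\<lambda>c d. ?G a (c \<otimes> b) d) \<one>) \<one>"
    by (rule tlift_cong, rule et_push[where f = "\<lambda>x. F _ x"]) (assumption | rule tcs bil1[OF F])+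
  also have "\<dots> = SW P (\<lambda>a b. SW P (\<lambda>c d. ?G a c d) b) \<one>"
    using one_ax[OF G P] by simp
  also have "\<dots> = SW P (\<lambda>a b. F a b) \<one>"
    by (rule tlift_cong, rule counit1) (assumption | rule tcs bil1[OF F])+
  finally show ?thesis .
qed

end

section \<open>Weak Hopf algebras\<close>

locale weak_hopf = weak_bialg k H for k :: "'u ring" and H :: "'u bialgebra" (structure) +
  fixes S :: "'u \<Rightarrow> 'u"
  assumes antipode: "is_antipode k H S"
begin

lemma lin_S: "lin H H S"
  using antipode by (simp add: is_antipode_def)

lemma lin_S' [tc]: "lin Q H f \<Longrightarrow> lin Q H (\<lambda>x. S (f x))"
  by (rule lin_comp[OF lin_S])

lemma S_in [tc]: "h \<in> carrier H \<Longrightarrow> S h \<in> carrier H"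
  by (rule lin_closed[OF lin_S])

lemma antipode_es: "h \<in> carrier H \<Longrightarrow> SW H (\<lambda>a b. S a \<otimes> b) h = es h"
  and antipode_et: "h \<in> carrier H \<Longrightarrow> SW H (\<lambda>a b. a \<otimes> S b) h = et h"
  and antipode_S: "h \<in> carrier H \<Longrightarrow> SW H (\<lambda>a b. SW H (\<lambda>c d. S a \<otimes> c \<otimes> S d) b) h = S h"
  using antipode unfolding is_antipode_def sweedler_def by blast+

lemma S_et:
  assumes h: "h \<in> carrier H"
  shows "SW H (\<lambda>a b. S a \<otimes> et b) h = S h"
proof -
  have "SW H (\<lambda>a b. S a \<otimes> et b) h = SW H (\<lambda>a b. SW H (\<lambda>c d. S a \<otimes> (c \<otimes> S d)) b) h"
    by (rule tlift_cong, subst antipode_et[symmetric], assumption, rule SW_push[where g = "\<lambda>x. _ \<otimes> x"])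
      (assumption | rule tc h)+
  also have "\<dots> = SW H (\<lambda>a b. SW H (\<lambda>c d. S a \<otimes> c \<otimes> S d) b) h"
    by (intro tlift_cong) (simp add: mult_assoc S_in)
  finally show ?thesis using antipode_S[OF h] by simp
qed

lemma S_es:
  assumes h: "h \<in> carrier H"
  shows "SW H (\<lambda>a b. es a \<otimes> S b) h = S h"
proof -
  have "SW H (\<lambda>a b. es a \<otimes> S b) h = SW H (\<lambda>a b. SW H (\<lambda>c d. S c \<otimes> d \<otimes> S b) a) h"
    by (rule tlift_cong, subst antipode_es[symmetric], assumption, rule SW_push[where g = "\<lambda>x. x \<otimes> _"])
      (assumption | rule tc h)+
  also have "\<dots> = SW H (\<lambda>a b. SW H (\<lambda>c d. S a \<otimes> c \<otimes> S d) b) h"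
    by (rule coassoc) (assumption | rule tc h)+
  finally show ?thesis using antipode_S[OF h] by simp
qed

text \<open>The argument \<open>h\<close> may be replaced by \<open>et h\<close>, and then the
  antipode identity is evaluated on \<open>\<Delta>(g \<epsilon>\<^sub>t(h)) = g\<^sub>1
  \<epsilon>\<^sub>t(h) \<otimes> g\<^sub>2\<close>. The point is that only \<open>g\<close> is
  comultiplied.\<close>

lemma et_mult:
  assumes g: "g \<in> carrier H" and h: "h \<in> carrier H"
  shows "et (g \<otimes> h) = SW H (\<lambda>a b. (a \<otimes> et h) \<otimes> S b) g"
proof -
  have "et (g \<otimes> h) = SW H (\<lambda>a b. a \<otimes> S b) (g \<otimes> et h)"
    by (simp add: antipode_et mult_in et_in g h et_mult_et)
  also have "\<dots> = SW H (\<lambda>a b. (a \<otimes> et h) \<otimes> S b) g"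
    by (rule SW_mult_et) (assumption | rule tc g h)+
  finally show ?thesis .
qed

lemma es_mult:
  assumes g: "g \<in> carrier H" and h: "h \<in> carrier H"
  shows "es (g \<otimes> h) = SW H (\<lambda>a b. S a \<otimes> (es g \<otimes> b)) h"
proof -
  have "es (g \<otimes> h) = SW H (\<lambda>a b. S a \<otimes> b) (es g \<otimes> h)"
    by (simp add: antipode_es mult_in es_in g h es_es_mult)
  also have "\<dots> = SW H (\<lambda>a b. S a \<otimes> (es g \<otimes> b)) h"
    by (rule SW_es_mult) (assumption | rule tc g h)+
  finally show ?thesis .
qed

text \<open>Expand \<open>S(gh) = S(g\<^sub>1h\<^sub>1) \<epsilon>\<^sub>t(g\<^sub>2h\<^sub>2)\<close> with \<open>et_mult\<close>, contract the first factors with \<open>es_mult\<close>, and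
  use that \<open>\<epsilon>\<^sub>s(g)\<close> commutes with \<open>\<epsilon>\<^sub>t(h)\<close>.\<close>

lemma S_mult:
  assumes g: "g \<in> carrier H" and h: "h \<in> carrier H"
  shows "S (g \<otimes> h) = S h \<otimes> S g"
proof -
  note tcs = tc g h
  let ?G = "\<lambda>a e f c p q. (S (a \<otimes> c) \<otimes> (e \<otimes> p)) \<otimes> (S q \<otimes> S f)"
  have 1: "S (a \<otimes> c) \<otimes> et (b \<otimes> d) = SW H (\<lambda>e f. SW H (\<lambda>p q. ?G a e f c p q) d) b"
    if a: "a \<in> carrier H" and b: "b \<in> carrier H" and c: "c \<in> carrier H" and d: "d \<in> carrier H" for a b c d
  proof -
    note tcs = tcs a b c d
    have "S (a \<otimes> c) \<otimes> et (b \<otimes> d) = SW H (\<lambda>e f. S (a \<otimes> c) \<otimes> ((e \<otimes> et d) \<otimes> S f)) b"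
      unfolding et_mult[OF b d] by (rule SW_push[where g = "\<lambda>x. S (a \<otimes> c) \<otimes> x"]) (assumption | rule tcs)+
    also have "\<dots> = SW H (\<lambda>e f. SW H (\<lambda>p q. S (a \<otimes> c) \<otimes> ((e \<otimes> (p \<otimes> S q)) \<otimes> S f)) d) b"
      by (rule tlift_cong, subst antipode_et[OF d, symmetric],
          rule SW_push[where g = "\<lambda>x. _ \<otimes> ((_ \<otimes> x) \<otimes> _)"]) (assumption | rule tcs)+
    also have "\<dots> = SW H (\<lambda>e f. SW H (\<lambda>p q. ?G a e f c p q) d) b"
      by (intro tlift_cong) (simp add: mult_assoc S_in mult_in a c)
    finally show ?thesis .
  qed
  have "S (g \<otimes> h) = SW H (\<lambda>a b. S a \<otimes> et b) (g \<otimes> h)"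
    by (simp add: S_et mult_in g h)
  also have "\<dots> = SW H (\<lambda>a b. SW H (\<lambda>c d. S (a \<otimes> c) \<otimes> et (b \<otimes> d)) h) g"
    by (rule SW_mult) (assumption | rule tcs)+
  also have "\<dots> = SW H (\<lambda>a b. SW H (\<lambda>c d. SW H (\<lambda>e f. SW H (\<lambda>p q. ?G a e f c p q) d) b) h) g"
    by (intro tlift_cong) (simp add: 1)
  also have "\<dots> = SW H (\<lambda>a b. SW H (\<lambda>e f. SW H (\<lambda>c d. SW H (\<lambda>p q. ?G a e f c p q) d) h) b) g"
    by (rule tlift_cong, rule tl_swap) (assumption | rule tcs)+
  \<comment> \<open>The legs of \<open>g\<close> and of \<open>h\<close> are regrouped by
    coassociativity until \<open>S (a' \<otimes> c')\<close> and the product of \<open>e\<close> and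
    \<open>p\<close> come from one comultiplication of \<open>a \<otimes> c\<close>; together they
    contract to \<open>es (a \<otimes> c)\<close>.\<close>
  also have "\<dots> = SW H (\<lambda>a f. SW H (\<lambda>a' e. SW H (\<lambda>c d. SW H (\<lambda>p q. ?G a' e f c p q) d) h) a) g"
    by (rule coassoc[symmetric]) (assumption | rule tcs)+
  also have "\<dots> = SW H (\<lambda>a f. SW H (\<lambda>a' e. SW H (\<lambda>c q. SW H (\<lambda>c' p. ?G a' e f c' p q) c) h) a) g"
    by (rule tlift_cong, rule tlift_cong, rule coassoc[symmetric]) (assumption | rule tcs)+
  also have "\<dots> = SW H (\<lambda>a f. SW H (\<lambda>c q. SW H (\<lambda>a' e. SW H (\<lambda>c' p. ?G a' e f c' p q) c) a) h) g"
    by (rule tlift_cong, rule tl_swap) (assumption | rule tcs)+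
  also have "\<dots> = SW H (\<lambda>a f. SW H (\<lambda>c q. es (a \<otimes> c) \<otimes> (S q \<otimes> S f)) h) g"
  proof (intro tlift_cong)
    fix a f c q assume *: "a \<in> carrier H" "f \<in> carrier H" "c \<in> carrier H" "q \<in> carrier H"
    note tcs = tcs *
    have "es (a \<otimes> c) \<otimes> (S q \<otimes> S f) = SW H (\<lambda>x y. S x \<otimes> y) (a \<otimes> c) \<otimes> (S q \<otimes> S f)"
      using * by (simp add: antipode_es mult_in)
    also have "\<dots> = SW H (\<lambda>x y. (S x \<otimes> y) \<otimes> (S q \<otimes> S f)) (a \<otimes> c)"
      by (rule SW_push[where g = "\<lambda>x. x \<otimes> _"]) (assumption | rule tcs)+
    also have "\<dots> = SW H (\<lambda>a' e. SW H (\<lambda>c' p. ?G a' e f c' p q) c) a"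
      by (rule SW_mult) (assumption | rule tcs)+
    finally show "SW H (\<lambda>a' e. SW H (\<lambda>c' p. ?G a' e f c' p q) c) a = es (a \<otimes> c) \<otimes> (S q \<otimes> S f)"
      by simp
  qed
  also have "\<dots> = SW H (\<lambda>a f. SW H (\<lambda>c q. SW H (\<lambda>x y. (S x \<otimes> (es a \<otimes> y)) \<otimes> (S q \<otimes> S f)) c) h) g"
    by (rule tlift_cong, rule tlift_cong, subst es_mult, assumption, assumption,
        rule SW_push[where g = "\<lambda>x. x \<otimes> _"]) (assumption | rule tcs)+
  also have "\<dots> = SW H (\<lambda>a f. SW H (\<lambda>c q. SW H (\<lambda>x y. (S c \<otimes> (es a \<otimes> x)) \<otimes> (S y \<otimes> S f)) q) h) g"
    by (rule tlift_cong, rule coassoc) (assumption | rule tcs)+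
  also have "\<dots> = SW H (\<lambda>a f. SW H (\<lambda>c q. SW H (\<lambda>x y. S c \<otimes> (es a \<otimes> ((x \<otimes> S y) \<otimes> S f))) q) h) g"
    by (intro tlift_cong) (simp add: mult_assoc S_in es_in mult_in)
  also have "\<dots> = SW H (\<lambda>a f. SW H (\<lambda>c q. S c \<otimes> (es a \<otimes> (et q \<otimes> S f))) h) g"
    by (rule tlift_cong, rule tlift_cong, subst antipode_et[symmetric], assumption,
        rule SW_push[where g = "\<lambda>x. _ \<otimes> (_ \<otimes> (x \<otimes> _))", symmetric]) (assumption | rule tcs)+
  also have "\<dots> = SW H (\<lambda>a f. SW H (\<lambda>c q. (S c \<otimes> et q) \<otimes> (es a \<otimes> S f)) h) g"
  proof (intro tlift_cong)
    fix a f c q assume *: "a \<in> carrier H" "f \<in> carrier H" "c \<in> carrier H" "q \<in> carrier H"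
    have "es a \<otimes> (et q \<otimes> S f) = et q \<otimes> (es a \<otimes> S f)"
      using es_et_commute[of a q] * by (simp add: mult_assoc[symmetric] es_in et_in S_in)
    then show "S c \<otimes> (es a \<otimes> (et q \<otimes> S f)) = (S c \<otimes> et q) \<otimes> (es a \<otimes> S f)"
      using * by (simp add: mult_assoc es_in et_in S_in mult_in)
  qed
  also have "\<dots> = SW H (\<lambda>a f. S h \<otimes> (es a \<otimes> S f)) g"
    unfolding S_et[OF h, symmetric]
    by (rule tlift_cong, rule SW_push[where g = "\<lambda>x. x \<otimes> _", symmetric]) (assumption | rule tcs)+
  also have "\<dots> = S h \<otimes> S g"
    unfolding S_es[OF g, symmetric]
    by (rule SW_push[where g = "\<lambda>x. S h \<otimes> x", symmetric]) (assumption | rule tcs)+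
  finally show ?thesis .
qed

text \<open>For \<open>z\<close> in \<open>H\<^sub>t\<close> one has
  \<open>\<Delta>(z) = 1\<^sub>1 z \<otimes> 1\<^sub>2\<close>, so antimultiplicativity gives
  \<open>\<epsilon>\<^sub>s(z) = S(1\<^sub>1 z) 1\<^sub>2 = S(z) S(1\<^sub>1) 1\<^sub>2 = S(z)
  \<epsilon>\<^sub>s(1) = S(z)\<close>. The next lemma is the mirror image.\<close>

lemma S_of_et:
  assumes h: "h \<in> carrier H"
  shows "S (et h) = es (et h)"
proof -
  have "es (et h) = SW H (\<lambda>a b. S (a \<otimes> et h) \<otimes> b) \<one>"
    unfolding antipode_es[OF et_in[OF h], symmetric]
    by (rule SW_et(1)[where F = "\<lambda>a b. S a \<otimes> b"]) (assumption | rule tc h)+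
  also have "\<dots> = SW H (\<lambda>a b. S (et h) \<otimes> (S a \<otimes> b)) \<one>"
    by (rule tlift_cong) (simp add: S_mult et_in h mult_assoc S_in)
  also have "\<dots> = S (et h) \<otimes> es \<one>"
    unfolding antipode_es[OF one_in, symmetric]
    by (rule SW_push[where g = "\<lambda>x. _ \<otimes> x", symmetric]) (assumption | rule tc h)+
  finally show ?thesis by (simp add: es_one S_in et_in h)
qed

lemma S_of_es:
  assumes h: "h \<in> carrier H"
  shows "S (es h) = et (es h)"
proof -
  have "et (es h) = SW H (\<lambda>a b. a \<otimes> S (es h \<otimes> b)) \<one>"
    unfolding antipode_et[OF es_in[OF h], symmetric]
    by (rule SW_es[where F = "\<lambda>a b. a \<otimes> S b"]) (assumption | rule tc h)+
  also have "\<dots> = SW H (\<lambda>a b. (a \<otimes> S b) \<otimes> S (es h)) \<one>"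
    by (rule tlift_cong) (simp add: S_mult es_in h mult_assoc S_in)
  also have "\<dots> = et \<one> \<otimes> S (es h)"
    unfolding antipode_et[OF one_in, symmetric]
    by (rule SW_push[where g = "\<lambda>x. x \<otimes> _", symmetric]) (assumption | rule tc h)+
  finally show ?thesis by (simp add: et_one S_in es_in h)
qed

text \<open>The legs of \<Delta>(1) lie in \<open>H\<^sub>s\<close> and \<open>H\<^sub>t\<close>,
  where the antipode agrees with \<open>et\<close> and \<open>es\<close>. This is how the antipode
  enters the inverse of the half-braiding: a counital map on a leg of the unit becomes
  \<open>S\<close>, which then cancels against its inverse.\<close>

lemma SW_one_S:
  assumes F: "bil H H P F" and P: "module k P"
  shows "SW P (\<lambda>a b. F a (S b)) \<one> = SW P (\<lambda>a b. F a (es b)) \<one>"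
    "SW P (\<lambda>a b. F (S a) b) \<one> = SW P (\<lambda>a b. F (et a) b) \<one>"
proof -
  note tcs = tc bil_tc[OF F] P
  have "SW P (\<lambda>a b. F a (S b)) \<one> = SW P (\<lambda>a b. F a (S (et b))) \<one>"
    by (rule SW_one_et[symmetric]) (assumption | rule tcs)+
  also have "\<dots> = SW P (\<lambda>a b. F a (es (et b))) \<one>"
    by (rule tlift_cong) (simp add: S_of_et)
  also have "\<dots> = SW P (\<lambda>a b. F a (es b)) \<one>"
    by (rule SW_one_et[where F = "\<lambda>a b. F a (es b)"]) (assumption | rule tcs)+
  finally show "SW P (\<lambda>a b. F a (S b)) \<one> = SW P (\<lambda>a b. F a (es b)) \<one>" .
  have "SW P (\<lambda>a b. F (S a) b) \<one> = SW P (\<lambda>a b. F (S (es a)) b) \<one>"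
    by (rule SW_one_es[symmetric]) (assumption | rule tcs)+
  also have "\<dots> = SW P (\<lambda>a b. F (et (es a)) b) \<one>"
    by (rule tlift_cong) (simp add: S_of_es)
  also have "\<dots> = SW P (\<lambda>a b. F (et a) b) \<one>"
    by (rule SW_one_es[where F = "\<lambda>a b. F (et a) b"]) (assumption | rule tcs)+
  finally show "SW P (\<lambda>a b. F (S a) b) \<one> = SW P (\<lambda>a b. F (et a) b) \<one>" .
qed

end

section \<open>The inverse of a bijective antipode\<close>

locale weak_hopf_bij = weak_hopf k H S for k :: "'u ring" and H :: "'u bialgebra" (structure) and S +
  assumes bij_S: "bij_betw S (carrier H) (carrier H)"
begin

definition T where "T = inv_into (carrier H) S"

lemma T_in [tc]: "h \<in> carrier H \<Longrightarrow> T h \<in> carrier H"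
  unfolding T_def using bij_S by (metis bij_betw_imp_surj_on inv_into_into)

lemma S_T: "h \<in> carrier H \<Longrightarrow> S (T h) = h"
  unfolding T_def using bij_S by (metis bij_betw_inv_into_right)

lemma T_S: "h \<in> carrier H \<Longrightarrow> T (S h) = h"
  unfolding T_def using bij_S by (metis bij_betw_inv_into_left)

lemma S_inj: "g \<in> carrier H \<Longrightarrow> h \<in> carrier H \<Longrightarrow> S g = S h \<Longrightarrow> g = h"
  by (metis T_S)

lemma lin_T: "lin H H T"
proof -
  interpret H: module k H by (rule module_H)
  show ?thesis
    by (rule linI; (rule T_in, assumption)?; rule S_inj)
      (auto simp: T_in S_T lin_add[OF lin_S] lin_smult[OF lin_S])
qed

lemma lin_T' [tc]: "lin Q H f \<Longrightarrow> lin Q H (\<lambda>x. T (f x))"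
  by (rule lin_comp[OF lin_T])

text \<open>Since \<open>S\<close> reverses products, it carries
  \<open>S\<^sup>-\<^sup>1(h\<^sub>2) h\<^sub>1\<close> to \<open>S(h\<^sub>1) h\<^sub>2\<close>;
  injectivity of \<open>S\<close> does the rest.\<close>

lemma SW_T_es:
  assumes h: "h \<in> carrier H"
  shows "SW H (\<lambda>a b. T b \<otimes> a) h = T (es h)"
proof (rule S_inj)
  have "S (SW H (\<lambda>a b. T b \<otimes> a) h) = SW H (\<lambda>a b. S (T b \<otimes> a)) h"
    by (rule SW_push[OF lin_S]) (assumption | rule tc h)+
  also have "\<dots> = SW H (\<lambda>a b. S a \<otimes> b) h"
    by (rule tlift_cong) (simp add: S_mult T_in S_T)
  finally show "S (SW H (\<lambda>a b. T b \<otimes> a) h) = S (T (es h))"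
    by (simp add: antipode_es S_T es_in h)
qed (assumption | rule tc h)+

lemma SW_T_et:
  assumes h: "h \<in> carrier H"
  shows "SW H (\<lambda>a b. b \<otimes> T a) h = T (et h)"
proof (rule S_inj)
  have "S (SW H (\<lambda>a b. b \<otimes> T a) h) = SW H (\<lambda>a b. S (b \<otimes> T a)) h"
    by (rule SW_push[OF lin_S]) (assumption | rule tc h)+
  also have "\<dots> = SW H (\<lambda>a b. a \<otimes> S b) h"
    by (rule tlift_cong) (simp add: S_mult T_in S_T)
  finally show "S (SW H (\<lambda>a b. b \<otimes> T a) h) = S (T (et h))"
    by (simp add: antipode_et S_T et_in h)
qed (assumption | rule tc h)+

end

section \<open>Modules over a weak bialgebra\<close>

context weak_bialg
begin

abbreviation LM where "LM \<equiv> left_module k H"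
abbreviation dact where "dact M N h x \<equiv> act2 k H M N (comult H h) x"
abbreviation tensor_th (infixr \<open>\<otimes>\<^sub>t\<close> 75) where "M \<otimes>\<^sub>t N \<equiv> tensor_t k H M N"
abbreviation U where "U \<equiv> unit_t k H"
abbreviation R where "R \<equiv> regular k H"

lemma module_LM [tc]: "LM M \<Longrightarrow> module k M"
  by (simp add: left_module_def)

lemma bil_act: "LM M \<Longrightarrow> bil H M M (act M)"
  by (simp add: left_module_def)

lemma act_in [tc]: "LM M \<Longrightarrow> h \<in> carrier H \<Longrightarrow> m \<in> carrier M \<Longrightarrow> act M h m \<in> carrier M"
  using bil_in[OF bil_act] .

lemma lin_act1 [tc]: "LM M \<Longrightarrow> lin Q H f \<Longrightarrow> m \<in> carrier M \<Longrightarrow> lin Q M (\<lambda>x. act M (f x) m)"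
  by (rule bil_1[OF bil_act])

lemma lin_act2 [tc]: "LM M \<Longrightarrow> h \<in> carrier H \<Longrightarrow> lin Q M f \<Longrightarrow> lin Q M (\<lambda>x. act M h (f x))"
  by (rule bil_2[OF bil_act])

lemma act_mult:
  "LM M \<Longrightarrow> g \<in> carrier H \<Longrightarrow> h \<in> carrier H \<Longrightarrow> m \<in> carrier M \<Longrightarrow> act M (g \<otimes> h) m = act M g (act M h m)"
  by (simp add: left_module_def)

lemma act_one: "LM M \<Longrightarrow> m \<in> carrier M \<Longrightarrow> act M \<one> m = m"
  by (simp add: left_module_def)

lemma hmod_on_simps:
  "carrier (hmod_on k H C V \<alpha>) = C" "\<zero>\<^bsub>hmod_on k H C V \<alpha>\<^esub> = \<zero>\<^bsub>V\<^esub>"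
  "x \<in> C \<Longrightarrow> y \<in> C \<Longrightarrow> x \<oplus>\<^bsub>hmod_on k H C V \<alpha>\<^esub> y = x \<oplus>\<^bsub>V\<^esub> y"
  "a \<in> carrier k \<Longrightarrow> x \<in> C \<Longrightarrow> a \<odot>\<^bsub>hmod_on k H C V \<alpha>\<^esub> x = a \<odot>\<^bsub>V\<^esub> x"
  "h \<in> carrier H \<Longrightarrow> x \<in> C \<Longrightarrow> act (hmod_on k H C V \<alpha>) h x = \<alpha> h x"
  by (simp_all add: hmod_on_def)

lemma left_module_hmod_on:
  assumes V: "module k V" and C: "C \<subseteq> carrier V" "\<zero>\<^bsub>V\<^esub> \<in> C"
    and add: "\<And>x y. x \<in> C \<Longrightarrow> y \<in> C \<Longrightarrow> x \<oplus>\<^bsub>V\<^esub> y \<in> C"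
    and smult: "\<And>a x. a \<in> carrier k \<Longrightarrow> x \<in> C \<Longrightarrow> a \<odot>\<^bsub>V\<^esub> x \<in> C"
    and act: "\<And>h x. h \<in> carrier H \<Longrightarrow> x \<in> C \<Longrightarrow> \<alpha> h x \<in> C"
    and lin1: "\<And>x. x \<in> C \<Longrightarrow> lin H V (\<lambda>h. \<alpha> h x)"
    and lin2: "\<And>h x y. h \<in> carrier H \<Longrightarrow> x \<in> C \<Longrightarrow> y \<in> C \<Longrightarrow> \<alpha> h (x \<oplus>\<^bsub>V\<^esub> y) = \<alpha> h x \<oplus>\<^bsub>V\<^esub> \<alpha> h y"
      "\<And>h a x. h \<in> carrier H \<Longrightarrow> a \<in> carrier k \<Longrightarrow> x \<in> C \<Longrightarrow> \<alpha> h (a \<odot>\<^bsub>V\<^esub> x) = a \<odot>\<^bsub>V\<^esub> \<alpha> h x"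
    and mult: "\<And>g h x. g \<in> carrier H \<Longrightarrow> h \<in> carrier H \<Longrightarrow> x \<in> C \<Longrightarrow> \<alpha> (g \<otimes> h) x = \<alpha> g (\<alpha> h x)"
    and one: "\<And>x. x \<in> C \<Longrightarrow> \<alpha> \<one> x = x"
  shows "LM (hmod_on k H C V \<alpha>)"
proof -
  interpret V: module k V by (rule V)
  interpret H: module k H by (rule module_H)
  let ?N = "hmod_on k H C V \<alpha>"
  note [simp] = hmod_on_simps subsetD[OF C(1)]
  have ag: "abelian_group ?N"
  proof (rule abelian_groupI)
    fix x assume "x \<in> carrier ?N"
    then have x: "x \<in> C" by simp
    have "\<ominus>\<^bsub>k\<^esub> \<one>\<^bsub>k\<^esub> \<odot>\<^bsub>V\<^esub> x \<in> C" "(\<ominus>\<^bsub>k\<^esub> \<one>\<^bsub>k\<^esub> \<odot>\<^bsub>V\<^esub> x) \<oplus>\<^bsub>V\<^esub> x = \<zero>\<^bsub>V\<^esub>"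
      using x smult[of "\<ominus>\<^bsub>k\<^esub> \<one>\<^bsub>k\<^esub>" x] by (simp, simp add: V.smult_l_minus V.l_neg)
    then show "\<exists>y\<in>carrier ?N. y \<oplus>\<^bsub>?N\<^esub> x = \<zero>\<^bsub>?N\<^esub>" using x by auto
  qed (simp_all add: C add V.a_assoc V.a_comm V.a_lcomm)
  have md: "module k ?N"
    by (rule moduleI[OF cring_k ag])
      (simp_all add: smult add V.smult_l_distr V.smult_r_distr V.smult_assoc1)
  have "bil H ?N ?N (act ?N)"
    by (intro bilI linI) (simp_all add: act lin2 lin_add[OF lin1] lin_smult[OF lin1] add smult)
  moreover have "hmod_on k H (carrier ?N) ?N (act ?N) = ?N"
    by (simp add: hmod_on_def fun_eq_iff restrict_def)
  ultimately show ?thesis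
    unfolding left_module_def using md by (simp add: act mult one mult_in one_in)
qed

lemma lin_act2u [tc]:
  "LM M \<Longrightarrow> LM N \<Longrightarrow> lin Q (H \<boxtimes> H) u \<Longrightarrow> x \<in> carrier (M \<boxtimes> N) \<Longrightarrow>
    lin Q (M \<boxtimes> N) (\<lambda>t. act2 k H M N (u t) x)"
  unfolding act2_def by (assumption | rule tc)+

lemma lin_act2x [tc]:
  "LM M \<Longrightarrow> LM N \<Longrightarrow> u \<in> carrier (H \<boxtimes> H) \<Longrightarrow> lin Q (M \<boxtimes> N) f \<Longrightarrow> module k Q \<Longrightarrow>
    lin Q (M \<boxtimes> N) (\<lambda>t. act2 k H M N u (f t))"
proof -
  assume *: "LM M" "LM N" "u \<in> carrier (H \<boxtimes> H)"
  have "lin (M \<boxtimes> N) (M \<boxtimes> N) (\<lambda>t. act2 k H M N u t)"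
    unfolding act2_def by (assumption | rule tc *)+
  then show "lin Q (M \<boxtimes> N) f \<Longrightarrow> lin Q (M \<boxtimes> N) (\<lambda>t. act2 k H M N u (f t))" by (rule lin_comp)
qed

lemma act2_in [tc]:
  "LM M \<Longrightarrow> LM N \<Longrightarrow> u \<in> carrier (H \<boxtimes> H) \<Longrightarrow> x \<in> carrier (M \<boxtimes> N) \<Longrightarrow>
    act2 k H M N u x \<in> carrier (M \<boxtimes> N)"
  unfolding act2_def by (assumption | rule tc)+

lemma act2_tens:
  assumes "LM M" "LM N" "u \<in> carrier (H \<boxtimes> H)" "m \<in> carrier M" "n \<in> carrier N"
  shows "act2 k H M N u (tens k M N m n) = tl H H (M \<boxtimes> N) (\<lambda>a b. tens k M N (act M a m) (act N b n)) u"
  unfolding act2_def by (intro tlift_cong tlift_tens) (assumption | rule tc assms)+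

text \<open>Multiplicativity of \<Delta> makes the diagonal action multiplicative on the full tensor
  product. In general \<open>\<one>\<close> acts there only as an idempotent, and
  \<open>M \<otimes>\<^sub>t N\<close> is the part on which it is the identity.\<close>

lemma dact_mult:
  assumes M: "LM M" and N: "LM N" and g: "g \<in> carrier H" and h: "h \<in> carrier H" and x: "x \<in> carrier (M \<boxtimes> N)"
  shows "dact M N (g \<otimes> h) x = dact M N g (dact M N h x)"
proof (rule lin_ext[where P = "M \<boxtimes> N" and f = "\<lambda>x. dact M N (g \<otimes> h) x" and g = "\<lambda>x. dact M N g (dact M N h x)", OF _ _ _ _ _ _ x])
  note tcs = tc M N g h
  fix m n assume m: "m \<in> carrier M" and n: "n \<in> carrier N"
  note tcs = tcs m n
  have "dact M N (g \<otimes> h) (tens k M N m n) = SW (M \<boxtimes> N) (\<lambda>a b. tens k M N (act M a m) (act N b n)) (g \<otimes> h)"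
    by (rule act2_tens) (assumption | rule tcs)+
  also have "\<dots> = SW (M \<boxtimes> N) (\<lambda>a b. SW (M \<boxtimes> N) (\<lambda>c d. tens k M N (act M (a \<otimes> c) m) (act N (b \<otimes> d) n)) h) g"
    by (rule SW_mult) (assumption | rule tcs)+
  also have "\<dots> = SW (M \<boxtimes> N) (\<lambda>a b. SW (M \<boxtimes> N) (\<lambda>c d. tens k M N (act M a (act M c m)) (act N b (act N d n))) h) g"
    by (intro tlift_cong) (simp add: act_mult M N m n)
  also have "\<dots> = SW (M \<boxtimes> N) (\<lambda>c d. SW (M \<boxtimes> N) (\<lambda>a b. tens k M N (act M a (act M c m)) (act N b (act N d n))) g) h"
    by (rule tl_swap) (assumption | rule tcs)+
  also have "\<dots> = SW (M \<boxtimes> N) (\<lambda>c d. dact M N g (tens k M N (act M c m) (act N d n))) h"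
    by (rule tlift_cong, rule act2_tens[symmetric]) (assumption | rule tcs)+
  also have "\<dots> = dact M N g (SW (M \<boxtimes> N) (\<lambda>c d. tens k M N (act M c m) (act N d n)) h)"
    by (rule SW_push[symmetric, where g = "\<lambda>x. dact M N g x"]) (assumption | rule tcs)+
  also have "SW (M \<boxtimes> N) (\<lambda>c d. tens k M N (act M c m) (act N d n)) h = dact M N h (tens k M N m n)"
    by (rule act2_tens[symmetric]) (assumption | rule tcs)+
  finally show "dact M N (g \<otimes> h) (tens k M N m n) = dact M N g (dact M N h (tens k M N m n))" .
qed (assumption | rule tc M N g h)+

lemma dact_one_dact:
  "LM M \<Longrightarrow> LM N \<Longrightarrow> h \<in> carrier H \<Longrightarrow> x \<in> carrier (M \<boxtimes> N) \<Longrightarrow> dact M N \<one> (dact M N h x) = dact M N h x"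
  "LM M \<Longrightarrow> LM N \<Longrightarrow> h \<in> carrier H \<Longrightarrow> x \<in> carrier (M \<boxtimes> N) \<Longrightarrow> dact M N h (dact M N \<one> x) = dact M N h x"
  using dact_mult[of M N \<one> h x] dact_mult[of M N h \<one> x] one_in by simp_all

lemma carrier_tt: "carrier (M \<otimes>\<^sub>t N) = dact M N \<one> ` carrier (M \<boxtimes> N)"
  by (simp add: tensor_t_def hmod_on_simps)

text \<open>The image of an idempotent is its set of fixed points. Membership is used in this form
  throughout.\<close>

lemma in_tt: "LM M \<Longrightarrow> LM N \<Longrightarrow> x \<in> carrier (M \<otimes>\<^sub>t N) \<longleftrightarrow> x \<in> carrier (M \<boxtimes> N) \<and> dact M N \<one> x = x"
  using dact_one_dact(1)[OF _ _ one_in] act2_in[OF _ _ D_in[OF one_in]]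
  by (force simp: carrier_tt)

lemma tt_D: "LM M \<Longrightarrow> LM N \<Longrightarrow> x \<in> carrier (M \<otimes>\<^sub>t N) \<Longrightarrow> x \<in> carrier (M \<boxtimes> N)"
  "LM M \<Longrightarrow> LM N \<Longrightarrow> x \<in> carrier (M \<otimes>\<^sub>t N) \<Longrightarrow> dact M N \<one> x = x"
  by (simp_all add: in_tt)

lemma tt_mem: "x \<in> carrier (M \<otimes>\<^sub>t N) \<Longrightarrow> LM M \<Longrightarrow> LM N \<Longrightarrow> x \<in> carrier (M \<boxtimes> N)"
  by (rule tt_D(1))

lemma dact_tt [tc]:
  "LM M \<Longrightarrow> LM N \<Longrightarrow> h \<in> carrier H \<Longrightarrow> x \<in> carrier (M \<boxtimes> N) \<Longrightarrow> dact M N h x \<in> carrier (M \<otimes>\<^sub>t N)"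
  by (simp add: in_tt dact_one_dact act2_in D_in)

lemma tt_ops:
  "x \<in> carrier (M \<otimes>\<^sub>t N) \<Longrightarrow> y \<in> carrier (M \<otimes>\<^sub>t N) \<Longrightarrow> x \<oplus>\<^bsub>M \<otimes>\<^sub>t N\<^esub> y = x \<oplus>\<^bsub>M \<boxtimes> N\<^esub> y"
  "a \<in> carrier k \<Longrightarrow> x \<in> carrier (M \<otimes>\<^sub>t N) \<Longrightarrow> a \<odot>\<^bsub>M \<otimes>\<^sub>t N\<^esub> x = a \<odot>\<^bsub>M \<boxtimes> N\<^esub> x"
  "h \<in> carrier H \<Longrightarrow> x \<in> carrier (M \<otimes>\<^sub>t N) \<Longrightarrow> act (M \<otimes>\<^sub>t N) h x = dact M N h x"
  by (simp_all add: tensor_t_def hmod_on_simps)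

lemma LM_tt [tc]:
  assumes M: "LM M" and N: "LM N"
  shows "LM (M \<otimes>\<^sub>t N)"
proof -
  let ?C = "dact M N \<one> ` carrier (M \<boxtimes> N)"
  have V: "module k (M \<boxtimes> N)" by (assumption | rule tc M N | erule tt_mem)+
  interpret V: module k "M \<boxtimes> N" by (rule V)
  have l: "lin (M \<boxtimes> N) (M \<boxtimes> N) (\<lambda>x. dact M N h x)" if "h \<in> carrier H" for h
    by (assumption | rule tc M N that | erule tt_mem)+
  have C: "x \<in> ?C \<longleftrightarrow> x \<in> carrier (M \<boxtimes> N) \<and> dact M N \<one> x = x" for x
    using in_tt[OF M N] by (simp add: carrier_tt)
  show ?thesis
    unfolding tensor_t_def
  proof (rule left_module_hmod_on[OF V])
    show "?C \<subseteq> carrier (M \<boxtimes> N)" using C by blast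
    show "\<zero>\<^bsub>M \<boxtimes> N\<^esub> \<in> ?C" using C lin_zero[OF V V l[OF one_in]] by simp
    show "lin H (M \<boxtimes> N) (\<lambda>h. dact M N h x)" if "x \<in> ?C" for x
      using that C by (intro tc M N) auto
    show "dact M N h x \<in> ?C" if "h \<in> carrier H" "x \<in> ?C" for h x
      using dact_tt[OF M N] that C carrier_tt by metis
  qed (auto simp: C lin_add[OF l] lin_smult[OF l] one_in dact_mult M N)
qed

lemma lin_tt_incl [tc]: "LM M \<Longrightarrow> LM N \<Longrightarrow> lin (M \<otimes>\<^sub>t N) (M \<boxtimes> N) (\<lambda>x. x)"
  by (rule linI) (simp_all add: tt_ops tt_D)

lemma lin_tt_cod:
  assumes "lin Q (M \<boxtimes> N) f" "\<And>x. x \<in> carrier Q \<Longrightarrow> f x \<in> carrier (M \<otimes>\<^sub>t N)"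
  shows "lin Q (M \<otimes>\<^sub>t N) f"
  by (rule linI) (simp_all add: tt_ops assms lin_add[OF assms(1)] lin_smult[OF assms(1)])

lemma lin_tt_to: "LM M \<Longrightarrow> LM N \<Longrightarrow> lin Q (M \<otimes>\<^sub>t N) f \<Longrightarrow> lin Q (M \<boxtimes> N) f"
  using lin_comp[OF lin_tt_incl] by blast

lemma lin_dact_tt1 [tc]:
  "LM M \<Longrightarrow> LM N \<Longrightarrow> lin Q H f \<Longrightarrow> x \<in> carrier (M \<boxtimes> N) \<Longrightarrow> lin Q (M \<otimes>\<^sub>t N) (\<lambda>t. dact M N (f t) x)"
  by (rule lin_tt_cod) (assumption | rule tc | erule (1) lin_closed | erule tt_mem)+

lemma lin_dact_tt2 [tc]:
  "LM M \<Longrightarrow> LM N \<Longrightarrow> h \<in> carrier H \<Longrightarrow> lin Q (M \<boxtimes> N) f \<Longrightarrow> module k Q \<Longrightarrow>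
    lin Q (M \<otimes>\<^sub>t N) (\<lambda>t. dact M N h (f t))"
  by (rule lin_tt_cod) (assumption | rule tc | erule (1) lin_closed | erule tt_mem)+

text \<open>Pure tensors need not lie in \<open>M \<otimes>\<^sub>t N\<close>, so the test elements
  are their projections; these generate because every element is its own projection.\<close>

lemma tt_ext:
  assumes M: "LM M" and N: "LM N" and P: "module k P"
    and f: "lin (M \<otimes>\<^sub>t N) P f" and g: "lin (M \<otimes>\<^sub>t N) P g"
    and eq: "\<And>m n. m \<in> carrier M \<Longrightarrow> n \<in> carrier N \<Longrightarrow>
      f (dact M N \<one> (tens k M N m n)) = g (dact M N \<one> (tens k M N m n))"
    and x: "x \<in> carrier (M \<otimes>\<^sub>t N)"
  shows "f x = g x"
proof -
  have "f (dact M N \<one> x) = g (dact M N \<one> x)"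
    by (rule lin_ext[where P = P and f = "\<lambda>x. f (dact M N \<one> x)" and g = "\<lambda>x. g (dact M N \<one> x)", OF _ _ _ _ _ _ tt_D(1)[OF M N x]])
      (assumption | rule tc lin_comp[OF f] lin_comp[OF g] M N P eq | erule tt_mem)+
  then show ?thesis using tt_D(2)[OF M N x] by simp
qed

section \<open>The associativity constraint\<close>

text \<open>\<open>iL\<close> and \<open>iR\<close> are the canonical maps from the two bracketings into \<open>A \<boxtimes> B \<boxtimes> C\<close> that occur in
  \<^const>\<open>assoc_t\<close>, and \<open>rbr\<close> sends \<open>(a \<otimes> b) \<otimes> c\<close> to \<open>a \<otimes> (b \<otimes> c)\<close>. The map \<open>pR\<close> is a left inverse of \<open>iR\<close>;
  it exists because \<open>\<Delta>(1)\<close> acts as an idempotent. \<open>E3\<close> is the action of \<open>(id \<otimes> \<Delta>)\<Delta>(1)\<close>, whose image is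
  the image of both \<open>iL\<close> and \<open>iR\<close>.\<close>

abbreviation iR where
  "iR A B C y \<equiv> tl A (B \<otimes>\<^sub>t C) (A \<boxtimes> B \<boxtimes> C) (\<lambda>m u. tens k A (B \<boxtimes> C) m u) y"

abbreviation rbr where
  "rbr A B C u p \<equiv> tl A B (A \<boxtimes> B \<boxtimes> C) (\<lambda>m n. tens k A (B \<boxtimes> C) m (tens k B C n p)) u"

abbreviation iL where
  "iL A B C x \<equiv> tl (A \<otimes>\<^sub>t B) C (A \<boxtimes> B \<boxtimes> C) (\<lambda>u p. rbr A B C u p) x"

definition E3 where
  "E3 A B C x = SW (A \<boxtimes> B \<boxtimes> C) (\<lambda>p q. tl A (B \<boxtimes> C) (A \<boxtimes> B \<boxtimes> C)
     (\<lambda>a v. tens k A (B \<boxtimes> C) (act A p a) (dact B C q v)) x) \<one>"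

definition pR where
  "pR A B C x = tl A (B \<boxtimes> C) (A \<boxtimes> (B \<otimes>\<^sub>t C)) (\<lambda>a v. tens k A (B \<otimes>\<^sub>t C) a (dact B C \<one> v)) x"

text \<open>An explicit candidate for the value that \<open>assoc_t\<close> singles out by a
  definite description: rebracket in the triple tensor product, pull back along \<open>iR\<close>,
  and project.\<close>

definition asm where
  "asm A B C x = dact A (B \<otimes>\<^sub>t C) \<one> (pR A B C (iL A B C x))"

lemma lin_pR [tc]:
  "LM A \<Longrightarrow> LM B \<Longrightarrow> LM C \<Longrightarrow> lin Q (A \<boxtimes> B \<boxtimes> C) f \<Longrightarrow> lin Q (A \<boxtimes> (B \<otimes>\<^sub>t C)) (\<lambda>x. pR A B C (f x))"
  unfolding pR_def by (assumption | rule tc | erule tt_mem)+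

lemma pR_in [tc]:
  "LM A \<Longrightarrow> LM B \<Longrightarrow> LM C \<Longrightarrow> x \<in> carrier (A \<boxtimes> B \<boxtimes> C) \<Longrightarrow> pR A B C x \<in> carrier (A \<boxtimes> (B \<otimes>\<^sub>t C))"
  unfolding pR_def by (assumption | rule tc | erule tt_mem)+

lemma lin_E3 [tc]:
  "LM A \<Longrightarrow> LM B \<Longrightarrow> LM C \<Longrightarrow> lin Q (A \<boxtimes> B \<boxtimes> C) f \<Longrightarrow> module k Q \<Longrightarrow>
    lin Q (A \<boxtimes> B \<boxtimes> C) (\<lambda>x. E3 A B C (f x))"
  unfolding E3_def by (assumption | rule tc | erule (1) lin_closed | erule tt_mem)+

text \<open>The projection inside \<open>pR\<close> fixes the factor from
  \<open>B \<otimes>\<^sub>t C\<close>. The consequence that matters is injectivity of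
  \<open>iR\<close>, which is not automatic, since tensoring with \<open>A\<close> need not preserve
  an inclusion.\<close>

lemma pR_iR:
  assumes A: "LM A" and B: "LM B" and C: "LM C" and y: "y \<in> carrier (A \<boxtimes> (B \<otimes>\<^sub>t C))"
  shows "pR A B C (iR A B C y) = y"
proof (rule lin_ext[where P = "A \<boxtimes> (B \<otimes>\<^sub>t C)" and f = "\<lambda>y. pR A B C (iR A B C y)" and g = "\<lambda>y. y", OF _ _ _ _ _ _ y])
  note tcs = tc A B C
  fix a v assume a: "a \<in> carrier A" and v: "v \<in> carrier (B \<otimes>\<^sub>t C)"
  note v' = tt_D[OF B C v]
  have "iR A B C (tens k A (B \<otimes>\<^sub>t C) a v) = tens k A (B \<boxtimes> C) a v"
    by (rule tlift_tens) (assumption | rule tcs a v v' | erule tt_mem)+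
  also have "pR A B C (tens k A (B \<boxtimes> C) a v) = tens k A (B \<otimes>\<^sub>t C) a (dact B C \<one> v)"
    unfolding pR_def by (rule tlift_tens) (assumption | rule tcs a v v' | erule tt_mem)+
  finally show "pR A B C (iR A B C (tens k A (B \<otimes>\<^sub>t C) a v)) = tens k A (B \<otimes>\<^sub>t C) a v"
    using v' by simp
qed (assumption | rule tc A B C | erule tt_mem)+

lemma iR_dact_pR:
  assumes A: "LM A" and B: "LM B" and C: "LM C" and x: "x \<in> carrier (A \<boxtimes> B \<boxtimes> C)"
  shows "iR A B C (dact A (B \<otimes>\<^sub>t C) \<one> (pR A B C x)) = E3 A B C x"
proof (rule lin_ext[where P = "A \<boxtimes> B \<boxtimes> C" and f = "\<lambda>x. iR A B C (dact A (B \<otimes>\<^sub>t C) \<one> (pR A B C x))" and g = "\<lambda>x. E3 A B C x", OF _ _ _ _ _ _ x])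
  note tcs = tc A B C
  fix a v assume a: "a \<in> carrier A" and v: "v \<in> carrier (B \<boxtimes> C)"
  note tcs = tcs a v
  have 1: "pR A B C (tens k A (B \<boxtimes> C) a v) = tens k A (B \<otimes>\<^sub>t C) a (dact B C \<one> v)"
    unfolding pR_def by (rule tlift_tens) (assumption | rule tcs | erule tt_mem)+
  have "dact A (B \<otimes>\<^sub>t C) \<one> (tens k A (B \<otimes>\<^sub>t C) a (dact B C \<one> v))
     = SW (A \<boxtimes> (B \<otimes>\<^sub>t C)) (\<lambda>p q. tens k A (B \<otimes>\<^sub>t C) (act A p a) (act (B \<otimes>\<^sub>t C) q (dact B C \<one> v))) \<one>"
    by (rule act2_tens) (assumption | rule tcs | erule tt_mem)+
  \<comment> \<open>The inner projection disappears because
    \<open>\<Delta>(q)\<Delta>(1) = \<Delta>(q)\<close>.\<close>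
  also have "\<dots> = SW (A \<boxtimes> (B \<otimes>\<^sub>t C)) (\<lambda>p q. tens k A (B \<otimes>\<^sub>t C) (act A p a) (dact B C q v)) \<one>"
    by (rule tlift_cong) (simp add: tt_ops dact_tt B C one_in v dact_one_dact)
  finally have 2: "dact A (B \<otimes>\<^sub>t C) \<one> (tens k A (B \<otimes>\<^sub>t C) a (dact B C \<one> v))
     = SW (A \<boxtimes> (B \<otimes>\<^sub>t C)) (\<lambda>p q. tens k A (B \<otimes>\<^sub>t C) (act A p a) (dact B C q v)) \<one>" .
  have "iR A B C (SW (A \<boxtimes> (B \<otimes>\<^sub>t C)) (\<lambda>p q. tens k A (B \<otimes>\<^sub>t C) (act A p a) (dact B C q v)) \<one>)
     = SW (A \<boxtimes> B \<boxtimes> C) (\<lambda>p q. iR A B C (tens k A (B \<otimes>\<^sub>t C) (act A p a) (dact B C q v))) \<one>"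
    by (rule SW_push[where g = "\<lambda>y. iR A B C y"]) (assumption | rule tcs | erule tt_mem)+
  also have "\<dots> = SW (A \<boxtimes> B \<boxtimes> C) (\<lambda>p q. tens k A (B \<boxtimes> C) (act A p a) (dact B C q v)) \<one>"
    by (rule tlift_cong, rule tlift_tens) (assumption | rule tcs | erule tt_mem)+
  also have "\<dots> = E3 A B C (tens k A (B \<boxtimes> C) a v)"
    unfolding E3_def by (rule tlift_cong, rule tlift_tens[symmetric]) (assumption | rule tcs | erule tt_mem)+
  finally show "iR A B C (dact A (B \<otimes>\<^sub>t C) \<one> (pR A B C (tens k A (B \<boxtimes> C) a v))) = E3 A B C (tens k A (B \<boxtimes> C) a v)"
    unfolding 1 2 .
qed (assumption | rule tc A B C | erule tt_mem)+

lemma E3_tens: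
  assumes A: "LM A" and B: "LM B" and C: "LM C"
    and a: "a \<in> carrier A" and b: "b \<in> carrier B" and c: "c \<in> carrier C"
  shows "E3 A B C (tens k A (B \<boxtimes> C) a (tens k B C b c)) =
    SW (A \<boxtimes> B \<boxtimes> C) (\<lambda>p q. SW (A \<boxtimes> B \<boxtimes> C) (\<lambda>r s.
      tens k A (B \<boxtimes> C) (act A p a) (tens k B C (act B r b) (act C s c))) q) \<one>"
proof -
  note tcs = tc A B C a b c
  have "E3 A B C (tens k A (B \<boxtimes> C) a (tens k B C b c)) =
     SW (A \<boxtimes> B \<boxtimes> C) (\<lambda>p q. tens k A (B \<boxtimes> C) (act A p a) (dact B C q (tens k B C b c))) \<one>"
    unfolding E3_def by (rule tlift_cong, rule tlift_tens) (assumption | rule tcs | erule tt_mem)+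
  also have "\<dots> = SW (A \<boxtimes> B \<boxtimes> C) (\<lambda>p q. tens k A (B \<boxtimes> C) (act A p a)
      (SW (B \<boxtimes> C) (\<lambda>r s. tens k B C (act B r b) (act C s c)) q)) \<one>"
    by (rule tlift_cong, subst act2_tens) (assumption | rule tcs refl | erule tt_mem)+
  also have "\<dots> = SW (A \<boxtimes> B \<boxtimes> C) (\<lambda>p q. SW (A \<boxtimes> B \<boxtimes> C) (\<lambda>r s.
      tens k A (B \<boxtimes> C) (act A p a) (tens k B C (act B r b) (act C s c))) q) \<one>"
    by (rule tlift_cong, rule SW_push[where g = "\<lambda>x. tens k A (B \<boxtimes> C) _ x"]) (assumption | rule tcs | erule tt_mem)+
  finally show ?thesis .
qed

lemma rbr_tens:
  assumes "LM A" "LM B" "LM C" "a \<in> carrier A" "b \<in> carrier B" "c \<in> carrier C"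
  shows "rbr A B C (tens k A B a b) c = tens k A (B \<boxtimes> C) a (tens k B C b c)"
  by (rule tlift_tens) (assumption | rule tc assms | erule tt_mem)+

lemma iL_tens:
  assumes A: "LM A" and B: "LM B" and C: "LM C" and "u \<in> carrier (A \<otimes>\<^sub>t B)" "c \<in> carrier C"
  shows "iL A B C (tens k (A \<otimes>\<^sub>t B) C u c) = rbr A B C u c"
  by (rule tlift_tens) (assumption | rule tc assms | erule tt_mem)+

text \<open>On the left bracketing the unit acts through
  \<open>(\<Delta> \<otimes> id)\<Delta>(1)\<close>, and coassociativity identifies this with the
  action in \<open>E3\<close>. Here \<open>u\<close> ranges over the full
  \<open>A \<boxtimes> B\<close>, so that the lemma also applies to pure tensors.\<close>

lemma SW_rbr_dact:
  assumes A: "LM A" and B: "LM B" and C: "LM C" and u: "u \<in> carrier (A \<boxtimes> B)" and c: "c \<in> carrier C"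
  shows "SW (A \<boxtimes> B \<boxtimes> C) (\<lambda>p q. rbr A B C (dact A B p u) (act C q c)) \<one> = E3 A B C (rbr A B C u c)"
proof (rule lin_ext[where P = "A \<boxtimes> B \<boxtimes> C" and f = "\<lambda>u. SW (A \<boxtimes> B \<boxtimes> C) (\<lambda>p q. rbr A B C (dact A B p u) (act C q c)) \<one>"
      and g = "\<lambda>u. E3 A B C (rbr A B C u c)", OF _ _ _ _ _ _ u])
  note tcs = tc A B C c
  fix a b assume a: "a \<in> carrier A" and b: "b \<in> carrier B"
  note tcs = tcs a b
  have "SW (A \<boxtimes> B \<boxtimes> C) (\<lambda>p q. rbr A B C (dact A B p (tens k A B a b)) (act C q c)) \<one>
     = SW (A \<boxtimes> B \<boxtimes> C) (\<lambda>p q. rbr A B C (SW (A \<boxtimes> B) (\<lambda>r s. tens k A B (act A r a) (act B s b)) p) (act C q c)) \<one>"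
    by (rule tlift_cong, subst act2_tens) (assumption | rule tcs refl | erule tt_mem)+
  also have "\<dots> = SW (A \<boxtimes> B \<boxtimes> C) (\<lambda>p q. SW (A \<boxtimes> B \<boxtimes> C) (\<lambda>r s. rbr A B C (tens k A B (act A r a) (act B s b)) (act C q c)) p) \<one>"
    by (rule tlift_cong, rule SW_push[where g = "\<lambda>x. rbr A B C x _"]) (assumption | rule tcs | erule tt_mem)+
  also have "\<dots> = SW (A \<boxtimes> B \<boxtimes> C) (\<lambda>p q. SW (A \<boxtimes> B \<boxtimes> C) (\<lambda>r s. tens k A (B \<boxtimes> C) (act A r a) (tens k B C (act B s b) (act C q c))) p) \<one>"
    by (rule tlift_cong, rule tlift_cong, rule rbr_tens) (assumption | rule tcs | erule tt_mem)+
  also have "\<dots> = SW (A \<boxtimes> B \<boxtimes> C) (\<lambda>p q. SW (A \<boxtimes> B \<boxtimes> C) (\<lambda>r s. tens k A (B \<boxtimes> C) (act A p a) (tens k B C (act B r b) (act C s c))) q) \<one>"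
    by (rule coassoc) (assumption | rule tcs | erule tt_mem)+
  also have "\<dots> = E3 A B C (tens k A (B \<boxtimes> C) a (tens k B C b c))"
    by (rule E3_tens[symmetric]) (assumption | rule tcs | erule tt_mem)+
  also have "\<dots> = E3 A B C (rbr A B C (tens k A B a b) c)"
    using A B C a b c by (simp add: rbr_tens)
  finally show "SW (A \<boxtimes> B \<boxtimes> C) (\<lambda>p q. rbr A B C (dact A B p (tens k A B a b)) (act C q c)) \<one>
     = E3 A B C (rbr A B C (tens k A B a b) c)" .
qed (assumption | rule tc A B C c | erule tt_mem)+

lemma iL_dact:
  assumes A: "LM A" and B: "LM B" and C: "LM C" and w: "w \<in> carrier ((A \<otimes>\<^sub>t B) \<boxtimes> C)"
  shows "iL A B C (dact (A \<otimes>\<^sub>t B) C \<one> w) = E3 A B C (iL A B C w)"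
proof (rule lin_ext[where P = "A \<boxtimes> B \<boxtimes> C" and f = "\<lambda>w. iL A B C (dact (A \<otimes>\<^sub>t B) C \<one> w)" and g = "\<lambda>w. E3 A B C (iL A B C w)", OF _ _ _ _ _ _ w])
  note tcs = tc A B C
  fix u c assume u: "u \<in> carrier (A \<otimes>\<^sub>t B)" and c: "c \<in> carrier C"
  note u' = tt_D[OF A B u]
  note tcs = tcs u u' c
  have "dact (A \<otimes>\<^sub>t B) C \<one> (tens k (A \<otimes>\<^sub>t B) C u c)
     = SW ((A \<otimes>\<^sub>t B) \<boxtimes> C) (\<lambda>p q. tens k (A \<otimes>\<^sub>t B) C (act (A \<otimes>\<^sub>t B) p u) (act C q c)) \<one>"
    by (rule act2_tens) (assumption | rule tcs | erule tt_mem)+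
  also have "\<dots> = SW ((A \<otimes>\<^sub>t B) \<boxtimes> C) (\<lambda>p q. tens k (A \<otimes>\<^sub>t B) C (dact A B p u) (act C q c)) \<one>"
    by (rule tlift_cong) (simp add: tt_ops u)
  finally have 1: "dact (A \<otimes>\<^sub>t B) C \<one> (tens k (A \<otimes>\<^sub>t B) C u c)
     = SW ((A \<otimes>\<^sub>t B) \<boxtimes> C) (\<lambda>p q. tens k (A \<otimes>\<^sub>t B) C (dact A B p u) (act C q c)) \<one>" .
  have "iL A B C (SW ((A \<otimes>\<^sub>t B) \<boxtimes> C) (\<lambda>p q. tens k (A \<otimes>\<^sub>t B) C (dact A B p u) (act C q c)) \<one>)
     = SW (A \<boxtimes> B \<boxtimes> C) (\<lambda>p q. iL A B C (tens k (A \<otimes>\<^sub>t B) C (dact A B p u) (act C q c))) \<one>"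
    by (rule SW_push[where g = "\<lambda>w. iL A B C w"]) (assumption | rule tcs | erule tt_mem)+
  also have "\<dots> = SW (A \<boxtimes> B \<boxtimes> C) (\<lambda>p q. rbr A B C (dact A B p u) (act C q c)) \<one>"
    by (rule tlift_cong, rule iL_tens) (assumption | rule tcs | erule tt_mem)+
  also have "\<dots> = E3 A B C (rbr A B C u c)"
    by (rule SW_rbr_dact) (assumption | rule tcs | erule tt_mem)+
  also have "\<dots> = E3 A B C (iL A B C (tens k (A \<otimes>\<^sub>t B) C u c))"
    using A B C u c by (simp add: iL_tens)
  finally show "iL A B C (dact (A \<otimes>\<^sub>t B) C \<one> (tens k (A \<otimes>\<^sub>t B) C u c)) = E3 A B C (iL A B C (tens k (A \<otimes>\<^sub>t B) C u c))"
    unfolding 1 .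
qed (assumption | rule tc A B C | erule tt_mem)+

lemma iL_in:
  assumes "LM A" "LM B" "LM C" "x \<in> carrier ((A \<otimes>\<^sub>t B) \<boxtimes> C)"
  shows "iL A B C x \<in> carrier (A \<boxtimes> B \<boxtimes> C)"
  by (assumption | rule tc assms | erule tt_mem)+

lemma asm_in:
  assumes "LM A" "LM B" "LM C" "x \<in> carrier ((A \<otimes>\<^sub>t B) \<otimes>\<^sub>t C)"
  shows "asm A B C x \<in> carrier (A \<otimes>\<^sub>t (B \<otimes>\<^sub>t C))"
  unfolding asm_def by (assumption | rule tc iL_in assms(1-3) tt_D(1)[OF _ _ assms(4)] | erule tt_mem)+

text \<open>An element \<open>x\<close> fixed by \<Delta>(1) has an image \<open>iL A B C x\<close>
  fixed by \<open>E3\<close>, and \<open>E3\<close> is what projecting and applying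
  \<open>iR\<close> produce after \<open>pR\<close>.\<close>

lemma iR_asm:
  assumes A: "LM A" and B: "LM B" and C: "LM C" and x: "x \<in> carrier ((A \<otimes>\<^sub>t B) \<otimes>\<^sub>t C)"
  shows "iR A B C (asm A B C x) = iL A B C x"
proof -
  note x' = tt_D[OF LM_tt[OF A B] C x]
  have "iR A B C (asm A B C x) = E3 A B C (iL A B C x)"
    unfolding asm_def by (rule iR_dact_pR[OF A B C]) (rule iL_in[OF A B C x'(1)])
  also have "\<dots> = iL A B C x"
    using iL_dact[OF A B C x'(1)] x'(2) by simp
  finally show ?thesis .
qed

lemma assoc_t_eq:
  assumes A: "LM A" and B: "LM B" and C: "LM C"
  shows "assoc_t k H A B C = Arrow ((A \<otimes>\<^sub>t B) \<otimes>\<^sub>t C) (A \<otimes>\<^sub>t (B \<otimes>\<^sub>t C))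
    (\<lambda>x\<in>carrier ((A \<otimes>\<^sub>t B) \<otimes>\<^sub>t C). asm A B C x)"
proof -
  have "(THE y. y \<in> carrier (A \<otimes>\<^sub>t (B \<otimes>\<^sub>t C)) \<and> iR A B C y = iL A B C x) = asm A B C x"
    if x: "x \<in> carrier ((A \<otimes>\<^sub>t B) \<otimes>\<^sub>t C)" for x
  proof (rule the_equality)
    show "asm A B C x \<in> carrier (A \<otimes>\<^sub>t (B \<otimes>\<^sub>t C)) \<and> iR A B C (asm A B C x) = iL A B C x"
      using asm_in iR_asm A B C x by blast
    fix y assume y: "y \<in> carrier (A \<otimes>\<^sub>t (B \<otimes>\<^sub>t C)) \<and> iR A B C y = iL A B C x"
    have eq: "iR A B C y = iR A B C (asm A B C x)"
      using y iR_asm[OF A B C x] by simp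
    have "y = pR A B C (iR A B C y)"
      by (rule pR_iR[OF A B C, symmetric]) (use y tt_D(1)[OF A LM_tt[OF B C]] in blast)
    also have "\<dots> = asm A B C x"
      unfolding eq by (rule pR_iR[OF A B C tt_D(1)[OF A LM_tt[OF B C] asm_in[OF A B C x]]])
    finally show "y = asm A B C x" .
  qed
  then show ?thesis unfolding assoc_t_def by (auto simp: restrict_def)
qed

end

section \<open>The category of modules\<close>

lemma category_concrete:
  assumes fs: "\<And>A B f. A \<in> Ob \<Longrightarrow> B \<in> Ob \<Longrightarrow> f \<in> homs A B \<Longrightarrow> f \<in> extensional (car A) \<and> f \<in> car A \<rightarrow> car B"
    and id: "\<And>A. A \<in> Ob \<Longrightarrow> (\<lambda>x\<in>car A. x) \<in> homs A A"
    and comp: "\<And>A B E f g. A \<in> Ob \<Longrightarrow> B \<in> Ob \<Longrightarrow> E \<in> Ob \<Longrightarrow> f \<in> homs A B \<Longrightarrow> g \<in> homs B E \<Longrightarrow>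
      compose (car A) g f \<in> homs A E"
  shows "category (concrete_category Ob car homs)"
proof
  show "Comp (concrete_category Ob car homs) (Comp (concrete_category Ob car homs) h g) f =
      Comp (concrete_category Ob car homs) h (Comp (concrete_category Ob car homs) g f)"
    if "in_hom (concrete_category Ob car homs) f A B" "in_hom (concrete_category Ob car homs) g B E"
      "in_hom (concrete_category Ob car homs) h E F" for f g h A B E F
    using that fs by (fastforce simp: concrete_category_def in_hom_def compose_def fun_eq_iff restrict_def)
  show "Comp (concrete_category Ob car homs) (Ident (concrete_category Ob car homs) B) f = f"
    if hf: "in_hom (concrete_category Ob car homs) f A B" for f A B
  proof -
    obtain \<phi> where "f = Arrow A B \<phi>" "A \<in> Ob" "B \<in> Ob" "\<phi> \<in> homs A B"
      using hf by (auto simp: concrete_category_def in_hom_def)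
    then show ?thesis using fs[of A B \<phi>]
      by (auto simp: concrete_category_def compose_def extensional_def fun_eq_iff restrict_def)
  qed
  show "Comp (concrete_category Ob car homs) f (Ident (concrete_category Ob car homs) A) = f"
    if hf: "in_hom (concrete_category Ob car homs) f A B" for f A B
  proof -
    obtain \<phi> where "f = Arrow A B \<phi>" "A \<in> Ob" "B \<in> Ob" "\<phi> \<in> homs A B"
      using hf by (auto simp: concrete_category_def in_hom_def)
    then show ?thesis using fs[of A B \<phi>]
      by (auto simp: concrete_category_def compose_def extensional_def fun_eq_iff restrict_def)
  qed
qed (use id comp in \<open>auto simp: concrete_category_def in_hom_def\<close>)

context weak_bialg
begin

abbreviation hom where "hom \<equiv> H_linear_maps k H"
abbreviation CM where "CM \<equiv> left_modules k H"

lemma CM_simps [simp]: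
  "Obj CM = {M. LM M}" "Dom CM = src" "Cod CM = tgt"
  "Ident CM M = Arrow M M (\<lambda>x\<in>carrier M. x)"
  "Comp CM g f = Arrow (src f) (tgt g) (compose (carrier (src f)) (mor g) (mor f))"
  "tens_obj CM = tensor_t k H" "tens_arr CM = tensor_t_arr k H" "unit_obj CM = U"
  "associator CM = assoc_t k H" "left_unitor CM = lunit_t k H" "right_unitor CM = runit_t k H"
  by (simp_all add: left_modules_def left_modules_category_def concrete_category_def)

lemma Arr_CM: "Arrow A B f \<in> Arr CM \<longleftrightarrow> LM A \<and> LM B \<and> f \<in> hom A B"
  by (simp add: left_modules_def left_modules_category_def concrete_category_def)

lemma in_hom_CM: "in_hom CM f A B \<longleftrightarrow> LM A \<and> LM B \<and> (\<exists>g\<in>hom A B. f = Arrow A B g)"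
  by (cases f) (auto simp: in_hom_def Arr_CM)

lemma homI:
  "f \<in> extensional (carrier M) \<Longrightarrow> lin M N f \<Longrightarrow>
    (\<And>h m. h \<in> carrier H \<Longrightarrow> m \<in> carrier M \<Longrightarrow> f (act M h m) = act N h (f m)) \<Longrightarrow> f \<in> hom M N"
  by (simp add: H_linear_maps_def)

lemma hom_D:
  assumes "f \<in> hom M N"
  shows "f \<in> extensional (carrier M)" "lin M N f"
    "h \<in> carrier H \<Longrightarrow> m \<in> carrier M \<Longrightarrow> f (act M h m) = act N h (f m)"
    "m \<in> carrier M \<Longrightarrow> f m \<in> carrier N"
  using assms lin_closed[of M N f m] by (auto simp: H_linear_maps_def)

lemma hom_restrictI:
  assumes "LM M" "lin M N f"
    "\<And>h m. h \<in> carrier H \<Longrightarrow> m \<in> carrier M \<Longrightarrow> f (act M h m) = act N h (f m)"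
  shows "restrict f (carrier M) \<in> hom M N"
proof (rule homI)
  show "lin M N (restrict f (carrier M))"
    using lin_cong[OF module_LM[OF assms(1)], of "restrict f (carrier M)" f N] assms(2) by simp
qed (use assms in \<open>auto simp: act_in\<close>)

lemma id_hom: "LM M \<Longrightarrow> (\<lambda>x\<in>carrier M. x) \<in> hom M M"
  by (rule hom_restrictI[where f = "\<lambda>x. x"]) (simp_all add: lin_id)

lemma compose_hom:
  assumes "LM A" "f \<in> hom A B" "g \<in> hom B E"
  shows "compose (carrier A) g f \<in> hom A E"
proof -
  have "(\<lambda>x\<in>carrier A. g (f x)) \<in> hom A E"
    by (rule hom_restrictI[OF assms(1)])
      (use assms in \<open>auto simp: hom_D intro: lin_comp[of B E g A f]\<close>)
  then show ?thesis by (simp add: compose_def)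
qed

section \<open>The regular module and the unit object\<close>

lemma carrier_R: "carrier R = carrier H"
  by (simp add: regular_def hmod_on_simps)

lemma R_ops:
  "x \<in> carrier H \<Longrightarrow> y \<in> carrier H \<Longrightarrow> x \<oplus>\<^bsub>R\<^esub> y = x \<oplus> y"
  "a \<in> carrier k \<Longrightarrow> x \<in> carrier H \<Longrightarrow> a \<odot>\<^bsub>R\<^esub> x = a \<odot> x"
  "h \<in> carrier H \<Longrightarrow> x \<in> carrier H \<Longrightarrow> act R h x = h \<otimes> x"
  by (simp_all add: regular_def hmod_on_simps)

lemma LM_R [tc]: "LM R"
proof -
  interpret H: module k H by (rule module_H)
  have l: "lin H H (\<lambda>x. h \<otimes> x)" if "h \<in> carrier H" for h
    by (assumption | rule tc that)+
  show ?thesis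
    unfolding regular_def
    by (rule left_module_hmod_on) (auto simp: mult_in mult_assoc lin_add[OF l] lin_smult[OF l] intro: tc)
qed

lemma R_cong:
  fixes N :: "('u, 'u, 'p) module_scheme" and P :: "('u, 'u, 'q) module_scheme"
  shows "R \<boxtimes> N = H \<boxtimes> N" "tens k R N = tens k H N" "tlift k R N P f = tlift k H N P f"
    "N \<boxtimes> R = N \<boxtimes> H" "tens k N R = tens k N H" "tlift k N R P f = tlift k N H P f"
  by (rule tensor_cong1; simp add: carrier_R R_ops)+

lemma lin_R: "lin R N = lin H N" "lin N R = lin N H"
  by (rule linear_map_cong_dom linear_map_cong_cod; simp add: carrier_R R_ops)+

lemma in_U: "z \<in> carrier U \<longleftrightarrow> z \<in> carrier H \<and> et z = z"
  by (auto simp: unit_t_def hmod_on_simps et_in et_et) (metis imageI)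

lemma U_mem: "z \<in> carrier U \<Longrightarrow> z \<in> carrier H"
  by (simp add: in_U)

lemma U_ops:
  "x \<in> carrier U \<Longrightarrow> y \<in> carrier U \<Longrightarrow> x \<oplus>\<^bsub>U\<^esub> y = x \<oplus> y"
  "a \<in> carrier k \<Longrightarrow> x \<in> carrier U \<Longrightarrow> a \<odot>\<^bsub>U\<^esub> x = a \<odot> x"
  "h \<in> carrier H \<Longrightarrow> x \<in> carrier U \<Longrightarrow> act U h x = et (h \<otimes> x)"
  by (simp_all add: unit_t_def hmod_on_simps)

lemma et_in_U [tc]: "h \<in> carrier H \<Longrightarrow> et h \<in> carrier U"
  by (simp add: in_U et_et et_in)

lemma one_in_U [tc]: "\<one> \<in> carrier U"
  by (simp add: in_U one_in et_one)

lemma LM_U [tc]: "LM U"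
proof -
  interpret H: module k H by (rule module_H)
  have C: "x \<in> et ` carrier H \<longleftrightarrow> x \<in> carrier H \<and> et x = x" for x
    using in_U[of x] by (simp add: unit_t_def hmod_on_simps)
  have l: "lin H H (\<lambda>x. et (h \<otimes> x))" if "h \<in> carrier H" for h
    by (assumption | rule tc that)+
  show ?thesis
    unfolding unit_t_def
  proof (rule left_module_hmod_on)
    show "\<zero> \<in> et ` carrier H" using lin_zero[OF module_H module_H lin_et] by (simp add: C)
    show "lin H H (\<lambda>h. et (h \<otimes> x))" if "x \<in> et ` carrier H" for x
      using that C by (intro tc) auto
  qed (auto simp: C mult_in et_in et_et et_mult_et mult_assoc lin_add[OF l] lin_smult[OF l]
      lin_add[OF lin_et] lin_smult[OF lin_et] intro: tc)
qed

lemma lin_U_H [tc]: "lin U H (\<lambda>x. x)"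
  by (rule linI) (simp_all add: in_U U_ops)

lemma lin_et_U [tc]:
  assumes f: "lin Q H f"
  shows "lin Q U (\<lambda>x. et (f x))"
proof -
  have l: "lin Q H (\<lambda>x. et (f x))" by (assumption | rule tc f)+
  show ?thesis
    by (rule linI) (simp_all add: U_ops et_in_U lin_closed[OF f] lin_add[OF l] lin_smult[OF l])
qed

section \<open>The unit constraints and their inverses\<close>

lemma SW_et_mult:
  assumes h: "h \<in> carrier H"
  shows "SW H (\<lambda>a b. et a \<otimes> b) h = h"
proof -
  have "SW H (\<lambda>a b. et a \<otimes> b) h = SW H (\<lambda>a b. SW H (\<lambda>p q. eps (p \<otimes> a) \<odot> (q \<otimes> b)) \<one>) h"
    by (rule tlift_cong, rule et_push[where f = "\<lambda>x. x \<otimes> _"]) (assumption | rule tc h)+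
  also have "\<dots> = SW H (\<lambda>p q. SW H (\<lambda>a b. eps (p \<otimes> a) \<odot> (q \<otimes> b)) h) \<one>"
    by (rule tl_swap) (assumption | rule tc h)+
  \<comment> \<open>The double sum is the counit applied to the first leg of
    \<open>\<Delta>(1)\<Delta>(h) = \<Delta>(h)\<close>.\<close>
  also have "\<dots> = SW H (\<lambda>x y. eps x \<odot> y) (\<one> \<otimes> h)"
    by (rule SW_mult[symmetric]) (assumption | rule tc h)+
  also have "\<dots> = \<one> \<otimes> h"
    by (rule counit1) (assumption | rule tc h)+
  finally show ?thesis using h by simp
qed

text \<open>The transfer identity moves \<open>et z\<close> out of the first factor to the far
  right, after which \<open>SW_et_mult\<close> applies. This is the computation behind the left unit
  constraint, whose value on \<open>\<Delta>(h)(z \<otimes> m)\<close> is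
  \<open>\<epsilon>\<^sub>t(h\<^sub>1 z) h\<^sub>2 m\<close>.\<close>

lemma SW_et_mult2:
  assumes h: "h \<in> carrier H" and z: "z \<in> carrier H"
  shows "SW H (\<lambda>a b. et (a \<otimes> z) \<otimes> b) h = h \<otimes> et z"
proof -
  have "SW H (\<lambda>a b. et (a \<otimes> z) \<otimes> b) h = SW H (\<lambda>a b. et a \<otimes> (b \<otimes> et z)) h"
    by (rule SW_et_transfer[symmetric, where F = "\<lambda>a b. a \<otimes> b"]) (assumption | rule tc h z)+
  also have "\<dots> = SW H (\<lambda>a b. (et a \<otimes> b) \<otimes> et z) h"
    by (rule tlift_cong) (simp add: mult_assoc et_in z)
  also have "\<dots> = SW H (\<lambda>a b. et a \<otimes> b) h \<otimes> et z"
    by (rule SW_push[where g = "\<lambda>x. x \<otimes> et z", symmetric]) (assumption | rule tc h z)+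
  finally show ?thesis using h by (simp add: SW_et_mult)
qed

lemma esb_et:
  assumes z: "z \<in> carrier H"
  shows "esb (et z) = esb z"
  unfolding eps_s_bar_def[of _ _ "et z"] eps_s_bar_def[of _ _ "z"] sweedler_def
  by (rule tlift_cong) (simp add: eps_mult_et z)

text \<open>The left side is the map sending \<open>x \<otimes> y\<close> to
  \<open>\<epsilon>(y z) x\<close>, evaluated at
  \<open>\<Delta>(1)\<Delta>(1) = \<Delta>(1)\<close>. It makes the right unit constraint
  independent of the projection.\<close>

lemma SW_esb_mult:
  assumes z: "z \<in> carrier H"
  shows "SW H (\<lambda>a b. esb (et (b \<otimes> z)) \<otimes> a) \<one> = esb z"
proof -
  have "SW H (\<lambda>a b. esb (et (b \<otimes> z)) \<otimes> a) \<one> = SW H (\<lambda>a b. esb (b \<otimes> z) \<otimes> a) \<one>"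
    by (rule tlift_cong) (simp add: esb_et mult_in z)
  also have "\<dots> = SW H (\<lambda>a b. SW H (\<lambda>p q. eps (q \<otimes> (b \<otimes> z)) \<odot> (p \<otimes> a)) \<one>) \<one>"
    by (rule tlift_cong, rule esb_push[where f = "\<lambda>x. x \<otimes> _"]) (assumption | rule tc z)+
  also have "\<dots> = SW H (\<lambda>p q. SW H (\<lambda>a b. eps (q \<otimes> (b \<otimes> z)) \<odot> (p \<otimes> a)) \<one>) \<one>"
    by (rule tl_swap) (assumption | rule tc z)+
  also have "\<dots> = SW H (\<lambda>p q. SW H (\<lambda>a b. eps ((q \<otimes> b) \<otimes> z) \<odot> (p \<otimes> a)) \<one>) \<one>"
    by (intro tlift_cong) (simp add: mult_assoc z)
  also have "\<dots> = SW H (\<lambda>x y. eps (y \<otimes> z) \<odot> x) (\<one> \<otimes> \<one>)"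
    by (rule SW_mult[symmetric]) (assumption | rule tc z)+
  also have "\<dots> = esb z"
    by (simp add: eps_s_bar_def sweedler_def one_in)
  finally show ?thesis .
qed

text \<open>The unit constraints are defined here on the full tensor products;
  \<open>lm_dact\<close> and \<open>rm_dact\<close> confirm that on projected pure tensors they take
  the prescribed values. The inverse of the left one is \<open>linv\<close>, the projection of
  \<open>\<one> \<otimes> m\<close>.\<close>

definition lm where "lm M x = tl U M M (\<lambda>z m. act M z m) x"
definition rm where "rm M x = tl M U M (\<lambda>m z. act M (esb z) m) x"
definition linv where "linv M m = dact U M \<one> (tens k U M \<one> m)"

lemma lin_lm [tc]: "LM M \<Longrightarrow> lin Q (U \<boxtimes> M) f \<Longrightarrow> lin Q M (\<lambda>x. lm M (f x))"
  unfolding lm_def by (assumption | rule tc | erule U_mem)+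

lemma lin_rm [tc]: "LM M \<Longrightarrow> lin Q (M \<boxtimes> U) f \<Longrightarrow> lin Q M (\<lambda>x. rm M (f x))"
  unfolding rm_def by (assumption | rule tc | erule U_mem)+

lemma lin_linv [tc]: "LM M \<Longrightarrow> lin Q M f \<Longrightarrow> module k Q \<Longrightarrow> lin Q (U \<otimes>\<^sub>t M) (\<lambda>x. linv M (f x))"
  unfolding linv_def by (assumption | rule tc | erule U_mem)+

lemma lm_tens: "LM M \<Longrightarrow> z \<in> carrier U \<Longrightarrow> m \<in> carrier M \<Longrightarrow> lm M (tens k U M z m) = act M z m"
  unfolding lm_def by (rule tlift_tens) (assumption | rule tc | erule U_mem)+

lemma rm_tens: "LM M \<Longrightarrow> m \<in> carrier M \<Longrightarrow> z \<in> carrier U \<Longrightarrow> rm M (tens k M U m z) = act M (esb z) m"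
  unfolding rm_def by (rule tlift_tens) (assumption | rule tc | erule U_mem)+

text \<open>The case \<open>h = \<one>\<close> is the defining property of the left unit constraint;
  general \<open>h\<close> gives its \<open>H\<close>-linearity in \<open>lm_act\<close>.\<close>

lemma lm_dact:
  assumes M: "LM M" and h: "h \<in> carrier H" and z: "z \<in> carrier U" and m: "m \<in> carrier M"
  shows "lm M (dact U M h (tens k U M z m)) = act M h (act M z m)"
proof -
  have z': "z \<in> carrier H" "et z = z" using z by (simp_all add: in_U)
  note tcs = tc M h z m z'
  have 1: "dact U M h (tens k U M z m) = SW (U \<boxtimes> M) (\<lambda>a b. tens k U M (act U a z) (act M b m)) h"
    by (rule act2_tens) (assumption | rule tcs)+
  have 2: "SW (U \<boxtimes> M) (\<lambda>a b. tens k U M (act U a z) (act M b m)) h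
     = SW (U \<boxtimes> M) (\<lambda>a b. tens k U M (et (a \<otimes> z)) (act M b m)) h"
    by (rule tlift_cong) (simp add: U_ops z)
  have "lm M (SW (U \<boxtimes> M) (\<lambda>a b. tens k U M (et (a \<otimes> z)) (act M b m)) h)
      = SW M (\<lambda>a b. lm M (tens k U M (et (a \<otimes> z)) (act M b m))) h"
    by (rule SW_push[where g = "\<lambda>x. lm M x"]) (assumption | rule tcs)+
  also have "\<dots> = SW M (\<lambda>a b. act M (et (a \<otimes> z) \<otimes> b) m) h"
    by (rule tlift_cong) (simp add: lm_tens et_in_U mult_in act_in et_in act_mult M m z')
  also have "\<dots> = act M (SW H (\<lambda>a b. et (a \<otimes> z) \<otimes> b) h) m"
    by (rule SW_push[where g = "\<lambda>x. act M x m", symmetric]) (assumption | rule tcs)+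
  also have "\<dots> = act M h (act M z m)"
    using h z' M m by (simp add: SW_et_mult2 act_mult)
  finally show ?thesis unfolding 1 2 .
qed

lemma rm_dact:
  assumes M: "LM M" and z: "z \<in> carrier U" and m: "m \<in> carrier M"
  shows "rm M (dact M U \<one> (tens k M U m z)) = act M (esb z) m"
proof -
  have z': "z \<in> carrier H" "et z = z" using z by (simp_all add: in_U)
  note tcs = tc M z m z'
  have 1: "dact M U \<one> (tens k M U m z) = SW (M \<boxtimes> U) (\<lambda>a b. tens k M U (act M a m) (act U b z)) \<one>"
    by (rule act2_tens) (assumption | rule tcs)+
  have 2: "SW (M \<boxtimes> U) (\<lambda>a b. tens k M U (act M a m) (act U b z)) \<one>
     = SW (M \<boxtimes> U) (\<lambda>a b. tens k M U (act M a m) (et (b \<otimes> z))) \<one>"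
    by (rule tlift_cong) (simp add: U_ops z)
  have "rm M (SW (M \<boxtimes> U) (\<lambda>a b. tens k M U (act M a m) (et (b \<otimes> z))) \<one>)
      = SW M (\<lambda>a b. rm M (tens k M U (act M a m) (et (b \<otimes> z)))) \<one>"
    by (rule SW_push[where g = "\<lambda>x. rm M x"]) (assumption | rule tcs)+
  also have "\<dots> = SW M (\<lambda>a b. act M (esb (et (b \<otimes> z)) \<otimes> a) m) \<one>"
    by (rule tlift_cong) (simp add: rm_tens et_in_U mult_in act_in et_in esb_in act_mult M m z')
  also have "\<dots> = act M (SW H (\<lambda>a b. esb (et (b \<otimes> z)) \<otimes> a) \<one>) m"
    by (rule SW_push[where g = "\<lambda>x. act M x m", symmetric]) (assumption | rule tcs)+
  also have "\<dots> = act M (esb z) m"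
    using z' by (simp add: SW_esb_mult)
  finally show ?thesis unfolding 1 2 .
qed

lemma lunit_t_eq:
  assumes M: "LM M"
  shows "lunit_t k H M = Arrow (U \<otimes>\<^sub>t M) M (\<lambda>x\<in>carrier (U \<otimes>\<^sub>t M). lm M x)"
proof -
  let ?f = "\<lambda>x\<in>carrier (U \<otimes>\<^sub>t M). lm M x"
  have l: "lin (U \<otimes>\<^sub>t M) M (\<lambda>x. lm M x)" by (assumption | rule tc M)+
  have l': "lin (U \<otimes>\<^sub>t M) M ?f"
    using lin_cong[OF module_LM[OF LM_tt[OF LM_U M]], of ?f "lm M" M] l by simp
  have d: "dact U M \<one> (tens k U M z m) \<in> carrier (U \<otimes>\<^sub>t M)" if "z \<in> carrier U" "m \<in> carrier M" for z m
    by (assumption | rule tc M that)+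
  have v: "?f (dact U M \<one> (tens k U M z m)) = act M z m" if "z \<in> carrier U" "m \<in> carrier M" for z m
    using that M d U_mem by (simp add: lm_dact one_in act_one act_in)
  show ?thesis
    unfolding lunit_t_def arrow.inject
  proof (intro conjI refl the_equality)
    fix f assume f: "f \<in> extensional (carrier (U \<otimes>\<^sub>t M)) \<and> lin (U \<otimes>\<^sub>t M) M f \<and>
        (\<forall>z\<in>carrier U. \<forall>m\<in>carrier M. f (dact U M \<one> (tens k U M z m)) = act M z m)"
    show "f = ?f"
    proof (rule extensionalityI[of _ "carrier (U \<otimes>\<^sub>t M)"])
      show "f x = ?f x" if "x \<in> carrier (U \<otimes>\<^sub>t M)" for x
        by (rule tt_ext[OF LM_U M module_LM[OF M] _ l' _ that]) (use f v in auto)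
    qed (use f in auto)
  qed (use l' v in auto)
qed

lemma runit_t_eq:
  assumes M: "LM M"
  shows "runit_t k H M = Arrow (M \<otimes>\<^sub>t U) M (\<lambda>x\<in>carrier (M \<otimes>\<^sub>t U). rm M x)"
proof -
  let ?f = "\<lambda>x\<in>carrier (M \<otimes>\<^sub>t U). rm M x"
  have l: "lin (M \<otimes>\<^sub>t U) M (\<lambda>x. rm M x)" by (assumption | rule tc M)+
  have l': "lin (M \<otimes>\<^sub>t U) M ?f"
    using lin_cong[OF module_LM[OF LM_tt[OF M LM_U]], of ?f "rm M" M] l by simp
  have d: "dact M U \<one> (tens k M U m z) \<in> carrier (M \<otimes>\<^sub>t U)" if "m \<in> carrier M" "z \<in> carrier U" for z m
    by (assumption | rule tc M that)+
  have v: "?f (dact M U \<one> (tens k M U m z)) = act M (esb z) m" if "m \<in> carrier M" "z \<in> carrier U" for z m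
    using that M d by (simp add: rm_dact)
  show ?thesis
    unfolding runit_t_def arrow.inject
  proof (intro conjI refl the_equality)
    fix f assume f: "f \<in> extensional (carrier (M \<otimes>\<^sub>t U)) \<and> lin (M \<otimes>\<^sub>t U) M f \<and>
        (\<forall>m\<in>carrier M. \<forall>z\<in>carrier U. f (dact M U \<one> (tens k M U m z)) = act M (esb z) m)"
    show "f = ?f"
    proof (rule extensionalityI[of _ "carrier (M \<otimes>\<^sub>t U)"])
      show "f x = ?f x" if "x \<in> carrier (M \<otimes>\<^sub>t U)" for x
        by (rule tt_ext[OF M LM_U module_LM[OF M] _ l' _ that]) (use f v in auto)
    qed (use f in auto)
  qed (use l' v in auto)
qed

lemma linv_in: "LM M \<Longrightarrow> m \<in> carrier M \<Longrightarrow> linv M m \<in> carrier (U \<otimes>\<^sub>t M)"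
  unfolding linv_def by (assumption | rule tc)+

lemma lm_linv: "LM M \<Longrightarrow> m \<in> carrier M \<Longrightarrow> lm M (linv M m) = m"
  unfolding linv_def by (simp add: lm_dact one_in one_in_U act_one)

text \<open>On generators the claim is \<open>\<epsilon>\<^sub>t(1\<^sub>1) \<otimes> 1\<^sub>2 z m
  = \<epsilon>\<^sub>t(1\<^sub>1 z) \<otimes> 1\<^sub>2 m\<close> for \<open>z\<close> in
  \<open>H\<^sub>t\<close>, an instance of the transfer identity.\<close>

lemma linv_lm:
  assumes M: "LM M" and x: "x \<in> carrier (U \<otimes>\<^sub>t M)"
  shows "linv M (lm M x) = x"
proof (rule tt_ext[OF LM_U M _ _ _ _ x, where P = "U \<otimes>\<^sub>t M" and f = "\<lambda>x. linv M (lm M x)" and g = "\<lambda>x. x"])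
  fix z m assume z: "z \<in> carrier U" and m: "m \<in> carrier M"
  have z': "z \<in> carrier H" "et z = z" using z by (simp_all add: in_U)
  note tcs = tc M m z z'
  have "linv M (lm M (dact U M \<one> (tens k U M z m))) = dact U M \<one> (tens k U M \<one> (act M z m))"
    using M z z' m by (simp add: lm_dact one_in act_one act_in linv_def)
  also have "\<dots> = SW (U \<boxtimes> M) (\<lambda>a b. tens k U M (act U a \<one>) (act M b (act M z m))) \<one>"
    by (rule act2_tens) (assumption | rule tcs)+
  also have "\<dots> = SW (U \<boxtimes> M) (\<lambda>a b. tens k U M (et a) (act M (b \<otimes> et z) m)) \<one>"
    by (rule tlift_cong) (simp add: U_ops one_in_U act_mult M m z')
  \<comment> \<open>The repeated \<open>et\<close> prepares the transfer: the test map must be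
    defined for every \<open>a\<close> in \<open>H\<close>, and its own \<open>et\<close> brings the
    first factor into the unit object.\<close>
  also have "\<dots> = SW (U \<boxtimes> M) (\<lambda>a b. tens k U M (et (et a)) (act M (b \<otimes> et z) m)) \<one>"
    by (rule tlift_cong) (simp add: et_et)
  also have "\<dots> = SW (U \<boxtimes> M) (\<lambda>a b. tens k U M (et (et (a \<otimes> z))) (act M b m)) \<one>"
    by (rule SW_et_transfer[where F = "\<lambda>a b. tens k U M (et a) (act M b m)"]) (assumption | rule tcs)+
  also have "\<dots> = SW (U \<boxtimes> M) (\<lambda>a b. tens k U M (act U a z) (act M b m)) \<one>"
    by (rule tlift_cong) (simp add: et_et U_ops z z' mult_in)
  also have "\<dots> = dact U M \<one> (tens k U M z m)"
    by (rule act2_tens[symmetric]) (assumption | rule tcs)+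
  finally show "linv M (lm M (dact U M \<one> (tens k U M z m))) = dact U M \<one> (tens k U M z m)" .
qed (assumption | rule tc M)+

lemma lm_act:
  assumes M: "LM M" and h: "h \<in> carrier H" and x: "x \<in> carrier (U \<otimes>\<^sub>t M)"
  shows "lm M (act (U \<otimes>\<^sub>t M) h x) = act M h (lm M x)"
proof -
  have "lm M (dact U M h x) = act M h (lm M x)"
    by (rule lin_ext[where P = M and f = "\<lambda>x. lm M (dact U M h x)" and g = "\<lambda>x. act M h (lm M x)",
          OF _ _ _ _ _ _ tt_D(1)[OF LM_U M x]])
      (assumption | rule tc M h | simp add: lm_dact lm_tens M h)+
  then show ?thesis using h x by (simp add: tt_ops)
qed

lemma inverse_lunit:
  assumes M: "LM M"
  shows "inverse_arrow CM (lunit_t k H M) = Arrow M (U \<otimes>\<^sub>t M) (\<lambda>m\<in>carrier M. linv M m)"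
proof -
  have lm_in: "lm M x \<in> carrier M" if "x \<in> carrier (U \<otimes>\<^sub>t M)" for x
    using lin_closed[of "U \<otimes>\<^sub>t M" M "\<lambda>x. lm M x"] that by (simp add: lin_lm lin_tt_incl M LM_U)
  have l: "(\<lambda>x\<in>carrier (U \<otimes>\<^sub>t M). lm M x) \<in> hom (U \<otimes>\<^sub>t M) M"
    by (rule hom_restrictI) (assumption | rule tc M | simp add: lm_act M)+
  have i: "(\<lambda>m\<in>carrier M. linv M m) \<in> hom M (U \<otimes>\<^sub>t M)"
  proof (rule hom_restrictI[OF M])
    fix h m assume h: "h \<in> carrier H" and m: "m \<in> carrier M"
    \<comment> \<open>Linearity of the inverse over \<open>H\<close> is inherited from
      \<open>lm\<close> by cancellation.\<close>
    have "linv M (act M h m) = linv M (lm M (act (U \<otimes>\<^sub>t M) h (linv M m)))"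
      using lm_act[OF M h linv_in[OF M m]] lm_linv[OF M m] by simp
    also have "\<dots> = act (U \<otimes>\<^sub>t M) h (linv M m)"
      by (rule linv_lm[OF M]) (assumption | rule tc M h m linv_in)+
    finally show "linv M (act M h m) = act (U \<otimes>\<^sub>t M) h (linv M m)" .
  qed (assumption | rule tc M)+
  have in_i: "in_hom CM (Arrow M (U \<otimes>\<^sub>t M) (\<lambda>m\<in>carrier M. linv M m)) M (U \<otimes>\<^sub>t M)"
    using M i LM_tt[OF LM_U M] unfolding in_hom_CM by blast
  show ?thesis
    unfolding inverse_arrow_def lunit_t_eq[OF M]
  proof (rule the_equality)
    show "is_inverse CM (Arrow (U \<otimes>\<^sub>t M) M (\<lambda>x\<in>carrier (U \<otimes>\<^sub>t M). lm M x)) (Arrow M (U \<otimes>\<^sub>t M) (\<lambda>m\<in>carrier M. linv M m))"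
      using M l in_i unfolding is_inverse_def
      by (auto simp: Arr_CM LM_tt LM_U compose_def fun_eq_iff linv_in lm_in lm_linv linv_lm)
  next
    fix g assume g: "is_inverse CM (Arrow (U \<otimes>\<^sub>t M) M (\<lambda>x\<in>carrier (U \<otimes>\<^sub>t M). lm M x)) g"
    then obtain \<phi> where \<phi>: "g = Arrow M (U \<otimes>\<^sub>t M) \<phi>" "\<phi> \<in> hom M (U \<otimes>\<^sub>t M)"
      by (auto simp: is_inverse_def in_hom_CM)
    have *: "\<phi> (lm M x) = x" if "x \<in> carrier (U \<otimes>\<^sub>t M)" for x
      using g that by (auto simp: is_inverse_def \<phi> compose_def fun_eq_iff split: if_splits)
    have "\<phi> = (\<lambda>m\<in>carrier M. linv M m)"
    proof (rule extensionalityI[of _ "carrier M"])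
      show "\<phi> m = (\<lambda>m\<in>carrier M. linv M m) m" if "m \<in> carrier M" for m
        using *[OF linv_in[OF M that]] lm_linv[OF M that] that by simp
    qed (use \<phi> in \<open>auto simp: hom_D\<close>)
    then show "g = Arrow M (U \<otimes>\<^sub>t M) (\<lambda>m\<in>carrier M. linv M m)" using \<phi> by simp
  qed
qed

section \<open>Tensor products of morphisms\<close>

definition tm where
  "tm A A' B B' f g w = tl A A' (B \<boxtimes> B') (\<lambda>m n. tens k B B' (f m) (g n)) w"

lemma lin_tm:
  "LM A \<Longrightarrow> LM A' \<Longrightarrow> LM B \<Longrightarrow> LM B' \<Longrightarrow> lin A B f \<Longrightarrow> lin A' B' g \<Longrightarrow> lin (A \<boxtimes> A') (B \<boxtimes> B') (tm A A' B B' f g)"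
  unfolding tm_def[abs_def] by (assumption | rule tc | erule (1) lin_closed)+

lemma tm_tens:
  "LM A \<Longrightarrow> LM A' \<Longrightarrow> LM B \<Longrightarrow> LM B' \<Longrightarrow> lin A B f \<Longrightarrow> lin A' B' g \<Longrightarrow> m \<in> carrier A \<Longrightarrow> n \<in> carrier A' \<Longrightarrow>
    tm A A' B B' f g (tens k A A' m n) = tens k B B' (f m) (g n)"
  unfolding tm_def by (rule tlift_tens) (assumption | rule tc | erule (1) lin_closed)+

lemma tm_dact:
  assumes A: "LM A" and A': "LM A'" and B: "LM B" and B': "LM B'" and f: "f \<in> hom A B" and g: "g \<in> hom A' B'"
    and h: "h \<in> carrier H" and w: "w \<in> carrier (A \<boxtimes> A')"
  shows "tm A A' B B' f g (dact A A' h w) = dact B B' h (tm A A' B B' f g w)"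
proof -
  note lf = hom_D(2)[OF f] and lg = hom_D(2)[OF g]
  note l = lin_tm[OF A A' B B' lf lg]
  note tcs = tc A A' B B' h lin_comp[OF l] lin_comp[OF lf] lin_comp[OF lg]
  show ?thesis
  proof (rule lin_ext[where P = "B \<boxtimes> B'" and f = "\<lambda>w. tm A A' B B' f g (dact A A' h w)"
        and g = "\<lambda>w. dact B B' h (tm A A' B B' f g w)", OF _ _ _ _ _ _ w])
    fix m n assume m: "m \<in> carrier A" and n: "n \<in> carrier A'"
    note tcs = tcs m n hom_D(4)[OF f m] hom_D(4)[OF g n]
    have 1: "dact A A' h (tens k A A' m n) = SW (A \<boxtimes> A') (\<lambda>a b. tens k A A' (act A a m) (act A' b n)) h"
      by (rule act2_tens) (assumption | rule tcs)+
    have "tm A A' B B' f g (SW (A \<boxtimes> A') (\<lambda>a b. tens k A A' (act A a m) (act A' b n)) h)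
      = SW (B \<boxtimes> B') (\<lambda>a b. tm A A' B B' f g (tens k A A' (act A a m) (act A' b n))) h"
      by (rule SW_push[OF l]) (assumption | rule tcs)+
    also have "\<dots> = SW (B \<boxtimes> B') (\<lambda>a b. tens k B B' (act B a (f m)) (act B' b (g n))) h"
      by (rule tlift_cong) (simp add: tm_tens A A' B B' lf lg act_in m n hom_D(3)[OF f] hom_D(3)[OF g])
    also have "\<dots> = dact B B' h (tens k B B' (f m) (g n))"
      by (rule act2_tens[symmetric]) (assumption | rule tcs)+
    also have "\<dots> = dact B B' h (tm A A' B B' f g (tens k A A' m n))"
      by (simp add: tm_tens A A' B B' lf lg m n)
    finally show "tm A A' B B' f g (dact A A' h (tens k A A' m n)) = dact B B' h (tm A A' B B' f g (tens k A A' m n))"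
      unfolding 1 .
  qed (assumption | rule tcs)+
qed

lemma tm_in:
  assumes A: "LM A" and A': "LM A'" and B: "LM B" and B': "LM B'" and f: "f \<in> hom A B" and g: "g \<in> hom A' B'"
    and w: "w \<in> carrier (A \<otimes>\<^sub>t A')"
  shows "tm A A' B B' f g w \<in> carrier (B \<otimes>\<^sub>t B')"
  using tm_dact[OF A A' B B' f g one_in tt_D(1)[OF A A' w]] tt_D[OF A A' w]
    lin_closed[OF lin_tm[OF A A' B B' hom_D(2)[OF f] hom_D(2)[OF g]]] B B'
  by (simp add: in_tt)

lemma tensor_t_arr_eq:
  "tensor_t_arr k H (Arrow A B f) (Arrow A' B' g) =
    Arrow (A \<otimes>\<^sub>t A') (B \<otimes>\<^sub>t B') (\<lambda>w\<in>carrier (A \<otimes>\<^sub>t A'). tm A A' B B' f g w)"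
  by (simp add: tensor_t_arr_def tm_def restrict_def)

end

section \<open>Yetter-Drinfeld modules\<close>

context weak_bialg
begin

lemma tl_tens_id:
  assumes "module k M" "module k N" "u \<in> carrier (M \<boxtimes> N)"
  shows "tl M N (M \<boxtimes> N) (tens k M N) u = u"
  by (rule tlift_unique[where g = "\<lambda>x. x", symmetric]) (assumption | rule tc assms refl)+

lemma lin_dactR:
  assumes M: "LM M" and h: "h \<in> carrier H"
  shows "lin (H \<boxtimes> M) (H \<boxtimes> M) (\<lambda>u. dact R M h u)"
proof -
  have "lin (R \<boxtimes> M) (R \<boxtimes> M) (\<lambda>u. dact R M h u)" by (assumption | rule tc M h)+
  then show ?thesis by (simp add: R_cong)
qed

lemma dactR_tens:
  assumes M: "LM M" and h: "h \<in> carrier H" and g: "g \<in> carrier H" and n: "n \<in> carrier M"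
  shows "dact R M h (tens k H M g n) = SW (H \<boxtimes> M) (\<lambda>a b. tens k H M (a \<otimes> g) (act M b n)) h"
proof -
  have "dact R M h (tens k R M g n) = SW (R \<boxtimes> M) (\<lambda>a b. tens k R M (act R a g) (act M b n)) h"
    by (rule act2_tens[OF LM_R M]) (simp_all add: D_in h g n carrier_R)
  also have "\<dots> = SW (R \<boxtimes> M) (\<lambda>a b. tens k R M (a \<otimes> g) (act M b n)) h"
    by (rule tlift_cong) (simp add: R_ops g)
  finally show ?thesis by (simp add: R_cong)
qed

lemma tl_dactR:
  assumes M: "LM M" and P: "module k P" and F: "bil H M P F" and h: "h \<in> carrier H"
    and u: "u \<in> carrier (H \<boxtimes> M)"
  shows "tl H M P F (dact R M h u) = tl H M P (\<lambda>g n. SW P (\<lambda>a b. F (a \<otimes> g) (act M b n)) h) u"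
proof -
  note tcs = tc bil_tc[OF F] M P h u
  note l = lin_dactR[OF M h]
  show ?thesis
  proof (rule lin_ext[where P = P and f = "\<lambda>u. tl H M P F (dact R M h u)"
        and g = "\<lambda>u. tl H M P (\<lambda>g n. SW P (\<lambda>a b. F (a \<otimes> g) (act M b n)) h) u", OF _ _ _ _ _ _ u])
    fix g n assume g: "g \<in> carrier H" and n: "n \<in> carrier M"
    have "tl H M P F (dact R M h (tens k H M g n)) =
        SW P (\<lambda>a b. tl H M P F (tens k H M (a \<otimes> g) (act M b n))) h"
      unfolding dactR_tens[OF M h g n]
      by (rule SW_push[where g = "tl H M P F"]) (assumption | rule tcs g n lin_tlift)+
    also have "\<dots> = SW P (\<lambda>a b. F (a \<otimes> g) (act M b n)) h"
      by (rule tlift_cong, rule tlift_tens) (assumption | rule tcs g n)+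
    also have "\<dots> = tl H M P (\<lambda>g n. SW P (\<lambda>a b. F (a \<otimes> g) (act M b n)) h) (tens k H M g n)"
      by (rule tlift_tens[symmetric]) (assumption | rule tcs g n)+
    finally show "tl H M P F (dact R M h (tens k H M g n)) =
      tl H M P (\<lambda>g n. SW P (\<lambda>a b. F (a \<otimes> g) (act M b n)) h) (tens k H M g n)" .
  qed (assumption | rule tcs lin_comp[OF l])+
qed

text \<open>The formula for the half-braiding makes sense on the full tensor product \<open>M \<boxtimes> X\<close>.\<close>

definition sg where
  "sg M \<rho> X w = tl M X (X \<boxtimes> M) (\<lambda>m x. tl H M (X \<boxtimes> M) (\<lambda>h n. tens k X M (act X h x) n) (\<rho> m)) w"

end

text \<open>Coassociativity and counitality are left to the extension \<open>ydm\<close>. When a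
  half-braiding is given, these two must be derived, and the derivation already uses the formula for
  \<sigma> and its properties, which depend only on the conditions collected here.\<close>

locale pre_yd = weak_bialg k H for k :: "'u ring" and H :: "'u bialgebra" (structure) +
  fixes M :: "'u hmod" and \<rho> :: "'u \<Rightarrow> 'u"
  assumes LM_M [tc]: "left_module k H M"
    and lin_rho: "lin M (H \<boxtimes> M) \<rho>"
    and rho_tt: "m \<in> carrier M \<Longrightarrow> dact R M \<one> (\<rho> m) = \<rho> m"
    and rho_dact: "m \<in> carrier M \<Longrightarrow> h \<in> carrier H \<Longrightarrow> dact R M h (\<rho> m) =
      SW (H \<boxtimes> M) (\<lambda>a b. tl H M (H \<boxtimes> M) (\<lambda>g n. tens k H M (g \<otimes> b) n) (\<rho> (act M a m))) h"
begin

abbreviation CO where "CO P F m \<equiv> tl H M P F (\<rho> m)"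

lemma lin_rho' [tc]: "lin Q M f \<Longrightarrow> lin Q (H \<boxtimes> M) (\<lambda>x. \<rho> (f x))"
  by (rule lin_comp[OF lin_rho])

lemma rho_in [tc]: "m \<in> carrier M \<Longrightarrow> \<rho> m \<in> carrier (H \<boxtimes> M)"
  by (rule lin_closed[OF lin_rho])

lemma CO_push:
  assumes "lin P Q g" "bil H M P f" "module k P" "module k Q" "m \<in> carrier M"
  shows "g (CO P f m) = CO Q (\<lambda>a b. g (f a b)) m"
  by (rule tl_push) (assumption | rule tc assms)+

lemma yd_one:
  assumes F: "bil H M P F" and P: "module k P" and m: "m \<in> carrier M"
  shows "CO P (\<lambda>g n. SW P (\<lambda>a b. F (a \<otimes> g) (act M b n)) \<one>) m = CO P F m"
  using tl_dactR[OF LM_M P F one_in rho_in[OF m]] rho_tt[OF m] by simp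

lemma yd_compat:
  assumes F: "bil H M P F" and P: "module k P" and m: "m \<in> carrier M" and h: "h \<in> carrier H"
  shows "CO P (\<lambda>g n. SW P (\<lambda>a b. F (a \<otimes> g) (act M b n)) h) m =
    SW P (\<lambda>a b. CO P (\<lambda>g n. F (g \<otimes> b) n) (act M a m)) h"
proof -
  note tcs = tc bil_tc[OF F] P m h
  have "CO P (\<lambda>g n. SW P (\<lambda>a b. F (a \<otimes> g) (act M b n)) h) m = tl H M P F (dact R M h (\<rho> m))"
    by (rule tl_dactR[symmetric]) (assumption | rule tcs)+
  also have "\<dots> = SW P (\<lambda>a b. tl H M P F (CO (H \<boxtimes> M) (\<lambda>g n. tens k H M (g \<otimes> b) n) (act M a m))) h"
    unfolding rho_dact[OF m h]
    by (rule SW_push[where g = "tl H M P F"]) (assumption | rule tcs lin_tlift)+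
  also have "\<dots> = SW P (\<lambda>a b. CO P (\<lambda>g n. tl H M P F (tens k H M (g \<otimes> b) n)) (act M a m)) h"
    by (rule tlift_cong, rule CO_push[where g = "tl H M P F"]) (assumption | rule tcs lin_tlift)+
  also have "\<dots> = SW P (\<lambda>a b. CO P (\<lambda>g n. F (g \<otimes> b) n) (act M a m)) h"
    by (rule tlift_cong, rule tlift_cong, rule tlift_tens) (assumption | rule tcs)+
  finally show ?thesis .
qed

text \<open>The compatibility condition at \<open>\<one>\<close> trades a unit multiplied on the
  left of the coaction, which \<open>yd_one\<close> absorbs, for a unit on the right. This is the
  rule that removes copies of \<Delta>(1) from arguments of \<sigma>.\<close>

lemma yd_one':
  assumes F: "bil H M P F" and P: "module k P" and m: "m \<in> carrier M"
  shows "SW P (\<lambda>a b. CO P (\<lambda>g n. F (g \<otimes> b) n) (act M a m)) \<one> = CO P F m"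
  using yd_one[OF F P m] yd_compat[OF F P m one_in] by simp

lemma lin_sg [tc]: "LM X \<Longrightarrow> lin Q (M \<boxtimes> X) f \<Longrightarrow> lin Q (X \<boxtimes> M) (\<lambda>w. sg M \<rho> X (f w))"
  unfolding sg_def by (assumption | rule tc)+

lemma sg_in [tc]: "LM X \<Longrightarrow> w \<in> carrier (M \<boxtimes> X) \<Longrightarrow> sg M \<rho> X w \<in> carrier (X \<boxtimes> M)"
  unfolding sg_def by (assumption | rule tc)+

lemma sg_tens: "LM X \<Longrightarrow> m \<in> carrier M \<Longrightarrow> x \<in> carrier X \<Longrightarrow>
    sg M \<rho> X (tens k M X m x) = CO (X \<boxtimes> M) (\<lambda>h n. tens k X M (act X h x) n) m"
  unfolding sg_def by (rule tlift_tens) (assumption | rule tc)+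

lemma sg_dact_tens:
  assumes X: "LM X" and m: "m \<in> carrier M" and x: "x \<in> carrier X" and h: "h \<in> carrier H"
  shows "sg M \<rho> X (dact M X h (tens k M X m x)) =
    SW (X \<boxtimes> M) (\<lambda>a b. CO (X \<boxtimes> M) (\<lambda>g n. tens k X M (act X (g \<otimes> b) x) n) (act M a m)) h"
proof -
  note tcs = tc X m x h
  have 1: "dact M X h (tens k M X m x) = SW (M \<boxtimes> X) (\<lambda>a b. tens k M X (act M a m) (act X b x)) h"
    by (rule act2_tens) (assumption | rule tcs)+
  have "sg M \<rho> X (SW (M \<boxtimes> X) (\<lambda>a b. tens k M X (act M a m) (act X b x)) h) =
      SW (X \<boxtimes> M) (\<lambda>a b. sg M \<rho> X (tens k M X (act M a m) (act X b x))) h"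
    by (rule SW_push[where g = "\<lambda>w. sg M \<rho> X w"]) (assumption | rule tcs)+
  also have "\<dots> = SW (X \<boxtimes> M) (\<lambda>a b. CO (X \<boxtimes> M) (\<lambda>g n. tens k X M (act X g (act X b x)) n) (act M a m)) h"
    by (rule tlift_cong, rule sg_tens) (assumption | rule tcs)+
  also have "\<dots> = SW (X \<boxtimes> M) (\<lambda>a b. CO (X \<boxtimes> M) (\<lambda>g n. tens k X M (act X (g \<otimes> b) x) n) (act M a m)) h"
    by (intro tlift_cong) (simp add: act_mult X x)
  finally show ?thesis unfolding 1 .
qed

lemma sg_dact:
  assumes X: "LM X" and w: "w \<in> carrier (M \<boxtimes> X)" and h: "h \<in> carrier H"
  shows "sg M \<rho> X (dact M X h w) = dact X M h (sg M \<rho> X w)"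
proof (rule lin_ext[where P = "X \<boxtimes> M" and f = "\<lambda>w. sg M \<rho> X (dact M X h w)"
      and g = "\<lambda>w. dact X M h (sg M \<rho> X w)", OF _ _ _ _ _ _ w])
  fix m x assume m: "m \<in> carrier M" and x: "x \<in> carrier X"
  note tcs = tc X m x h
  have "sg M \<rho> X (dact M X h (tens k M X m x)) =
    SW (X \<boxtimes> M) (\<lambda>a b. CO (X \<boxtimes> M) (\<lambda>g n. tens k X M (act X (g \<otimes> b) x) n) (act M a m)) h"
    by (rule sg_dact_tens) (assumption | rule tcs)+
  also have "\<dots> = CO (X \<boxtimes> M) (\<lambda>g n. SW (X \<boxtimes> M) (\<lambda>a b. tens k X M (act X (a \<otimes> g) x) (act M b n)) h) m"
    by (rule yd_compat[symmetric]) (assumption | rule tcs)+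
  also have "\<dots> = CO (X \<boxtimes> M) (\<lambda>g n. SW (X \<boxtimes> M) (\<lambda>a b. tens k X M (act X a (act X g x)) (act M b n)) h) m"
    by (intro tlift_cong) (simp add: act_mult X x)
  also have "\<dots> = CO (X \<boxtimes> M) (\<lambda>g n. dact X M h (tens k X M (act X g x) n)) m"
    by (rule tlift_cong, rule act2_tens[symmetric]) (assumption | rule tcs)+
  also have "\<dots> = dact X M h (CO (X \<boxtimes> M) (\<lambda>g n. tens k X M (act X g x) n) m)"
    by (rule CO_push[symmetric, where g = "\<lambda>w. dact X M h w"]) (assumption | rule tcs)+
  also have "\<dots> = dact X M h (sg M \<rho> X (tens k M X m x))"
    by (simp add: sg_tens X m x)
  finally show "sg M \<rho> X (dact M X h (tens k M X m x)) = dact X M h (sg M \<rho> X (tens k M X m x))" .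
qed (assumption | rule tc X h)+

text \<open>By \<open>yd_one'\<close> the formula for \<sigma> ignores the projection of its
  argument. Values on \<open>M \<otimes>\<^sub>t X\<close> can therefore be computed on unprojected
  pure tensors.\<close>

lemma sg_dact_one:
  assumes X: "LM X" and w: "w \<in> carrier (M \<boxtimes> X)"
  shows "sg M \<rho> X (dact M X \<one> w) = sg M \<rho> X w"
proof (rule lin_ext[where P = "X \<boxtimes> M" and f = "\<lambda>w. sg M \<rho> X (dact M X \<one> w)"
      and g = "\<lambda>w. sg M \<rho> X w", OF _ _ _ _ _ _ w])
  fix m x assume m: "m \<in> carrier M" and x: "x \<in> carrier X"
  note tcs = tc X m x
  have "sg M \<rho> X (dact M X \<one> (tens k M X m x)) =
    SW (X \<boxtimes> M) (\<lambda>a b. CO (X \<boxtimes> M) (\<lambda>g n. tens k X M (act X (g \<otimes> b) x) n) (act M a m)) \<one>"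
    by (rule sg_dact_tens) (assumption | rule tcs)+
  also have "\<dots> = CO (X \<boxtimes> M) (\<lambda>g n. tens k X M (act X g x) n) m"
    by (rule yd_one') (assumption | rule tcs)+
  finally show "sg M \<rho> X (dact M X \<one> (tens k M X m x)) = sg M \<rho> X (tens k M X m x)"
    by (simp add: sg_tens X m x)
qed (assumption | rule tc X)+

text \<open>Since \<sigma> commutes with \<Delta>(1) and also ignores it in the argument, every
  value of \<sigma> is fixed by \<Delta>(1).\<close>

lemma sg_tt: "LM X \<Longrightarrow> w \<in> carrier (M \<boxtimes> X) \<Longrightarrow> sg M \<rho> X w \<in> carrier (X \<otimes>\<^sub>t M)"
  using sg_dact[of X w \<one>] sg_dact_one[of X w] by (simp add: in_tt LM_M sg_in one_in)

lemma sg_hom: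
  assumes X: "LM X"
  shows "(\<lambda>w\<in>carrier (M \<otimes>\<^sub>t X). sg M \<rho> X w) \<in> hom (M \<otimes>\<^sub>t X) (X \<otimes>\<^sub>t M)"
proof (rule hom_restrictI)
  show "lin (M \<otimes>\<^sub>t X) (X \<otimes>\<^sub>t M) (\<lambda>w. sg M \<rho> X w)"
    by (rule lin_tt_cod) (assumption | rule tc X sg_tt | erule tt_mem)+
  show "sg M \<rho> X (act (M \<otimes>\<^sub>t X) h w) = act (X \<otimes>\<^sub>t M) h (sg M \<rho> X w)"
    if "h \<in> carrier H" "w \<in> carrier (M \<otimes>\<^sub>t X)" for h w
    using that tt_D(1)[OF LM_M X that(2)] X by (simp add: tt_ops sg_tt sg_dact)
qed (assumption | rule tc X)+

lemma sg_natural: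
  assumes X: "LM X" and Y: "LM Y" and f: "f \<in> hom X Y" and w: "w \<in> carrier (M \<boxtimes> X)"
  shows "tm X M Y M f (\<lambda>m\<in>carrier M. m) (sg M \<rho> X w) = sg M \<rho> Y (tm M X M Y (\<lambda>m\<in>carrier M. m) f w)"
proof -
  note lf = hom_D(2)[OF f] and li = hom_D(2)[OF id_hom[OF LM_M]]
  note l1 = lin_tm[OF X LM_M Y LM_M lf li] and l2 = lin_tm[OF LM_M X LM_M Y li lf]
  note tcs = tc X Y lin_comp[OF lf] lin_comp[OF l1] lin_comp[OF l2]
  show ?thesis
  proof (rule lin_ext[where P = "Y \<boxtimes> M" and f = "\<lambda>w. tm X M Y M f (\<lambda>m\<in>carrier M. m) (sg M \<rho> X w)"
        and g = "\<lambda>w. sg M \<rho> Y (tm M X M Y (\<lambda>m\<in>carrier M. m) f w)", OF _ _ _ _ _ _ w])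
    fix m x assume m: "m \<in> carrier M" and x: "x \<in> carrier X"
    note fx = hom_D(4)[OF f x]
    note tcs = tcs m x fx
    have "tm X M Y M f (\<lambda>m\<in>carrier M. m) (CO (X \<boxtimes> M) (\<lambda>h n. tens k X M (act X h x) n) m)
        = CO (Y \<boxtimes> M) (\<lambda>h n. tm X M Y M f (\<lambda>m\<in>carrier M. m) (tens k X M (act X h x) n)) m"
      by (rule CO_push[OF l1]) (assumption | rule tcs)+
    also have "\<dots> = CO (Y \<boxtimes> M) (\<lambda>h n. tens k Y M (act Y h (f x)) n) m"
      by (rule tlift_cong) (simp add: tm_tens X Y LM_M lf li act_in x hom_D(3)[OF f])
    finally show "tm X M Y M f (\<lambda>m\<in>carrier M. m) (sg M \<rho> X (tens k M X m x)) =
        sg M \<rho> Y (tm M X M Y (\<lambda>m\<in>carrier M. m) f (tens k M X m x))"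
      by (simp add: sg_tens X Y m x fx tm_tens LM_M lf li)
  qed (assumption | rule tcs)+
qed

text \<open>Expanding \<open>et\<close> gives
  \<open>\<epsilon>(1\<^sub>1 m\<^sub>- z) 1\<^sub>2 m\<^sub>0\<close>, and the coaction is fixed by
  the action of \<Delta>(1).\<close>

lemma CO_act_et:
  assumes m: "m \<in> carrier M" and z: "z \<in> carrier H"
  shows "CO M (\<lambda>h n. act M (et (h \<otimes> z)) n) m = CO M (\<lambda>h n. eps (h \<otimes> z) \<odot>\<^bsub>M\<^esub> n) m"
proof -
  note tcs = tc m z
  have "CO M (\<lambda>h n. act M (et (h \<otimes> z)) n) m =
      CO M (\<lambda>h n. SW M (\<lambda>a b. eps (a \<otimes> (h \<otimes> z)) \<odot>\<^bsub>M\<^esub> act M b n) \<one>) m"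
    by (rule tlift_cong, rule et_push[where f = "\<lambda>x. act M x _"]) (assumption | rule tcs)+
  also have "\<dots> = CO M (\<lambda>h n. SW M (\<lambda>a b. eps ((a \<otimes> h) \<otimes> z) \<odot>\<^bsub>M\<^esub> act M b n) \<one>) m"
    by (intro tlift_cong) (simp add: mult_assoc z)
  also have "\<dots> = CO M (\<lambda>h n. eps (h \<otimes> z) \<odot>\<^bsub>M\<^esub> n) m"
    by (rule yd_one[where F = "\<lambda>h n. eps (h \<otimes> z) \<odot>\<^bsub>M\<^esub> n"]) (assumption | rule tcs)+
  finally show ?thesis .
qed

text \<open>This evaluates \<sigma> at the unit object before counitality is available. At
  \<open>z = \<one>\<close> the unit condition then yields counitality; conversely,
  \<open>CO_eps_esb\<close> turns the right side into the right unit constraint.\<close>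

lemma lm_sg_dact:
  assumes m: "m \<in> carrier M" and z: "z \<in> carrier U"
  shows "lm M (sg M \<rho> U (dact M U \<one> (tens k M U m z))) = CO M (\<lambda>h n. eps (h \<otimes> z) \<odot>\<^bsub>M\<^esub> n) m"
proof -
  note tcs = tc m z U_mem[OF z]
  have 1: "sg M \<rho> U (dact M U \<one> (tens k M U m z)) = sg M \<rho> U (tens k M U m z)"
    by (rule sg_dact_one) (assumption | rule tcs)+
  also have "\<dots> = CO (U \<boxtimes> M) (\<lambda>h n. tens k U M (act U h z) n) m"
    by (rule sg_tens) (assumption | rule tcs)+
  finally have 1: "sg M \<rho> U (dact M U \<one> (tens k M U m z)) = CO (U \<boxtimes> M) (\<lambda>h n. tens k U M (act U h z) n) m" .
  have "lm M (CO (U \<boxtimes> M) (\<lambda>h n. tens k U M (act U h z) n) m) =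
      CO M (\<lambda>h n. lm M (tens k U M (act U h z) n)) m"
    by (rule CO_push[where g = "\<lambda>x. lm M x"]) (assumption | rule tcs)+
  also have "\<dots> = CO M (\<lambda>h n. act M (et (h \<otimes> z)) n) m"
    by (rule tlift_cong) (simp add: lm_tens LM_M act_in LM_U z U_ops et_in_U mult_in U_mem)
  also have "\<dots> = CO M (\<lambda>h n. eps (h \<otimes> z) \<odot>\<^bsub>M\<^esub> n) m"
    by (rule CO_act_et) (assumption | rule tcs)+
  finally show ?thesis unfolding 1 .
qed

text \<open>On \<open>M \<boxtimes> X \<boxtimes> Y\<close> the two sides of the hexagon are \<open>G2 \<circ> G1\<close> and \<open>G3\<close>.\<close>

definition G1 where
  "G1 X Y u = t3 M X Y (X \<boxtimes> M \<boxtimes> Y)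
    (\<lambda>m x y. CO (X \<boxtimes> M \<boxtimes> Y) (\<lambda>h n. tens k X (M \<boxtimes> Y) (act X h x) (tens k M Y n y)) m) u"

definition G2 where
  "G2 X Y u = tl X (M \<boxtimes> Y) (X \<boxtimes> Y \<boxtimes> M) (\<lambda>x v. tens k X (Y \<boxtimes> M) x (sg M \<rho> Y v)) u"

definition G3 where
  "G3 X Y u = tl M (X \<boxtimes> Y) (X \<boxtimes> Y \<boxtimes> M) (\<lambda>m v. CO (X \<boxtimes> Y \<boxtimes> M) (\<lambda>h n. rbr X Y M (dact X Y h v) n) m) u"

lemma lin_G1 [tc]: "LM X \<Longrightarrow> LM Y \<Longrightarrow> lin Q (M \<boxtimes> X \<boxtimes> Y) f \<Longrightarrow> lin Q (X \<boxtimes> M \<boxtimes> Y) (\<lambda>u. G1 X Y (f u))"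
  unfolding G1_def t3_def by (assumption | rule tc)+

lemma lin_G2 [tc]: "LM X \<Longrightarrow> LM Y \<Longrightarrow> lin Q (X \<boxtimes> M \<boxtimes> Y) f \<Longrightarrow> lin Q (X \<boxtimes> Y \<boxtimes> M) (\<lambda>u. G2 X Y (f u))"
  unfolding G2_def by (assumption | rule tc)+

lemma lin_G3 [tc]: "LM X \<Longrightarrow> LM Y \<Longrightarrow> lin Q (M \<boxtimes> X \<boxtimes> Y) f \<Longrightarrow> lin Q (X \<boxtimes> Y \<boxtimes> M) (\<lambda>u. G3 X Y (f u))"
  unfolding G3_def by (assumption | rule tc)+

lemma G1_tens:
  assumes "LM X" "LM Y" "m \<in> carrier M" "x \<in> carrier X" "y \<in> carrier Y"
  shows "G1 X Y (tens k M (X \<boxtimes> Y) m (tens k X Y x y)) =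
    CO (X \<boxtimes> M \<boxtimes> Y) (\<lambda>h n. tens k X (M \<boxtimes> Y) (act X h x) (tens k M Y n y)) m"
  unfolding G1_def by (rule t3_tens) (assumption | rule tc assms)+

lemma G21_tens:
  assumes X: "LM X" and Y: "LM Y" and m: "m \<in> carrier M" and x: "x \<in> carrier X" and y: "y \<in> carrier Y"
  shows "G2 X Y (G1 X Y (tens k M (X \<boxtimes> Y) m (tens k X Y x y))) =
    CO (X \<boxtimes> Y \<boxtimes> M) (\<lambda>h n. CO (X \<boxtimes> Y \<boxtimes> M) (\<lambda>g p. tens k X (Y \<boxtimes> M) (act X h x) (tens k Y M (act Y g y) p)) n) m"
proof -
  note tcs = tc X Y m x y
  have "G2 X Y (CO (X \<boxtimes> M \<boxtimes> Y) (\<lambda>h n. tens k X (M \<boxtimes> Y) (act X h x) (tens k M Y n y)) m) =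
      CO (X \<boxtimes> Y \<boxtimes> M) (\<lambda>h n. G2 X Y (tens k X (M \<boxtimes> Y) (act X h x) (tens k M Y n y))) m"
    by (rule CO_push[where g = "\<lambda>u. G2 X Y u"]) (assumption | rule tcs)+
  also have "\<dots> = CO (X \<boxtimes> Y \<boxtimes> M) (\<lambda>h n. tens k X (Y \<boxtimes> M) (act X h x) (sg M \<rho> Y (tens k M Y n y))) m"
    unfolding G2_def by (rule tlift_cong, rule tlift_tens) (assumption | rule tcs)+
  also have "\<dots> = CO (X \<boxtimes> Y \<boxtimes> M) (\<lambda>h n. tens k X (Y \<boxtimes> M) (act X h x) (CO (Y \<boxtimes> M) (\<lambda>g p. tens k Y M (act Y g y) p) n)) m"
    by (rule tlift_cong) (simp add: sg_tens Y y)
  also have "\<dots> = CO (X \<boxtimes> Y \<boxtimes> M) (\<lambda>h n. CO (X \<boxtimes> Y \<boxtimes> M) (\<lambda>g p. tens k X (Y \<boxtimes> M) (act X h x) (tens k Y M (act Y g y) p)) n) m"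
    by (rule tlift_cong, rule CO_push[where g = "\<lambda>u. tens k X (Y \<boxtimes> M) _ u"]) (assumption | rule tcs)+
  finally show ?thesis using X Y m x y by (simp add: G1_tens)
qed

lemma G3_tens:
  assumes X: "LM X" and Y: "LM Y" and m: "m \<in> carrier M" and x: "x \<in> carrier X" and y: "y \<in> carrier Y"
  shows "G3 X Y (tens k M (X \<boxtimes> Y) m (tens k X Y x y)) =
    CO (X \<boxtimes> Y \<boxtimes> M) (\<lambda>h n. SW (X \<boxtimes> Y \<boxtimes> M) (\<lambda>a b. tens k X (Y \<boxtimes> M) (act X a x) (tens k Y M (act Y b y) n)) h) m"
proof -
  note tcs = tc X Y m x y
  have "G3 X Y (tens k M (X \<boxtimes> Y) m (tens k X Y x y)) =
      CO (X \<boxtimes> Y \<boxtimes> M) (\<lambda>h n. rbr X Y M (dact X Y h (tens k X Y x y)) n) m"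
    unfolding G3_def by (rule tlift_tens) (assumption | rule tcs)+
  also have "\<dots> = CO (X \<boxtimes> Y \<boxtimes> M) (\<lambda>h n. rbr X Y M (SW (X \<boxtimes> Y) (\<lambda>a b. tens k X Y (act X a x) (act Y b y)) h) n) m"
    by (rule tlift_cong, subst act2_tens) (assumption | rule tcs refl)+
  also have "\<dots> = CO (X \<boxtimes> Y \<boxtimes> M) (\<lambda>h n. SW (X \<boxtimes> Y \<boxtimes> M) (\<lambda>a b. rbr X Y M (tens k X Y (act X a x) (act Y b y)) n) h) m"
    by (rule tlift_cong, rule SW_push[where g = "\<lambda>u. rbr X Y M u _"]) (assumption | rule tcs)+
  also have "\<dots> = CO (X \<boxtimes> Y \<boxtimes> M) (\<lambda>h n. SW (X \<boxtimes> Y \<boxtimes> M) (\<lambda>a b. tens k X (Y \<boxtimes> M) (act X a x) (tens k Y M (act Y b y) n)) h) m"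
    by (rule tlift_cong, rule tlift_cong, rule rbr_tens) (assumption | rule tcs)+
  finally show ?thesis .
qed

end

context weak_bialg
begin

definition sigma where
  "sigma M \<rho> = (\<lambda>X\<in>{X. LM X}. Arrow (M \<otimes>\<^sub>t X) (X \<otimes>\<^sub>t M) (\<lambda>w\<in>carrier (M \<otimes>\<^sub>t X). sg M \<rho> X w))"

lemma in_R [tc]: "x \<in> carrier H \<Longrightarrow> x \<in> carrier R"
  by (simp add: carrier_R)

end

section \<open>The hexagon in terms of the coaction\<close>

context pre_yd
begin

abbreviation sgr where "sgr X \<equiv> (\<lambda>w\<in>carrier (M \<otimes>\<^sub>t X). sg M \<rho> X w)"

text \<open>With the next two lemmas this transports the three half-braidings of the hexagon to the
  unprojected triple tensor products, where the bracketing disappears.\<close>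

lemma iL_sgr:
  assumes X: "LM X" and Y: "LM Y" and w: "w \<in> carrier ((M \<otimes>\<^sub>t X) \<boxtimes> Y)"
  shows "iL X M Y (tm (M \<otimes>\<^sub>t X) Y (X \<otimes>\<^sub>t M) Y (sgr X) (\<lambda>y\<in>carrier Y. y) w) = G1 X Y (iL M X Y w)"
proof -
  note f = sg_hom[OF X] and i = id_hom[OF Y]
  note lf = hom_D(2)[OF f] and li = hom_D(2)[OF i]
  have MX: "LM (M \<otimes>\<^sub>t X)" and XM: "LM (X \<otimes>\<^sub>t M)" by (assumption | rule tc X)+
  note l = lin_tm[OF MX Y XM Y lf li]
  note tcs = tc X Y lin_comp[OF l]
  show ?thesis
  proof (rule lin_ext[where P = "X \<boxtimes> M \<boxtimes> Y"
        and f = "\<lambda>w. iL X M Y (tm (M \<otimes>\<^sub>t X) Y (X \<otimes>\<^sub>t M) Y (sgr X) (\<lambda>y\<in>carrier Y. y) w)"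
        and g = "\<lambda>w. G1 X Y (iL M X Y w)", OF _ _ _ _ _ _ w])
    fix u y assume u: "u \<in> carrier (M \<otimes>\<^sub>t X)" and y: "y \<in> carrier Y"
    note u' = tt_D(1)[OF LM_M X u]
    have "iL X M Y (tm (M \<otimes>\<^sub>t X) Y (X \<otimes>\<^sub>t M) Y (sgr X) (\<lambda>y\<in>carrier Y. y) (tens k (M \<otimes>\<^sub>t X) Y u y))
       = rbr X M Y (sg M \<rho> X u) y"
      using iL_tens[OF X LM_M Y sg_tt[OF X u'] y] by (simp add: tm_tens[OF MX Y XM Y lf li u y] u y)
    also have "\<dots> = G1 X Y (rbr M X Y u y)"
    proof (rule lin_ext[where P = "X \<boxtimes> M \<boxtimes> Y" and f = "\<lambda>u. rbr X M Y (sg M \<rho> X u) y"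
          and g = "\<lambda>u. G1 X Y (rbr M X Y u y)", OF _ _ _ _ _ _ u'])
      fix m x assume m: "m \<in> carrier M" and x: "x \<in> carrier X"
      note tcs = tcs m x y
      have "rbr X M Y (CO (X \<boxtimes> M) (\<lambda>h n. tens k X M (act X h x) n) m) y =
          CO (X \<boxtimes> M \<boxtimes> Y) (\<lambda>h n. rbr X M Y (tens k X M (act X h x) n) y) m"
        by (rule CO_push[where g = "\<lambda>u. rbr X M Y u y"]) (assumption | rule tcs)+
      also have "\<dots> = CO (X \<boxtimes> M \<boxtimes> Y) (\<lambda>h n. tens k X (M \<boxtimes> Y) (act X h x) (tens k M Y n y)) m"
        by (rule tlift_cong, rule rbr_tens) (assumption | rule tcs)+
      finally show "rbr X M Y (sg M \<rho> X (tens k M X m x)) y = G1 X Y (rbr M X Y (tens k M X m x) y)"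
        using X Y m x y by (simp add: sg_tens rbr_tens LM_M G1_tens)
    qed (assumption | rule tcs y)+
    also have "\<dots> = G1 X Y (iL M X Y (tens k (M \<otimes>\<^sub>t X) Y u y))"
      using X Y u y by (simp add: iL_tens LM_M)
    finally show "iL X M Y (tm (M \<otimes>\<^sub>t X) Y (X \<otimes>\<^sub>t M) Y (sgr X) (\<lambda>y\<in>carrier Y. y) (tens k (M \<otimes>\<^sub>t X) Y u y))
      = G1 X Y (iL M X Y (tens k (M \<otimes>\<^sub>t X) Y u y))" .
  qed (assumption | rule tcs | erule tt_mem)+
qed

lemma iR_sgr:
  assumes X: "LM X" and Y: "LM Y" and y: "y \<in> carrier (X \<boxtimes> (M \<otimes>\<^sub>t Y))"
  shows "iR X Y M (tm X (M \<otimes>\<^sub>t Y) X (Y \<otimes>\<^sub>t M) (\<lambda>x\<in>carrier X. x) (sgr Y) y) = G2 X Y (iR X M Y y)"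
proof -
  note f = sg_hom[OF Y] and i = id_hom[OF X]
  note lf = hom_D(2)[OF f] and li = hom_D(2)[OF i]
  have MY: "LM (M \<otimes>\<^sub>t Y)" and YM: "LM (Y \<otimes>\<^sub>t M)" by (assumption | rule tc Y)+
  note l = lin_tm[OF X MY X YM li lf]
  note tcs = tc X Y lin_comp[OF l]
  show ?thesis
  proof (rule lin_ext[where P = "X \<boxtimes> Y \<boxtimes> M"
        and f = "\<lambda>y. iR X Y M (tm X (M \<otimes>\<^sub>t Y) X (Y \<otimes>\<^sub>t M) (\<lambda>x\<in>carrier X. x) (sgr Y) y)"
        and g = "\<lambda>y. G2 X Y (iR X M Y y)", OF _ _ _ _ _ _ y])
    fix x v assume x: "x \<in> carrier X" and v: "v \<in> carrier (M \<otimes>\<^sub>t Y)"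
    note v' = tt_D(1)[OF LM_M Y v]
    note s = sg_tt[OF Y v']
    have "tm X (M \<otimes>\<^sub>t Y) X (Y \<otimes>\<^sub>t M) (\<lambda>x\<in>carrier X. x) (sgr Y) (tens k X (M \<otimes>\<^sub>t Y) x v)
      = tens k X (Y \<otimes>\<^sub>t M) x (sg M \<rho> Y v)"
      by (simp add: tm_tens[OF X MY X YM li lf x v] x v)
    moreover have "iR X Y M (tens k X (Y \<otimes>\<^sub>t M) x (sg M \<rho> Y v)) = tens k X (Y \<boxtimes> M) x (sg M \<rho> Y v)"
      by (rule tlift_tens) (assumption | rule tcs x v' s | erule tt_mem)+
    moreover have "iR X M Y (tens k X (M \<otimes>\<^sub>t Y) x v) = tens k X (M \<boxtimes> Y) x v"
      by (rule tlift_tens) (assumption | rule tcs x v' v | erule tt_mem)+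
    moreover have "G2 X Y (tens k X (M \<boxtimes> Y) x v) = tens k X (Y \<boxtimes> M) x (sg M \<rho> Y v)"
      unfolding G2_def by (rule tlift_tens) (assumption | rule tcs x v' v | erule tt_mem)+
    ultimately show "iR X Y M (tm X (M \<otimes>\<^sub>t Y) X (Y \<otimes>\<^sub>t M) (\<lambda>x\<in>carrier X. x) (sgr Y) (tens k X (M \<otimes>\<^sub>t Y) x v))
        = G2 X Y (iR X M Y (tens k X (M \<otimes>\<^sub>t Y) x v))"
      by simp
  qed (assumption | rule tcs | erule tt_mem)+
qed

lemma iL_sg:
  assumes X: "LM X" and Y: "LM Y" and y: "y \<in> carrier (M \<boxtimes> (X \<otimes>\<^sub>t Y))"
  shows "iL X Y M (sg M \<rho> (X \<otimes>\<^sub>t Y) y) = G3 X Y (iR M X Y y)"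
proof (rule lin_ext[where P = "X \<boxtimes> Y \<boxtimes> M"
      and f = "\<lambda>y. iL X Y M (sg M \<rho> (X \<otimes>\<^sub>t Y) y)" and g = "\<lambda>y. G3 X Y (iR M X Y y)", OF _ _ _ _ _ _ y])
  note tcs = tc X Y
  have XY: "LM (X \<otimes>\<^sub>t Y)" by (assumption | rule tcs)+
  fix m v assume m: "m \<in> carrier M" and v: "v \<in> carrier (X \<otimes>\<^sub>t Y)"
  note v' = tt_D(1)[OF X Y v]
  note tcs = tcs m v v'
  have "iL X Y M (CO ((X \<otimes>\<^sub>t Y) \<boxtimes> M) (\<lambda>h n. tens k (X \<otimes>\<^sub>t Y) M (act (X \<otimes>\<^sub>t Y) h v) n) m)
     = CO (X \<boxtimes> Y \<boxtimes> M) (\<lambda>h n. iL X Y M (tens k (X \<otimes>\<^sub>t Y) M (act (X \<otimes>\<^sub>t Y) h v) n)) m"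
    by (rule CO_push[where g = "\<lambda>u. iL X Y M u"]) (assumption | rule tcs | erule tt_mem)+
  also have "\<dots> = CO (X \<boxtimes> Y \<boxtimes> M) (\<lambda>h n. rbr X Y M (dact X Y h v) n) m"
    by (rule tlift_cong) (simp add: iL_tens X Y LM_M act_in XY v tt_ops dact_tt v')
  also have "\<dots> = G3 X Y (tens k M (X \<boxtimes> Y) m v)"
    unfolding G3_def by (rule tlift_tens[symmetric]) (assumption | rule tcs)+
  also have "tens k M (X \<boxtimes> Y) m v = iR M X Y (tens k M (X \<otimes>\<^sub>t Y) m v)"
    by (rule tlift_tens[symmetric]) (assumption | rule tcs | erule tt_mem)+
  finally show "iL X Y M (sg M \<rho> (X \<otimes>\<^sub>t Y) (tens k M (X \<otimes>\<^sub>t Y) m v)) = G3 X Y (iR M X Y (tens k M (X \<otimes>\<^sub>t Y) m v))"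
    by (simp add: sg_tens XY m v)
qed (assumption | rule tc X Y | erule tt_mem)+

text \<open>Both composites end in \<open>X \<otimes>\<^sub>t (Y \<otimes>\<^sub>t M)\<close>, where
  \<open>iR\<close> is injective by \<open>pR_iR\<close>. After applying \<open>iR\<close> the
  associators become \<open>iL\<close>, and only \<open>G1\<close>, \<open>G2\<close>,
  \<open>G3\<close> remain. Coassociativity of the coaction does not enter, so both directions of
  the correspondence can use this.\<close>

lemma hexagon_iff:
  assumes X: "LM X" and Y: "LM Y"
  shows "Comp CM (Comp CM (tensor_t_arr k H (Ident CM X) (sigma M \<rho> Y)) (assoc_t k H X M Y))
       (tensor_t_arr k H (sigma M \<rho> X) (Ident CM Y)) =
     Comp CM (Comp CM (assoc_t k H X Y M) (sigma M \<rho> (X \<otimes>\<^sub>t Y))) (assoc_t k H M X Y)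
     \<longleftrightarrow> (\<forall>w\<in>carrier ((M \<otimes>\<^sub>t X) \<otimes>\<^sub>t Y). G2 X Y (G1 X Y (iL M X Y w)) = G3 X Y (iL M X Y w))"
    (is "?lhs = ?rhs \<longleftrightarrow> _")
proof -
  note [simp] = LM_M X Y LM_tt[OF X Y] LM_tt[OF LM_M X] LM_tt[OF X LM_M] LM_tt[OF LM_M Y] LM_tt[OF Y LM_M]
  let ?t1 = "tm (M \<otimes>\<^sub>t X) Y (X \<otimes>\<^sub>t M) Y (sgr X) (\<lambda>y\<in>carrier Y. y)"
  let ?t2 = "tm X (M \<otimes>\<^sub>t Y) X (Y \<otimes>\<^sub>t M) (\<lambda>x\<in>carrier X. x) (sgr Y)"
  let ?L = "\<lambda>w. ?t2 (asm X M Y (?t1 w))"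
  let ?R = "\<lambda>w. asm X Y M (sg M \<rho> (X \<otimes>\<^sub>t Y) (asm M X Y w))"
  let ?W = "carrier ((M \<otimes>\<^sub>t X) \<otimes>\<^sub>t Y)"
  have t1: "?t1 w \<in> carrier ((X \<otimes>\<^sub>t M) \<otimes>\<^sub>t Y)" if "w \<in> ?W" for w
    by (rule tm_in[OF _ _ _ _ sg_hom[OF X] id_hom[OF Y] that]) simp_all
  have a1: "asm X M Y (?t1 w) \<in> carrier (X \<otimes>\<^sub>t (M \<otimes>\<^sub>t Y))" if "w \<in> ?W" for w
    by (rule asm_in[OF X LM_M Y t1[OF that]])
  have t2: "?L w \<in> carrier (X \<otimes>\<^sub>t (Y \<otimes>\<^sub>t M))" if "w \<in> ?W" for w
    by (rule tm_in[OF _ _ _ _ id_hom[OF X] sg_hom[OF Y] a1[OF that]]) simp_all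
  have a2: "asm M X Y w \<in> carrier (M \<otimes>\<^sub>t (X \<otimes>\<^sub>t Y))" if "w \<in> ?W" for w
    by (rule asm_in[OF LM_M X Y that])
  have s: "sg M \<rho> (X \<otimes>\<^sub>t Y) (asm M X Y w) \<in> carrier ((X \<otimes>\<^sub>t Y) \<otimes>\<^sub>t M)" if "w \<in> ?W" for w
    by (rule sg_tt[OF _ tt_D(1)[OF _ _ a2[OF that]]]) simp_all
  have a3: "?R w \<in> carrier (X \<otimes>\<^sub>t (Y \<otimes>\<^sub>t M))" if "w \<in> ?W" for w
    by (rule asm_in[OF X Y LM_M s[OF that]])
  have lhs: "?lhs = Arrow ((M \<otimes>\<^sub>t X) \<otimes>\<^sub>t Y) (X \<otimes>\<^sub>t (Y \<otimes>\<^sub>t M)) (\<lambda>w\<in>?W. ?L w)"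
    by (simp add: sigma_def assoc_t_eq tensor_t_arr_eq compose_def) (rule restrict_ext, simp add: t1 a1)
  have rhs: "?rhs = Arrow ((M \<otimes>\<^sub>t X) \<otimes>\<^sub>t Y) (X \<otimes>\<^sub>t (Y \<otimes>\<^sub>t M)) (\<lambda>w\<in>?W. ?R w)"
    by (simp add: sigma_def assoc_t_eq compose_def) (rule restrict_ext, simp add: a2 s)
  have iRL: "iR X Y M (?L w) = G2 X Y (G1 X Y (iL M X Y w))" if w: "w \<in> ?W" for w
    using iR_sgr[OF X Y tt_D(1)[OF _ _ a1[OF w]]] iR_asm[OF X LM_M Y t1[OF w]]
      iL_sgr[OF X Y tt_D(1)[OF _ _ w]] by simp
  have iRR: "iR X Y M (?R w) = G3 X Y (iL M X Y w)" if w: "w \<in> ?W" for w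
    using iR_asm[OF X Y LM_M s[OF w]] iL_sg[OF X Y tt_D(1)[OF _ _ a2[OF w]]] iR_asm[OF LM_M X Y w] by simp
  have "?L w = ?R w \<longleftrightarrow> G2 X Y (G1 X Y (iL M X Y w)) = G3 X Y (iL M X Y w)" if w: "w \<in> ?W" for w
  proof -
    have "pR X Y M (iR X Y M (?L w)) = ?L w"
      by (rule pR_iR[OF X Y LM_M tt_D(1)[OF _ _ t2[OF w]]]) simp_all
    moreover have "pR X Y M (iR X Y M (?R w)) = ?R w"
      by (rule pR_iR[OF X Y LM_M tt_D(1)[OF _ _ a3[OF w]]]) simp_all
    ultimately show ?thesis using iRL[OF w] iRR[OF w] by metis
  qed
  moreover have "?lhs = ?rhs \<longleftrightarrow> (\<forall>w\<in>?W. ?L w = ?R w)"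
    unfolding lhs rhs by (auto simp: fun_eq_iff restrict_def)
  ultimately show ?thesis by simp
qed

text \<open>The next two lemmas evaluate the two sides of the hexagon at \<open>1\<^sub>1 m \<otimes> 1\<^sub>2 \<otimes> 1\<^sub>3\<close> without using
  coassociativity of the coaction.\<close>

lemma CO_hexagon_left:
  assumes F: "tri H H M P F" and P: "module k P" and m: "m \<in> carrier M"
  shows "SW P (\<lambda>p q. SW P (\<lambda>r s. CO P (\<lambda>h n. CO P (\<lambda>g t. F (h \<otimes> r) (g \<otimes> s) t) n) (act M p m)) q) \<one> =
    CO P (\<lambda>h n. CO P (\<lambda>g t. F h g t) n) m"
proof -
  note tcs = tc tri_tc[OF F] P m
  have "SW P (\<lambda>p q. SW P (\<lambda>r s. CO P (\<lambda>h n. CO P (\<lambda>g t. F (h \<otimes> r) (g \<otimes> s) t) n) (act M p m)) q) \<one> =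
    SW P (\<lambda>p q. SW P (\<lambda>a b. CO P (\<lambda>h n. CO P (\<lambda>g t. F (h \<otimes> b) (g \<otimes> q) t) n) (act M a m)) p) \<one>"
    by (rule coassoc[symmetric]) (assumption | rule tcs)+
  also have "\<dots> = SW P (\<lambda>p q. CO P (\<lambda>h n. SW P (\<lambda>a b. CO P (\<lambda>g t. F (a \<otimes> h) (g \<otimes> q) t) (act M b n)) p) m) \<one>"
    by (rule tlift_cong, rule yd_compat[symmetric]) (assumption | rule tcs)+
  also have "\<dots> = CO P (\<lambda>h n. SW P (\<lambda>p q. SW P (\<lambda>a b. CO P (\<lambda>g t. F (a \<otimes> h) (g \<otimes> q) t) (act M b n)) p) \<one>) m"
    by (rule tl_swap) (assumption | rule tcs)+
  also have "\<dots> = CO P (\<lambda>h n. CO P (\<lambda>g t. F h g t) n) m"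
  proof -
    \<comment> \<open>Write \<open>1\<^sub>1 \<otimes> 1\<^sub>2 \<otimes> 1\<^sub>3\<close> as
      \<open>1\<^sub>1 \<otimes> 1\<^sub>1' 1\<^sub>2 \<otimes> 1\<^sub>2'\<close>. The primed copy
      acts on \<open>1\<^sub>2 n\<close> and multiplies its coaction from the right, so
      \<open>yd_one'\<close> absorbs it.\<close>
    have inner: "SW P (\<lambda>p q. SW P (\<lambda>a b. CO P (\<lambda>g t. F (a \<otimes> h) (g \<otimes> q) t) (act M b n)) p) \<one>
       = SW P (\<lambda>a b. CO P (\<lambda>g t. F (a \<otimes> h) g t) (act M b n)) \<one>"
      if h: "h \<in> carrier H" and n: "n \<in> carrier M" for h n
    proof -
      note tcs = tcs h n
      let ?G = "\<lambda>a x d. CO P (\<lambda>g t. F (a \<otimes> h) (g \<otimes> d) t) (act M x n)"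
      have G: "tri H H H P ?G" by (assumption | rule tcs)+
      have "SW P (\<lambda>p q. SW P (\<lambda>a b. ?G a b q) p) \<one> = SW P (\<lambda>a b. SW P (\<lambda>c d. ?G a (c \<otimes> b) d) \<one>) \<one>"
        using coassoc[OF G P one_in] one_ax(2)[OF G P] by simp
      also have "\<dots> = SW P (\<lambda>a b. SW P (\<lambda>c d. CO P (\<lambda>g t. F (a \<otimes> h) (g \<otimes> d) t) (act M c (act M b n))) \<one>) \<one>"
        by (intro tlift_cong) (simp add: act_mult LM_M n)
      also have "\<dots> = SW P (\<lambda>a b. CO P (\<lambda>g t. F (a \<otimes> h) g t) (act M b n)) \<one>"
        by (rule tlift_cong, rule yd_one') (assumption | rule tcs)+
      finally show ?thesis .
    qed
    have "CO P (\<lambda>h n. SW P (\<lambda>p q. SW P (\<lambda>a b. CO P (\<lambda>g t. F (a \<otimes> h) (g \<otimes> q) t) (act M b n)) p) \<one>) m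
      = CO P (\<lambda>h n. SW P (\<lambda>a b. CO P (\<lambda>g t. F (a \<otimes> h) g t) (act M b n)) \<one>) m"
      by (rule tlift_cong, rule inner)
    also have "\<dots> = CO P (\<lambda>h n. CO P (\<lambda>g t. F h g t) n) m"
      by (rule yd_one[where F = "\<lambda>h n. CO P (\<lambda>g t. F h g t) n"]) (assumption | rule tcs)+
    finally show ?thesis .
  qed
  finally show ?thesis .
qed

lemma CO_hexagon_right:
  assumes F: "tri H H M P F" and P: "module k P" and m: "m \<in> carrier M"
  shows "SW P (\<lambda>p q. SW P (\<lambda>r s. CO P (\<lambda>h n. SW P (\<lambda>a b. F (a \<otimes> r) (b \<otimes> s) n) h) (act M p m)) q) \<one> =
    CO P (\<lambda>h n. SW P (\<lambda>a b. F a b n) h) m"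
proof -
  note tcs = tc tri_tc[OF F] P m
  have "SW P (\<lambda>p q. SW P (\<lambda>r s. CO P (\<lambda>h n. SW P (\<lambda>a b. F (a \<otimes> r) (b \<otimes> s) n) h) (act M p m)) q) \<one> =
     SW P (\<lambda>p q. CO P (\<lambda>h n. SW P (\<lambda>r s. SW P (\<lambda>a b. F (a \<otimes> r) (b \<otimes> s) n) h) q) (act M p m)) \<one>"
    by (rule tlift_cong, rule tl_swap) (assumption | rule tcs)+
  also have "\<dots> = SW P (\<lambda>p q. CO P (\<lambda>h n. SW P (\<lambda>a b. SW P (\<lambda>r s. F (a \<otimes> r) (b \<otimes> s) n) q) h) (act M p m)) \<one>"
    by (rule tlift_cong, rule tlift_cong, rule tl_swap) (assumption | rule tcs)+
  also have "\<dots> = SW P (\<lambda>p q. CO P (\<lambda>h n. SW P (\<lambda>a b. F a b n) (h \<otimes> q)) (act M p m)) \<one>"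
    by (rule tlift_cong, rule tlift_cong, rule SW_mult[symmetric]) (assumption | rule tcs)+
  also have "\<dots> = CO P (\<lambda>h n. SW P (\<lambda>a b. F a b n) h) m"
    by (rule yd_one'[where F = "\<lambda>h n. SW P (\<lambda>a b. F a b n) h"]) (assumption | rule tcs)+
  finally show ?thesis .
qed

text \<open>The hexagon speaks only about projected elements, here the projection of
  \<open>m \<otimes> \<one> \<otimes> \<one>\<close>. The two evaluation lemmas remove the resulting
  copies of the unit, and with both objects equal to the regular module the two sides of
  coassociativity can be read off.\<close>

lemma coassoc_of_hexagon:
  assumes hex: "\<And>w. w \<in> carrier ((M \<otimes>\<^sub>t R) \<otimes>\<^sub>t R) \<Longrightarrow> G2 R R (G1 R R (iL M R R w)) = G3 R R (iL M R R w)"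
    and m: "m \<in> carrier M"
  shows "CO (H \<boxtimes> H \<boxtimes> M) (\<lambda>h n. SW (H \<boxtimes> H \<boxtimes> M) (\<lambda>a b. tens k H (H \<boxtimes> M) a (tens k H M b n)) h) m =
    CO (H \<boxtimes> H \<boxtimes> M) (\<lambda>h n. tens k H (H \<boxtimes> M) h (\<rho> n)) m"
proof -
  note tcs = tc m
  define u where "u = tens k M R m \<one>"
  define e where "e = tens k M (R \<boxtimes> R) m (tens k R R \<one> \<one>)"
  \<comment> \<open>The inner projection is needed for the first factor to lie in
    \<open>M \<otimes>\<^sub>t R\<close>. It leaves no trace: the outer one absorbs it, and the
    image of \<open>?w\<close> in the triple product is \<open>E3 M R R e\<close>.\<close>
  let ?v = "tens k (M \<otimes>\<^sub>t R) R (dact M R \<one> u) \<one>"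
  let ?w = "dact (M \<otimes>\<^sub>t R) R \<one> ?v"
  let ?P = "H \<boxtimes> H \<boxtimes> M"
  let ?Q = "R \<boxtimes> R \<boxtimes> M"
  have PQ: "?Q = ?P" by (simp add: R_cong)
  have u: "u \<in> carrier (M \<boxtimes> R)" unfolding u_def by (assumption | rule tcs)+
  have v: "?v \<in> carrier ((M \<otimes>\<^sub>t R) \<boxtimes> R)" by (assumption | rule tcs u)+
  have w: "?w \<in> carrier ((M \<otimes>\<^sub>t R) \<otimes>\<^sub>t R)" by (assumption | rule tcs u)+
  have "iL M R R ?w = E3 M R R (iL M R R ?v)"
    by (rule iL_dact[OF LM_M LM_R LM_R v])
  also have "iL M R R ?v = rbr M R R (dact M R \<one> u) \<one>"
    by (rule iL_tens) (assumption | rule tcs u)+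
  also have "E3 M R R (rbr M R R (dact M R \<one> u) \<one>) =
      SW (M \<boxtimes> R \<boxtimes> R) (\<lambda>p q. rbr M R R (dact M R p (dact M R \<one> u)) (act R q \<one>)) \<one>"
    by (rule SW_rbr_dact[symmetric]) (assumption | rule tcs u)+
  also have "\<dots> = SW (M \<boxtimes> R \<boxtimes> R) (\<lambda>p q. rbr M R R (dact M R p u) (act R q \<one>)) \<one>"
    by (rule tlift_cong) (simp add: dact_one_dact LM_M LM_R u)
  also have "\<dots> = E3 M R R (rbr M R R u \<one>)"
    by (rule SW_rbr_dact[OF LM_M LM_R LM_R u]) (assumption | rule tcs)+
  also have "rbr M R R u \<one> = e"
    unfolding u_def e_def by (rule rbr_tens) (assumption | rule tcs)+
  finally have eq: "G2 R R (G1 R R (E3 M R R e)) = G3 R R (E3 M R R e)"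
    using hex[OF w] by simp
  have E: "E3 M R R e = SW (M \<boxtimes> R \<boxtimes> R) (\<lambda>p q. SW (M \<boxtimes> R \<boxtimes> R) (\<lambda>r s.
      tens k M (R \<boxtimes> R) (act M p m) (tens k R R (act R r \<one>) (act R s \<one>))) q) \<one>"
    unfolding e_def by (rule E3_tens) (assumption | rule tcs)+
  have push: "f (E3 M R R e) = SW ?Q (\<lambda>p q. SW ?Q (\<lambda>r s.
      f (tens k M (R \<boxtimes> R) (act M p m) (tens k R R (act R r \<one>) (act R s \<one>)))) q) \<one>"
    if f: "lin (M \<boxtimes> R \<boxtimes> R) ?Q f" for f
  proof -
    have "f (E3 M R R e) = SW ?Q (\<lambda>p q. f (SW (M \<boxtimes> R \<boxtimes> R) (\<lambda>r s.
      tens k M (R \<boxtimes> R) (act M p m) (tens k R R (act R r \<one>) (act R s \<one>))) q)) \<one>"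
      unfolding E by (rule SW_push[OF f]) (assumption | rule tcs)+
    also have "\<dots> = SW ?Q (\<lambda>p q. SW ?Q (\<lambda>r s.
      f (tens k M (R \<boxtimes> R) (act M p m) (tens k R R (act R r \<one>) (act R s \<one>)))) q) \<one>"
      by (rule tlift_cong, rule SW_push[OF f]) (assumption | rule tcs)+
    finally show ?thesis .
  qed
  have tri: "tri H H M ?P (\<lambda>a b n. tens k H (H \<boxtimes> M) a (tens k H M b n))"
    by (assumption | rule tcs)+
  have modP: "module k ?P" by (assumption | rule tcs)+
  have "G2 R R (G1 R R (E3 M R R e)) = SW ?Q (\<lambda>p q. SW ?Q (\<lambda>r s.
      G2 R R (G1 R R (tens k M (R \<boxtimes> R) (act M p m) (tens k R R (act R r \<one>) (act R s \<one>))))) q) \<one>"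
    by (rule push) (assumption | rule tcs)+
  also have "\<dots> = SW ?Q (\<lambda>p q. SW ?Q (\<lambda>r s. CO ?Q (\<lambda>h n. CO ?Q (\<lambda>g t.
      tens k R (R \<boxtimes> M) (act R h (act R r \<one>)) (tens k R M (act R g (act R s \<one>)) t)) n) (act M p m)) q) \<one>"
    by (rule tlift_cong, rule tlift_cong, rule G21_tens) (assumption | rule tcs)+
  also have "\<dots> = SW ?P (\<lambda>p q. SW ?P (\<lambda>r s. CO ?P (\<lambda>h n. CO ?P (\<lambda>g t.
      tens k H (H \<boxtimes> M) (h \<otimes> r) (tens k H M (g \<otimes> s) t)) n) (act M p m)) q) \<one>"
    unfolding R_cong by (intro tlift_cong) (simp add: R_ops one_in mult_in)
  also have "\<dots> = CO ?P (\<lambda>h n. CO ?P (\<lambda>g t. tens k H (H \<boxtimes> M) h (tens k H M g t)) n) m"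
    by (rule CO_hexagon_left[OF tri modP m])
  also have "\<dots> = CO ?P (\<lambda>h n. tens k H (H \<boxtimes> M) h (CO (H \<boxtimes> M) (\<lambda>g t. tens k H M g t) n)) m"
    by (rule tlift_cong, rule CO_push[where g = "\<lambda>x. tens k H (H \<boxtimes> M) _ x", symmetric]) (assumption | rule tcs)+
  also have "\<dots> = CO ?P (\<lambda>h n. tens k H (H \<boxtimes> M) h (\<rho> n)) m"
    by (rule tlift_cong) (simp add: tl_tens_id module_H module_LM LM_M rho_in)
  finally have l: "G2 R R (G1 R R (E3 M R R e)) = CO ?P (\<lambda>h n. tens k H (H \<boxtimes> M) h (\<rho> n)) m" .
  have "G3 R R (E3 M R R e) = SW ?Q (\<lambda>p q. SW ?Q (\<lambda>r s.
      G3 R R (tens k M (R \<boxtimes> R) (act M p m) (tens k R R (act R r \<one>) (act R s \<one>)))) q) \<one>"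
    by (rule push) (assumption | rule tcs)+
  also have "\<dots> = SW ?Q (\<lambda>p q. SW ?Q (\<lambda>r s. CO ?Q (\<lambda>h n. SW ?Q (\<lambda>a b.
      tens k R (R \<boxtimes> M) (act R a (act R r \<one>)) (tens k R M (act R b (act R s \<one>)) n)) h) (act M p m)) q) \<one>"
    by (rule tlift_cong, rule tlift_cong, rule G3_tens) (assumption | rule tcs)+
  also have "\<dots> = SW ?P (\<lambda>p q. SW ?P (\<lambda>r s. CO ?P (\<lambda>h n. SW ?P (\<lambda>a b.
      tens k H (H \<boxtimes> M) (a \<otimes> r) (tens k H M (b \<otimes> s) n)) h) (act M p m)) q) \<one>"
    unfolding R_cong by (intro tlift_cong) (simp add: R_ops one_in mult_in)
  also have "\<dots> = CO ?P (\<lambda>h n. SW ?P (\<lambda>a b. tens k H (H \<boxtimes> M) a (tens k H M b n)) h) m"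
    by (rule CO_hexagon_right[OF tri modP m])
  finally show ?thesis using eq l by simp
qed

end

locale ydm = pre_yd k H M \<rho> for k :: "'u ring" and H :: "'u bialgebra" (structure) and M \<rho> +
  assumes rho_coassoc: "m \<in> carrier M \<Longrightarrow>
      CO (H \<boxtimes> H \<boxtimes> M) (\<lambda>h n. SW (H \<boxtimes> H \<boxtimes> M) (\<lambda>a b. tens k H (H \<boxtimes> M) a (tens k H M b n)) h) m =
      CO (H \<boxtimes> H \<boxtimes> M) (\<lambda>h n. tens k H (H \<boxtimes> M) h (\<rho> n)) m"
    and rho_counit: "m \<in> carrier M \<Longrightarrow> CO M (\<lambda>h n. eps h \<odot>\<^bsub>M\<^esub> n) m = m"
begin

lemma co_coassoc:
  assumes F: "tri H H M P F" and P: "module k P" and m: "m \<in> carrier M"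
  shows "CO P (\<lambda>h n. SW P (\<lambda>a b. F a b n) h) m = CO P (\<lambda>h n. CO P (\<lambda>g p. F h g p) n) m"
proof -
  let ?Q = "H \<boxtimes> H \<boxtimes> M"
  note tcs = tc tri_tc[OF F] P m
  have l: "lin ?Q P (t3 H H M P F)" by (rule lin_t3) (assumption | rule tcs F)+
  have "t3 H H M P F (CO ?Q (\<lambda>h n. SW ?Q (\<lambda>a b. tens k H (H \<boxtimes> M) a (tens k H M b n)) h) m)
      = CO P (\<lambda>h n. t3 H H M P F (SW ?Q (\<lambda>a b. tens k H (H \<boxtimes> M) a (tens k H M b n)) h)) m"
    by (rule CO_push[OF l]) (assumption | rule tcs)+
  also have "\<dots> = CO P (\<lambda>h n. SW P (\<lambda>a b. t3 H H M P F (tens k H (H \<boxtimes> M) a (tens k H M b n))) h) m"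
    by (rule tlift_cong, rule SW_push[OF l]) (assumption | rule tcs)+
  also have "\<dots> = CO P (\<lambda>h n. SW P (\<lambda>a b. F a b n) h) m"
    by (intro tlift_cong t3_tens) (assumption | rule tcs F)+
  finally have 1: "t3 H H M P F (CO ?Q (\<lambda>h n. SW ?Q (\<lambda>a b. tens k H (H \<boxtimes> M) a (tens k H M b n)) h) m)
      = CO P (\<lambda>h n. SW P (\<lambda>a b. F a b n) h) m" .
  have "t3 H H M P F (CO ?Q (\<lambda>h n. tens k H (H \<boxtimes> M) h (\<rho> n)) m)
      = CO P (\<lambda>h n. t3 H H M P F (tens k H (H \<boxtimes> M) h (\<rho> n))) m"
    by (rule CO_push[OF l]) (assumption | rule tcs)+
  also have "\<dots> = CO P (\<lambda>h n. CO P (\<lambda>g p. F h g p) n) m"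
    by (rule tlift_cong, rule t3_tens1) (assumption | rule tcs F)+
  finally show ?thesis using 1 rho_coassoc[OF m] by simp
qed

lemma CO_et:
  assumes m: "m \<in> carrier M"
  shows "CO M (\<lambda>h n. act M (et h) n) m = m"
proof -
  have "CO M (\<lambda>h n. act M (et h) n) m = CO M (\<lambda>h n. act M (et (h \<otimes> \<one>)) n) m"
    by (rule tlift_cong) simp
  also have "\<dots> = CO M (\<lambda>h n. eps (h \<otimes> \<one>) \<odot>\<^bsub>M\<^esub> n) m"
    by (rule CO_act_et[OF m one_in])
  also have "\<dots> = CO M (\<lambda>h n. eps h \<odot>\<^bsub>M\<^esub> n) m"
    by (rule tlift_cong) simp
  finally show ?thesis using rho_counit[OF m] by simp
qed

text \<open>Applying \<open>\<epsilon>\<close> to the first leg of the compatibility condition recovers the action.\<close>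

lemma SW_CO_eps:
  assumes m: "m \<in> carrier M" and h: "h \<in> carrier H"
  shows "SW M (\<lambda>a b. CO M (\<lambda>g n. eps (g \<otimes> b) \<odot>\<^bsub>M\<^esub> n) (act M a m)) h = act M h m"
proof -
  note tcs = tc m h
  have "SW M (\<lambda>a b. CO M (\<lambda>g n. eps (g \<otimes> b) \<odot>\<^bsub>M\<^esub> n) (act M a m)) h =
      CO M (\<lambda>g n. SW M (\<lambda>a b. eps (a \<otimes> g) \<odot>\<^bsub>M\<^esub> act M b n) h) m"
    by (rule yd_compat[symmetric]) (assumption | rule tcs)+
  also have "\<dots> = CO M (\<lambda>g n. act M h (act M (et g) n)) m"
  proof (rule tlift_cong)
    fix g n assume g: "g \<in> carrier H" and n: "n \<in> carrier M"
    have "SW M (\<lambda>a b. eps (a \<otimes> g) \<odot>\<^bsub>M\<^esub> act M b n) h = SW M (\<lambda>a b. act M (eps (a \<otimes> g) \<odot> b) n) h"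
      by (rule tlift_cong) (simp add: bil_smult_out[OF bil_act[OF LM_M]] eps_in mult_in g n)
    also have "\<dots> = act M (SW H (\<lambda>a b. eps (a \<otimes> g) \<odot> b) h) n"
      by (rule SW_push[where g = "\<lambda>x. act M x n", symmetric]) (assumption | rule tcs g n)+
    also have "\<dots> = act M h (act M (et g) n)"
      unfolding mult_et[OF h g, symmetric] by (rule act_mult) (assumption | rule tcs g n)+
    finally show "SW M (\<lambda>a b. eps (a \<otimes> g) \<odot>\<^bsub>M\<^esub> act M b n) h = act M h (act M (et g) n)" .
  qed
  also have "\<dots> = act M h (CO M (\<lambda>g n. act M (et g) n) m)"
    by (rule CO_push[where g = "\<lambda>x. act M h x", symmetric]) (assumption | rule tcs)+
  finally show ?thesis using CO_et[OF m] by simp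
qed

text \<open>In \<open>esb(z) m = \<epsilon>(1\<^sub>2 z) 1\<^sub>1 m\<close> the vector
  \<open>1\<^sub>1 m\<close> is expanded by \<open>SW_CO_eps\<close>. Weak multiplicativity of the
  counit merges \<open>\<epsilon>(g 1\<^sub>2) \<epsilon>(1\<^sub>3 z)\<close> into
  \<open>\<epsilon>(g 1\<^sub>2 z)\<close>, and \<open>yd_one'\<close> removes the unit.\<close>

lemma CO_eps_esb:
  assumes m: "m \<in> carrier M" and z: "z \<in> carrier H"
  shows "CO M (\<lambda>h n. eps (h \<otimes> z) \<odot>\<^bsub>M\<^esub> n) m = act M (esb z) m"
proof -
  note tcs = tc m z
  have "act M (esb z) m = SW M (\<lambda>p q. eps (q \<otimes> z) \<odot>\<^bsub>M\<^esub> act M p m) \<one>"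
    by (rule esb_push[where f = "\<lambda>x. act M x m"]) (assumption | rule tcs)+
  also have "\<dots> = SW M (\<lambda>p q. eps (q \<otimes> z) \<odot>\<^bsub>M\<^esub> SW M (\<lambda>a b. CO M (\<lambda>g n. eps (g \<otimes> b) \<odot>\<^bsub>M\<^esub> n) (act M a m)) p) \<one>"
    by (rule tlift_cong) (simp add: SW_CO_eps m)
  also have "\<dots> = SW M (\<lambda>p q. SW M (\<lambda>a b. eps (q \<otimes> z) \<odot>\<^bsub>M\<^esub> CO M (\<lambda>g n. eps (g \<otimes> b) \<odot>\<^bsub>M\<^esub> n) (act M a m)) p) \<one>"
    by (rule tlift_cong, rule SW_push[where g = "\<lambda>x. _ \<odot>\<^bsub>M\<^esub> x"]) (assumption | rule tcs)+
  also have "\<dots> = SW M (\<lambda>p q. SW M (\<lambda>a b. eps (b \<otimes> z) \<odot>\<^bsub>M\<^esub> CO M (\<lambda>g n. eps (g \<otimes> a) \<odot>\<^bsub>M\<^esub> n) (act M p m)) q) \<one>"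
    by (rule coassoc) (assumption | rule tcs)+
  also have "\<dots> = SW M (\<lambda>p q. SW M (\<lambda>a b. CO M (\<lambda>g n. eps (b \<otimes> z) \<odot>\<^bsub>M\<^esub> (eps (g \<otimes> a) \<odot>\<^bsub>M\<^esub> n)) (act M p m)) q) \<one>"
    by (rule tlift_cong, rule tlift_cong, rule CO_push[where g = "\<lambda>x. _ \<odot>\<^bsub>M\<^esub> x"]) (assumption | rule tcs)+
  also have "\<dots> = SW M (\<lambda>p q. CO M (\<lambda>g n. SW M (\<lambda>a b. eps (b \<otimes> z) \<odot>\<^bsub>M\<^esub> (eps (g \<otimes> a) \<odot>\<^bsub>M\<^esub> n)) q) (act M p m)) \<one>"
    by (rule tlift_cong, rule tl_swap) (assumption | rule tcs)+
  also have "\<dots> = SW M (\<lambda>p q. CO M (\<lambda>g n. eps ((g \<otimes> q) \<otimes> z) \<odot>\<^bsub>M\<^esub> n) (act M p m)) \<one>"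
  proof (intro tlift_cong)
    fix p q g n assume *: "p \<in> carrier H" "q \<in> carrier H" "g \<in> carrier H" "n \<in> carrier M"
    have "eps ((g \<otimes> q) \<otimes> z) \<odot>\<^bsub>M\<^esub> n = SW K (\<lambda>a b. eps (g \<otimes> a) \<otimes>\<^bsub>k\<^esub> eps (b \<otimes> z)) q \<odot>\<^bsub>M\<^esub> n"
      using eps_mult(1)[of g q z] * z by simp
    also have "\<dots> = SW M (\<lambda>a b. (eps (g \<otimes> a) \<otimes>\<^bsub>k\<^esub> eps (b \<otimes> z)) \<odot>\<^bsub>M\<^esub> n) q"
      by (rule SW_push[where g = "\<lambda>x. x \<odot>\<^bsub>M\<^esub> n"]) (assumption | rule tcs *)+
    also have "\<dots> = SW M (\<lambda>a b. eps (b \<otimes> z) \<odot>\<^bsub>M\<^esub> (eps (g \<otimes> a) \<odot>\<^bsub>M\<^esub> n)) q"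
      by (rule tlift_cong)
        (simp add: mult_k_comm[of "eps (g \<otimes> _)"] smult_smult module_LM LM_M eps_in mult_in * z)
    finally show "SW M (\<lambda>a b. eps (b \<otimes> z) \<odot>\<^bsub>M\<^esub> (eps (g \<otimes> a) \<odot>\<^bsub>M\<^esub> n)) q = eps ((g \<otimes> q) \<otimes> z) \<odot>\<^bsub>M\<^esub> n" ..
  qed
  also have "\<dots> = CO M (\<lambda>g n. eps (g \<otimes> z) \<odot>\<^bsub>M\<^esub> n) m"
    by (rule yd_one'[where F = "\<lambda>g n. eps (g \<otimes> z) \<odot>\<^bsub>M\<^esub> n"]) (assumption | rule tcs)+
  finally show ?thesis ..
qed

lemma sg_unit:
  assumes w: "w \<in> carrier (M \<otimes>\<^sub>t U)"
  shows "sg M \<rho> U w = linv M (rm M w)"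
proof -
  have "lm M (sg M \<rho> U w) = rm M w"
    by (rule tt_ext[OF LM_M LM_U _ _ _ _ w, where P = M and f = "\<lambda>w. lm M (sg M \<rho> U w)" and g = "\<lambda>w. rm M w"])
      (assumption | rule tc | simp add: lm_sg_dact rm_dact LM_M CO_eps_esb U_mem)+
  then show ?thesis
    using linv_lm[OF LM_M sg_tt[OF LM_U tt_D(1)[OF LM_M LM_U w]]] by simp
qed

lemma G21_G3:
  assumes X: "LM X" and Y: "LM Y" and u: "u \<in> carrier (M \<boxtimes> X \<boxtimes> Y)"
  shows "G2 X Y (G1 X Y u) = G3 X Y u"
proof (rule lin_ext3[where P = "X \<boxtimes> Y \<boxtimes> M" and f = "\<lambda>u. G2 X Y (G1 X Y u)" and g = "\<lambda>u. G3 X Y u", OF _ _ _ _ _ _ _ u])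
  fix m x y assume m: "m \<in> carrier M" and x: "x \<in> carrier X" and y: "y \<in> carrier Y"
  show "G2 X Y (G1 X Y (tens k M (X \<boxtimes> Y) m (tens k X Y x y))) = G3 X Y (tens k M (X \<boxtimes> Y) m (tens k X Y x y))"
    unfolding G21_tens[OF X Y m x y] G3_tens[OF X Y m x y]
    by (rule co_coassoc[symmetric]) (assumption | rule tc X Y m x y)+
qed (assumption | rule tc X Y)+

lemma half_braiding_sigma: "half_braiding CM M (sigma M \<rho>)"
proof -
  have ext: "sigma M \<rho> \<in> extensional (Obj CM)" by (simp add: sigma_def)
  have hom: "\<forall>X\<in>Obj CM. in_hom CM (sigma M \<rho> X) (tens_obj CM M X) (tens_obj CM X M)"
  proof
    fix X assume "X \<in> Obj CM"
    then have X: "LM X" by simp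
    show "in_hom CM (sigma M \<rho> X) (tens_obj CM M X) (tens_obj CM X M)"
      unfolding in_hom_CM using X sg_hom[OF X] LM_tt[OF LM_M X] LM_tt[OF X LM_M]
      by (auto simp: sigma_def)
  qed
  have nat: "\<forall>f\<in>Arr CM. Comp CM (tens_arr CM f (Ident CM M)) (sigma M \<rho> (Dom CM f)) =
      Comp CM (sigma M \<rho> (Cod CM f)) (tens_arr CM (Ident CM M) f)"
  proof
    fix f assume f: "f \<in> Arr CM"
    obtain X Y \<phi> where fe: "f = Arrow X Y \<phi>" by (cases f)
    have X: "LM X" and Y: "LM Y" and \<phi>: "\<phi> \<in> hom X Y" using f by (simp_all add: fe Arr_CM)
    have "tm M X M Y (\<lambda>x\<in>carrier M. x) \<phi> w \<in> carrier (M \<otimes>\<^sub>t Y)" if "w \<in> carrier (M \<otimes>\<^sub>t X)" for w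
      by (rule tm_in[OF LM_M X LM_M Y id_hom[OF LM_M] \<phi> that])
    then show "Comp CM (tens_arr CM f (Ident CM M)) (sigma M \<rho> (Dom CM f)) =
      Comp CM (sigma M \<rho> (Cod CM f)) (tens_arr CM (Ident CM M) f)"
      using sg_natural[OF X Y \<phi>] X Y
      by (simp add: fe sigma_def tensor_t_arr_eq compose_def)
        (rule restrict_ext, simp add: sg_tt tt_D(1)[OF LM_M X])
  qed
  have hex: "\<forall>X\<in>Obj CM. \<forall>Y\<in>Obj CM.
      Comp CM (Comp CM (tens_arr CM (Ident CM X) (sigma M \<rho> Y)) (associator CM X M Y))
       (tens_arr CM (sigma M \<rho> X) (Ident CM Y)) =
      Comp CM (Comp CM (associator CM X Y M) (sigma M \<rho> (tens_obj CM X Y))) (associator CM M X Y)"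
  proof (intro ballI)
    fix X Y assume "X \<in> Obj CM" "Y \<in> Obj CM"
    then have X: "LM X" and Y: "LM Y" by simp_all
    have "\<forall>w\<in>carrier ((M \<otimes>\<^sub>t X) \<otimes>\<^sub>t Y). G2 X Y (G1 X Y (iL M X Y w)) = G3 X Y (iL M X Y w)"
      using G21_G3[OF X Y] iL_in[OF LM_M X Y] tt_D(1)[OF LM_tt[OF LM_M X] Y] by blast
    then show "Comp CM (Comp CM (tens_arr CM (Ident CM X) (sigma M \<rho> Y)) (associator CM X M Y))
       (tens_arr CM (sigma M \<rho> X) (Ident CM Y)) =
      Comp CM (Comp CM (associator CM X Y M) (sigma M \<rho> (tens_obj CM X Y))) (associator CM M X Y)"
      using hexagon_iff[OF X Y] by (simp only: CM_simps)
  qed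
  have rin: "rm M w \<in> carrier M" if "w \<in> carrier (M \<otimes>\<^sub>t U)" for w
    by (rule lin_closed[OF _ that, where f = "\<lambda>w. rm M w"]) (assumption | rule tc)+
  have unit: "sigma M \<rho> (unit_obj CM) = Comp CM (inverse_arrow CM (left_unitor CM M)) (right_unitor CM M)"
    by (simp add: inverse_lunit[OF LM_M] runit_t_eq[OF LM_M] sigma_def LM_U compose_def)
      (rule restrict_ext, simp add: sg_unit rin)
  show ?thesis
    unfolding half_braiding_def using ext hom nat hex unit by blast
qed

end

section \<open>From half-braidings to coactions and back\<close>

context weak_bialg
begin

lemma yd_iff: "yetter_drinfeld_module k H (M, \<rho>) \<longleftrightarrow> ydm k H M \<rho> \<and> \<rho> \<in> extensional (carrier M)"
proof -
  have "\<rho> m \<in> carrier (R \<otimes>\<^sub>t M) \<longleftrightarrow> dact R M \<one> (\<rho> m) = \<rho> m"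
    if "LM M" "lin M (H \<boxtimes> M) \<rho>" "m \<in> carrier M" for m
    using in_tt[OF LM_R that(1)] lin_closed[OF that(2,3)] by (simp add: R_cong)
  then show ?thesis
    unfolding yetter_drinfeld_module_def left_coaction_def sweedler_def split_conv R_cong
      ydm_def pre_yd_def pre_yd_axioms_def ydm_axioms_def
    using weak_bialg_axioms by blast
qed

definition rho_of where
  "rho_of M \<sigma> = (\<lambda>m\<in>carrier M. mor (\<sigma> R) (dact M R \<one> (tens k M R m \<one>)))"

lemma ydm_of_half_braiding:
  assumes M: "LM M" and hb: "half_braiding CM M \<sigma>"
  shows "ydm k H M (rho_of M \<sigma>)" "sigma M (rho_of M \<sigma>) = \<sigma>"
proof -
  let ?\<rho> = "rho_of M \<sigma>"
  define s where "s X = mor (\<sigma> X)" for X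
  have s: "\<sigma> X = Arrow (M \<otimes>\<^sub>t X) (X \<otimes>\<^sub>t M) (s X)" "s X \<in> hom (M \<otimes>\<^sub>t X) (X \<otimes>\<^sub>t M)" if "LM X" for X
    using hb that unfolding half_braiding_def s_def by (auto simp: in_hom_CM)
  have ls: "lin (M \<otimes>\<^sub>t X) (X \<boxtimes> M) (s X)" if "LM X" for X
    by (rule lin_tt_to[OF that M hom_D(2)[OF s(2)[OF that]]])
  have nat: "tm X M Y M f (\<lambda>m\<in>carrier M. m) (s X w) = s Y (tm M X M Y (\<lambda>m\<in>carrier M. m) f w)"
    if X: "LM X" and Y: "LM Y" and f: "f \<in> hom X Y" and w: "w \<in> carrier (M \<otimes>\<^sub>t X)" for X Y f w
  proof -
    have "Arrow X Y f \<in> Arr CM" using X Y f by (simp add: Arr_CM)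
    then have "Comp CM (tens_arr CM (Arrow X Y f) (Ident CM M)) (\<sigma> (Dom CM (Arrow X Y f))) =
      Comp CM (\<sigma> (Cod CM (Arrow X Y f))) (tens_arr CM (Ident CM M) (Arrow X Y f))"
      using hb unfolding half_braiding_def by blast
    then have "compose (carrier (M \<otimes>\<^sub>t X)) (\<lambda>w\<in>carrier (X \<otimes>\<^sub>t M). tm X M Y M f (\<lambda>m\<in>carrier M. m) w) (s X) w
      = compose (carrier (M \<otimes>\<^sub>t X)) (s Y) (\<lambda>w\<in>carrier (M \<otimes>\<^sub>t X). tm M X M Y (\<lambda>m\<in>carrier M. m) f w) w"
      by (simp add: s X Y tensor_t_arr_eq)
    then show ?thesis using w hom_D(4)[OF s(2)[OF X] w] by (simp add: compose_def)
  qed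
  have rho: "?\<rho> m = s R (dact M R \<one> (tens k M R m \<one>))" if "m \<in> carrier M" for m
    using that by (simp add: rho_of_def s_def)
  have "lin M (H \<boxtimes> M) (\<lambda>m. s R (dact M R \<one> (tens k M R m \<one>)))"
    unfolding R_cong(1)[symmetric] by (rule lin_comp[OF ls[OF LM_R]]) (assumption | rule tc M)+
  then have lrho: "lin M (H \<boxtimes> M) ?\<rho>"
    using lin_cong[OF module_LM[OF M], of ?\<rho> "\<lambda>m. s R (dact M R \<one> (tens k M R m \<one>))" "H \<boxtimes> M"] rho by simp
  \<comment> \<open>Naturality along \<open>?f\<close>, which sends \<open>h\<close> to
    \<open>h x\<close>, carries the projection of \<open>m \<otimes> \<one>\<close> to the
    projection of \<open>m \<otimes> x\<close>, so the value of \<sigma> at the regular module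
    determines all others.\<close>
  have sd: "s X (dact M X \<one> (tens k M X m x)) = tl H M (X \<boxtimes> M) (\<lambda>h n. tens k X M (act X h x) n) (?\<rho> m)"
    if X: "LM X" and m: "m \<in> carrier M" and x: "x \<in> carrier X" for X m x
  proof -
    let ?f = "\<lambda>h\<in>carrier R. act X h x"
    have f: "?f \<in> hom R X"
    proof (rule hom_restrictI[OF LM_R])
      show "lin R X (\<lambda>h. act X h x)" unfolding lin_R by (assumption | rule tc X x)+
    qed (simp add: carrier_R R_ops act_mult X x)
    note li = hom_D(2)[OF id_hom[OF M]] and lf = hom_D(2)[OF f]
    have t: "tens k M R m \<one> \<in> carrier (M \<boxtimes> R)" by (assumption | rule tc M m)+
    have w: "dact M R \<one> (tens k M R m \<one>) \<in> carrier (M \<otimes>\<^sub>t R)" by (assumption | rule tc M t)+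
    have "tm M R M X (\<lambda>m\<in>carrier M. m) ?f (dact M R \<one> (tens k M R m \<one>))
        = dact M X \<one> (tm M R M X (\<lambda>m\<in>carrier M. m) ?f (tens k M R m \<one>))"
      by (rule tm_dact[OF M LM_R M X id_hom[OF M] f one_in t])
    also have "tm M R M X (\<lambda>m\<in>carrier M. m) ?f (tens k M R m \<one>) = tens k M X m x"
      using tm_tens[OF M LM_R M X li lf m in_R[OF one_in]] m X x by (simp add: carrier_R one_in act_one)
    finally have eq: "tm M R M X (\<lambda>m\<in>carrier M. m) ?f (dact M R \<one> (tens k M R m \<one>)) =
      dact M X \<one> (tens k M X m x)" .
    have "s X (dact M X \<one> (tens k M X m x)) = tm R M X M ?f (\<lambda>m\<in>carrier M. m) (?\<rho> m)"
      unfolding eq[symmetric] rho[OF m] by (rule nat[OF LM_R X f w, symmetric])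
    also have "\<dots> = tl H M (X \<boxtimes> M) (\<lambda>h n. tens k X M (act X h x) n) (?\<rho> m)"
      unfolding tm_def R_cong by (rule tlift_cong) (simp add: carrier_R)
    finally show ?thesis .
  qed
  have rt: "?\<rho> m \<in> carrier (R \<otimes>\<^sub>t M)" if m: "m \<in> carrier M" for m
    unfolding rho[OF m] by (rule hom_D(4)[OF s(2)[OF LM_R]]) (assumption | rule tc M m)+
  have pre: "pre_yd k H M ?\<rho>"
  proof (intro pre_yd.intro weak_bialg_axioms pre_yd_axioms.intro M lrho)
    fix m assume m: "m \<in> carrier M"
    show "dact R M \<one> (?\<rho> m) = ?\<rho> m" by (rule tt_D(2)[OF LM_R M rt[OF m]])
    fix h assume h: "h \<in> carrier H"
    note tcs = tc M m h
    let ?t = "tens k M R m \<one>"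
    have t: "?t \<in> carrier (M \<boxtimes> R)" by (assumption | rule tcs)+
    \<comment> \<open>Linearity of \<sigma> at the regular module moves \<open>h\<close> inside;
      \<open>sd\<close>, applied to \<open>h\<^sub>1 m\<close> and \<open>h\<^sub>2\<close>, then
      produces the right side of the compatibility condition.\<close>
    have "dact R M h (?\<rho> m) = act (R \<otimes>\<^sub>t M) h (?\<rho> m)"
      by (simp add: tt_ops h rt m)
    also have "\<dots> = s R (act (M \<otimes>\<^sub>t R) h (dact M R \<one> ?t))"
      unfolding rho[OF m] by (rule hom_D(3)[OF s(2)[OF LM_R], symmetric]) (assumption | rule tcs)+
    also have "act (M \<otimes>\<^sub>t R) h (dact M R \<one> ?t) = dact M R \<one> (dact M R h ?t)"
      by (simp add: tt_ops dact_tt dact_one_dact M LM_R h one_in t)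
    also have "dact M R h ?t = SW (M \<boxtimes> R) (\<lambda>a b. tens k M R (act M a m) (act R b \<one>)) h"
      by (rule act2_tens) (assumption | rule tcs)+
    also have "s R (dact M R \<one> (SW (M \<boxtimes> R) (\<lambda>a b. tens k M R (act M a m) (act R b \<one>)) h))
        = SW (R \<boxtimes> M) (\<lambda>a b. s R (dact M R \<one> (tens k M R (act M a m) (act R b \<one>)))) h"
      by (rule SW_push[where g = "\<lambda>x. s R (dact M R \<one> x)"]) (assumption | rule tcs lin_comp[OF ls[OF LM_R]])+
    also have "\<dots> = SW (R \<boxtimes> M) (\<lambda>a b. tl H M (R \<boxtimes> M) (\<lambda>g n. tens k R M (act R g (act R b \<one>)) n) (?\<rho> (act M a m))) h"
      by (rule tlift_cong, rule sd) (assumption | rule tcs)+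
    also have "\<dots> = SW (H \<boxtimes> M) (\<lambda>a b. tl H M (H \<boxtimes> M) (\<lambda>g n. tens k H M (g \<otimes> b) n) (?\<rho> (act M a m))) h"
      unfolding R_cong by (intro tlift_cong) (simp add: R_ops one_in)
    finally show "dact R M h (?\<rho> m) =
        SW (H \<boxtimes> M) (\<lambda>a b. tl H M (H \<boxtimes> M) (\<lambda>g n. tens k H M (g \<otimes> b) n) (?\<rho> (act M a m))) h" .
  qed
  then interpret pre_yd k H M ?\<rho> .
  have sX: "s X w = sg M ?\<rho> X w" if X: "LM X" and w: "w \<in> carrier (M \<otimes>\<^sub>t X)" for X w
    by (rule tt_ext[OF M X _ ls[OF X] _ _ w, where g = "\<lambda>w. sg M ?\<rho> X w"])
      (assumption | rule tc X | simp add: sd X sg_dact_one sg_tens tens_closed module_LM M)+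
  \<comment> \<open>Proved before coassociativity and counitality: the hexagon and the unit
    condition of the given \<sigma> thereby become statements about \<open>sigma\<close>, to which
    \<open>hexagon_iff\<close> and \<open>lm_sg_dact\<close> apply.\<close>
  show sig: "sigma M ?\<rho> = \<sigma>"
  proof (rule extensionalityI[of _ "{X. LM X}"])
    show "\<sigma> \<in> extensional {X. LM X}" using hb by (simp add: half_braiding_def)
    fix X assume "X \<in> {X. LM X}"
    then have X: "LM X" by simp
    have "(\<lambda>w\<in>carrier (M \<otimes>\<^sub>t X). sg M ?\<rho> X w) = s X"
      by (rule extensionalityI[of _ "carrier (M \<otimes>\<^sub>t X)"]) (simp_all add: sX X hom_D(1)[OF s(2)[OF X]])
    then show "sigma M ?\<rho> X = \<sigma> X" using s(1)[OF X] X by (simp add: sigma_def)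
  qed (simp add: sigma_def)
  show "ydm k H M ?\<rho>"
  proof (intro ydm.intro pre ydm_axioms.intro)
    fix m assume m: "m \<in> carrier M"
    have RO: "R \<in> Obj CM" by (simp add: LM_R)
    have "Comp CM (Comp CM (tens_arr CM (Ident CM R) (sigma M ?\<rho> R)) (associator CM R M R))
       (tens_arr CM (sigma M ?\<rho> R) (Ident CM R)) =
      Comp CM (Comp CM (associator CM R R M) (sigma M ?\<rho> (tens_obj CM R R))) (associator CM M R R)"
      using hb RO unfolding half_braiding_def sig by blast
    then have "\<forall>w\<in>carrier ((M \<otimes>\<^sub>t R) \<otimes>\<^sub>t R). G2 R R (G1 R R (iL M R R w)) = G3 R R (iL M R R w)"
      unfolding CM_simps(6,7,9) by (rule iffD1[OF hexagon_iff[OF LM_R LM_R]])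
    then show "CO (H \<boxtimes> H \<boxtimes> M) (\<lambda>h n. SW (H \<boxtimes> H \<boxtimes> M) (\<lambda>a b. tens k H (H \<boxtimes> M) a (tens k H M b n)) h) m =
        CO (H \<boxtimes> H \<boxtimes> M) (\<lambda>h n. tens k H (H \<boxtimes> M) h (?\<rho> n)) m"
      using coassoc_of_hexagon m by blast
    have w: "dact M U \<one> (tens k M U m \<one>) \<in> carrier (M \<otimes>\<^sub>t U)" (is "?w \<in> _")
      by (assumption | rule tc m)+
    have rin: "rm M x \<in> carrier M" if "x \<in> carrier (M \<otimes>\<^sub>t U)" for x
      by (rule lin_closed[OF _ that, where f = "\<lambda>w. rm M w"]) (assumption | rule tc)+
    have "sigma M ?\<rho> (unit_obj CM) = Comp CM (inverse_arrow CM (left_unitor CM M)) (right_unitor CM M)"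
      using hb unfolding half_braiding_def sig by blast
    then have "sg M ?\<rho> U ?w = linv M (rm M ?w)"
      using w rin[OF w]
      by (simp add: inverse_lunit[OF M] runit_t_eq[OF M] sigma_def LM_U compose_def fun_eq_iff restrict_def split: if_splits)
    then have "lm M (sg M ?\<rho> U ?w) = m"
      using lm_linv[OF M rin[OF w]] by (simp add: rm_dact M one_in_U m esb_one act_one)
    moreover have "CO M (\<lambda>h n. eps (h \<otimes> \<one>) \<odot>\<^bsub>M\<^esub> n) m = CO M (\<lambda>h n. eps h \<odot>\<^bsub>M\<^esub> n) m"
      by (rule tlift_cong) simp
    ultimately show "CO M (\<lambda>h n. eps h \<odot>\<^bsub>M\<^esub> n) m = m"
      using lm_sg_dact[OF m one_in_U] by simp
  qed
qed

lemma sg_R_one: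
  assumes "ydm k H M \<rho>" and m: "m \<in> carrier M"
  shows "sg M \<rho> R (dact M R \<one> (tens k M R m \<one>)) = \<rho> m"
proof -
  interpret ydm k H M \<rho> by fact
  have "sg M \<rho> R (dact M R \<one> (tens k M R m \<one>)) = sg M \<rho> R (tens k M R m \<one>)"
    by (rule sg_dact_one) (assumption | rule tc m)+
  also have "\<dots> = CO (R \<boxtimes> M) (\<lambda>h n. tens k R M (act R h \<one>) n) m"
    by (rule sg_tens) (assumption | rule tc m)+
  also have "\<dots> = CO (H \<boxtimes> M) (\<lambda>h n. tens k H M h n) m"
    unfolding R_cong by (rule tlift_cong) (simp add: R_ops one_in)
  also have "\<dots> = \<rho> m"
    by (rule tl_tens_id) (assumption | rule tc m)+
  finally show ?thesis .
qed

lemma rho_of_sigma: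
  assumes yd: "ydm k H M \<rho>" and ext: "\<rho> \<in> extensional (carrier M)"
  shows "rho_of M (sigma M \<rho>) = \<rho>"
proof -
  interpret ydm k H M \<rho> by (rule yd)
  have "dact M R \<one> (tens k M R m \<one>) \<in> carrier (M \<otimes>\<^sub>t R)" if m: "m \<in> carrier M" for m
    by (assumption | rule tc m)+
  then show ?thesis
    using ext sg_R_one[OF yd] by (auto simp: rho_of_def sigma_def LM_R extensional_def fun_eq_iff)
qed

end

section \<open>Invertibility of the half-braidings\<close>

context weak_bialg
begin

text \<open>Both sides equal \<open>\<epsilon>(1\<^sub>2 1\<^sub>2') 1\<^sub>1 \<otimes>
  1\<^sub>1'\<close>, with the sum over one or the other copy of the unit carried out first.\<close>

lemma SW_es_esb:
  assumes F: "bil H H P F" and P: "module k P"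
  shows "SW P (\<lambda>a b. F a (es b)) \<one> = SW P (\<lambda>a b. F (esb b) a) \<one>"
proof -
  note tcs = tc bil_tc[OF F] P
  have "SW P (\<lambda>a b. F a (es b)) \<one> = SW P (\<lambda>a b. SW P (\<lambda>p q. eps (b \<otimes> q) \<odot>\<^bsub>P\<^esub> F a p) \<one>) \<one>"
    by (rule tlift_cong, rule es_push[where f = "\<lambda>x. F _ x"]) (assumption | rule tcs bil1[OF F])+
  also have "\<dots> = SW P (\<lambda>p q. SW P (\<lambda>a b. eps (b \<otimes> q) \<odot>\<^bsub>P\<^esub> F a p) \<one>) \<one>"
    by (rule tl_swap) (assumption | rule tcs)+
  also have "\<dots> = SW P (\<lambda>p q. F (esb q) p) \<one>"
    by (rule tlift_cong, rule esb_push[where f = "\<lambda>x. F x _", symmetric]) (assumption | rule tcs)+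
  finally show ?thesis .
qed

end

locale ydm_hopf = ydm k H M \<rho> + weak_hopf_bij k H S
  for k :: "'u ring" and H :: "'u bialgebra" (structure) and M \<rho> S
begin

definition tau where
  "tau X u = tl X M (M \<boxtimes> X) (\<lambda>x m. CO (M \<boxtimes> X) (\<lambda>h n. tens k M X n (act X (T h) x)) m) u"

lemma lin_tau [tc]: "LM X \<Longrightarrow> lin Q (X \<boxtimes> M) f \<Longrightarrow> lin Q (M \<boxtimes> X) (\<lambda>u. tau X (f u))"
  unfolding tau_def by (assumption | rule tc)+

lemma tau_tens: "LM X \<Longrightarrow> x \<in> carrier X \<Longrightarrow> m \<in> carrier M \<Longrightarrow>
    tau X (tens k X M x m) = CO (M \<boxtimes> X) (\<lambda>h n. tens k M X n (act X (T h) x)) m"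
  unfolding tau_def by (rule tlift_tens) (assumption | rule tc)+

text \<open>Coassociativity contracts the two coactions to \<open>m\<^sub>0 \<otimes>
  S\<^sup>-\<^sup>1(\<epsilon>\<^sub>s(m\<^sub>-)) x\<close>. Expanding \<open>es\<close> leaves
  \<open>\<epsilon>(m\<^sub>- 1\<^sub>2) m\<^sub>0 = esb(1\<^sub>2) m\<close>, which
  \<open>SW_es_esb\<close> rewrites as \<open>1\<^sub>1 m \<otimes>
  S\<^sup>-\<^sup>1(\<epsilon>\<^sub>s(1\<^sub>2)) x\<close>; there \<open>es\<close> may be
  replaced by \<open>S\<close>.\<close>

lemma tau_sg:
  assumes X: "LM X" and w: "w \<in> carrier (M \<boxtimes> X)"
  shows "tau X (sg M \<rho> X w) = dact M X \<one> w"
proof (rule lin_ext[where P = "M \<boxtimes> X" and f = "\<lambda>w. tau X (sg M \<rho> X w)" and g = "\<lambda>w. dact M X \<one> w", OF _ _ _ _ _ _ w])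
  let ?P = "M \<boxtimes> X"
  fix m x assume m: "m \<in> carrier M" and x: "x \<in> carrier X"
  note tcs = tc X m x
  have "tau X (CO (X \<boxtimes> M) (\<lambda>h n. tens k X M (act X h x) n) m) = CO ?P (\<lambda>h n. tau X (tens k X M (act X h x) n)) m"
    by (rule CO_push[where g = "\<lambda>u. tau X u"]) (assumption | rule tcs)+
  also have "\<dots> = CO ?P (\<lambda>h n. CO ?P (\<lambda>g p. tens k M X p (act X (T g) (act X h x))) n) m"
    by (rule tlift_cong, rule tau_tens) (assumption | rule tcs)+
  also have "\<dots> = CO ?P (\<lambda>h n. SW ?P (\<lambda>a b. tens k M X n (act X (T b) (act X a x))) h) m"
    by (rule co_coassoc[symmetric]) (assumption | rule tcs)+
  also have "\<dots> = CO ?P (\<lambda>h n. SW ?P (\<lambda>a b. tens k M X n (act X (T b \<otimes> a) x)) h) m"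
    by (intro tlift_cong) (simp add: act_mult X x T_in)
  also have "\<dots> = CO ?P (\<lambda>h n. tens k M X n (act X (SW H (\<lambda>a b. T b \<otimes> a) h) x)) m"
    by (rule tlift_cong, rule SW_push[where g = "\<lambda>y. tens k M X _ (act X y x)", symmetric]) (assumption | rule tcs)+
  also have "\<dots> = CO ?P (\<lambda>h n. tens k M X n (act X (T (es h)) x)) m"
    by (rule tlift_cong) (simp add: SW_T_es)
  also have "\<dots> = CO ?P (\<lambda>h n. SW ?P (\<lambda>a b. eps (h \<otimes> b) \<odot>\<^bsub>?P\<^esub> tens k M X n (act X (T a) x)) \<one>) m"
    by (rule tlift_cong, rule es_push[where f = "\<lambda>y. tens k M X _ (act X (T y) x)"]) (assumption | rule tcs)+
  also have "\<dots> = SW ?P (\<lambda>a b. CO ?P (\<lambda>h n. eps (h \<otimes> b) \<odot>\<^bsub>?P\<^esub> tens k M X n (act X (T a) x)) m) \<one>"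
    by (rule tl_swap) (assumption | rule tcs)+
  also have "\<dots> = SW ?P (\<lambda>a b. CO ?P (\<lambda>h n. tens k M X (eps (h \<otimes> b) \<odot>\<^bsub>M\<^esub> n) (act X (T a) x)) m) \<one>"
    by (intro tlift_cong) (simp add: bil_smult_out[OF bil_tens] module_LM LM_M X eps_in mult_in act_in T_in x)
  also have "\<dots> = SW ?P (\<lambda>a b. tens k M X (CO M (\<lambda>h n. eps (h \<otimes> b) \<odot>\<^bsub>M\<^esub> n) m) (act X (T a) x)) \<one>"
    by (rule tlift_cong, rule CO_push[where g = "\<lambda>y. tens k M X y _", symmetric]) (assumption | rule tcs)+
  also have "\<dots> = SW ?P (\<lambda>a b. tens k M X (act M (esb b) m) (act X (T a) x)) \<one>"
    by (rule tlift_cong) (simp add: CO_eps_esb m)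
  also have "\<dots> = SW ?P (\<lambda>a b. tens k M X (act M a m) (act X (T (es b)) x)) \<one>"
    by (rule SW_es_esb[symmetric, where F = "\<lambda>a b. tens k M X (act M a m) (act X (T b) x)"]) (assumption | rule tcs)+
  also have "\<dots> = SW ?P (\<lambda>a b. tens k M X (act M a m) (act X (T (S b)) x)) \<one>"
    by (rule SW_one_S(1)[symmetric, where F = "\<lambda>a b. tens k M X (act M a m) (act X (T b) x)"]) (assumption | rule tcs)+
  also have "\<dots> = SW ?P (\<lambda>a b. tens k M X (act M a m) (act X b x)) \<one>"
    by (rule tlift_cong) (simp add: T_S)
  also have "\<dots> = dact M X \<one> (tens k M X m x)"
    by (rule act2_tens[symmetric]) (assumption | rule tcs)+
  finally show "tau X (sg M \<rho> X (tens k M X m x)) = dact M X \<one> (tens k M X m x)"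
    by (simp add: sg_tens X m x)
qed (assumption | rule tc X)+

text \<open>Coassociativity leaves \<open>S\<^sup>-\<^sup>1(\<epsilon>\<^sub>t(m\<^sub>-)) x
  \<otimes> m\<^sub>0\<close>. A unit is inserted by \<open>yd_one\<close> so that the transfer
  identity can move \<open>m\<^sub>-\<close> to the second factor, where
  \<open>\<epsilon>\<^sub>t(m\<^sub>-) m\<^sub>0 = m\<close> collapses the coaction; on the
  remaining leg \<open>et\<close> may be replaced by \<open>S\<close>.\<close>

lemma sg_tau:
  assumes X: "LM X" and u: "u \<in> carrier (X \<boxtimes> M)"
  shows "sg M \<rho> X (tau X u) = dact X M \<one> u"
proof (rule lin_ext[where P = "X \<boxtimes> M" and f = "\<lambda>u. sg M \<rho> X (tau X u)" and g = "\<lambda>u. dact X M \<one> u", OF _ _ _ _ _ _ u])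
  let ?P = "X \<boxtimes> M"
  fix x m assume x: "x \<in> carrier X" and m: "m \<in> carrier M"
  note tcs = tc X m x
  have "sg M \<rho> X (CO (M \<boxtimes> X) (\<lambda>h n. tens k M X n (act X (T h) x)) m) =
      CO ?P (\<lambda>h n. sg M \<rho> X (tens k M X n (act X (T h) x))) m"
    by (rule CO_push[where g = "\<lambda>u. sg M \<rho> X u"]) (assumption | rule tcs)+
  also have "\<dots> = CO ?P (\<lambda>h n. CO ?P (\<lambda>g p. tens k X M (act X g (act X (T h) x)) p) n) m"
    by (rule tlift_cong, rule sg_tens) (assumption | rule tcs)+
  also have "\<dots> = CO ?P (\<lambda>h n. SW ?P (\<lambda>a b. tens k X M (act X b (act X (T a) x)) n) h) m"
    by (rule co_coassoc[symmetric]) (assumption | rule tcs)+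
  also have "\<dots> = CO ?P (\<lambda>h n. SW ?P (\<lambda>a b. tens k X M (act X (b \<otimes> T a) x) n) h) m"
    by (intro tlift_cong) (simp add: act_mult X x T_in)
  also have "\<dots> = CO ?P (\<lambda>h n. tens k X M (act X (SW H (\<lambda>a b. b \<otimes> T a) h) x) n) m"
    by (rule tlift_cong, rule SW_push[where g = "\<lambda>y. tens k X M (act X y x) _", symmetric]) (assumption | rule tcs)+
  also have "\<dots> = CO ?P (\<lambda>h n. tens k X M (act X (T (et h)) x) n) m"
    by (rule tlift_cong) (simp add: SW_T_et)
  also have "\<dots> = CO ?P (\<lambda>h n. SW ?P (\<lambda>a b. tens k X M (act X (T (et (a \<otimes> h))) x) (act M b n)) \<one>) m"
    by (rule yd_one[symmetric, where F = "\<lambda>h n. tens k X M (act X (T (et h)) x) n"]) (assumption | rule tcs)+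
  also have "\<dots> = CO ?P (\<lambda>h n. SW ?P (\<lambda>a b. tens k X M (act X (T (et a)) x) (act M (b \<otimes> et h) n)) \<one>) m"
    by (rule tlift_cong, rule SW_et_transfer[symmetric, where F = "\<lambda>a b. tens k X M (act X (T a) x) (act M b _)"])
      (assumption | rule tcs)+
  also have "\<dots> = CO ?P (\<lambda>h n. SW ?P (\<lambda>a b. tens k X M (act X (T (et a)) x) (act M b (act M (et h) n))) \<one>) m"
    by (intro tlift_cong) (simp add: act_mult LM_M et_in)
  also have "\<dots> = SW ?P (\<lambda>a b. CO ?P (\<lambda>h n. tens k X M (act X (T (et a)) x) (act M b (act M (et h) n))) m) \<one>"
    by (rule tl_swap) (assumption | rule tcs)+
  also have "\<dots> = SW ?P (\<lambda>a b. tens k X M (act X (T (et a)) x) (act M b (CO M (\<lambda>h n. act M (et h) n) m))) \<one>"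
    by (rule tlift_cong, rule CO_push[where g = "\<lambda>y. tens k X M _ (act M _ y)", symmetric]) (assumption | rule tcs)+
  also have "\<dots> = SW ?P (\<lambda>a b. tens k X M (act X (T (et a)) x) (act M b m)) \<one>"
    by (simp add: CO_et m)
  also have "\<dots> = SW ?P (\<lambda>a b. tens k X M (act X (T (S a)) x) (act M b m)) \<one>"
    by (rule SW_one_S(2)[symmetric, where F = "\<lambda>a b. tens k X M (act X (T a) x) (act M b m)"]) (assumption | rule tcs)+
  also have "\<dots> = SW ?P (\<lambda>a b. tens k X M (act X a x) (act M b m)) \<one>"
    by (rule tlift_cong) (simp add: T_S)
  also have "\<dots> = dact X M \<one> (tens k X M x m)"
    by (rule act2_tens[symmetric]) (assumption | rule tcs)+
  finally show "sg M \<rho> X (tau X (tens k X M x m)) = dact X M \<one> (tens k X M x m)"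
    by (simp add: tau_tens X m x)
qed (assumption | rule tc X)+

lemma is_iso_sigma:
  assumes X: "LM X"
  shows "is_iso CM (sigma M \<rho> X)"
proof -
  \<comment> \<open>The values of \<open>tau\<close> are projected to ensure that they lie in
    \<open>M \<otimes>\<^sub>t X\<close>. By \<open>sg_dact_one\<close> the projection does not
    affect the composite with \<sigma>.\<close>
  define \<tau> where "\<tau> u = dact M X \<one> (tau X u)" for u
  have ltau: "lin (X \<otimes>\<^sub>t M) (M \<otimes>\<^sub>t X) \<tau>"
    unfolding \<tau>_def by (assumption | rule tc X)+
  note tin = lin_closed[OF ltau]
  have \<tau>_sg: "\<tau> (sg M \<rho> X w) = w" if w: "w \<in> carrier (M \<otimes>\<^sub>t X)" for w
    using tau_sg[OF X tt_D(1)[OF LM_M X w]] tt_D(2)[OF LM_M X w] by (simp add: \<tau>_def)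
  have sg_\<tau>: "sg M \<rho> X (\<tau> u) = u" if u: "u \<in> carrier (X \<otimes>\<^sub>t M)" for u
  proof -
    note u' = tt_D[OF X LM_M u]
    have "tau X u \<in> carrier (M \<boxtimes> X)"
      by (rule lin_closed[OF _ u'(1), where f = "\<lambda>u. tau X u"]) (assumption | rule tc X)+
    then show ?thesis using sg_dact_one[OF X] sg_tau[OF X u'(1)] u'(2) by (simp add: \<tau>_def)
  qed
  note s = sg_hom[OF X]
  have t: "(\<lambda>u\<in>carrier (X \<otimes>\<^sub>t M). \<tau> u) \<in> hom (X \<otimes>\<^sub>t M) (M \<otimes>\<^sub>t X)"
  proof (rule hom_restrictI[OF _ ltau])
    fix h u assume h: "h \<in> carrier H" and u: "u \<in> carrier (X \<otimes>\<^sub>t M)"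
    have a: "act (M \<otimes>\<^sub>t X) h (\<tau> u) \<in> carrier (M \<otimes>\<^sub>t X)"
      by (assumption | rule tc X h tin u)+
    \<comment> \<open>Linearity of the inverse over \<open>H\<close> follows from that of \<sigma>:
      both candidates have the same image under \<sigma>.\<close>
    have "sg M \<rho> X (act (M \<otimes>\<^sub>t X) h (\<tau> u)) = act (X \<otimes>\<^sub>t M) h u"
      using hom_D(3)[OF s h tin[OF u]] tin[OF u] a sg_\<tau>[OF u] by simp
    then show "\<tau> (act (X \<otimes>\<^sub>t M) h u) = act (M \<otimes>\<^sub>t X) h (\<tau> u)"
      using \<tau>_sg[OF a] by simp
  qed (assumption | rule tc X)+
  have MX: "LM (M \<otimes>\<^sub>t X)" and XM: "LM (X \<otimes>\<^sub>t M)" by (assumption | rule tc X)+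
  have sin: "sg M \<rho> X w \<in> carrier (X \<otimes>\<^sub>t M)" if "w \<in> carrier (M \<otimes>\<^sub>t X)" for w
    by (rule sg_tt[OF X tt_D(1)[OF LM_M X that]])
  have in_t: "in_hom CM (Arrow (X \<otimes>\<^sub>t M) (M \<otimes>\<^sub>t X) (\<lambda>u\<in>carrier (X \<otimes>\<^sub>t M). \<tau> u)) (X \<otimes>\<^sub>t M) (M \<otimes>\<^sub>t X)"
    using t MX XM unfolding in_hom_CM by blast
  have "is_inverse CM (sigma M \<rho> X) (Arrow (X \<otimes>\<^sub>t M) (M \<otimes>\<^sub>t X) (\<lambda>u\<in>carrier (X \<otimes>\<^sub>t M). \<tau> u))"
    using X s in_t MX XM unfolding is_inverse_def
    by (auto simp: sigma_def Arr_CM compose_def fun_eq_iff sin tin \<tau>_sg sg_\<tau>)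
  then show ?thesis unfolding is_iso_def by blast
qed

end

section \<open>The isomorphism of categories\<close>

text \<open>Transport of structure: the category laws of \<open>E\<close> are deduced from those of
  \<open>C\<close> along the two bijections. For the center this replaces a direct verification
  through the monoidal structure.\<close>

lemma isomorphic_categoriesI:
  fixes C :: "('o, 'a, 'm) category_data_scheme" and E :: "('p, 'b, 'n) category_data_scheme"
  assumes C: "category C"
    and obj: "Obj E = Fo ` Obj C" and arr: "Arr E = Fa ` Arr C"
    and GF: "\<And>A. A \<in> Obj C \<Longrightarrow> Go (Fo A) = A" "\<And>f. f \<in> Arr C \<Longrightarrow> Ga (Fa f) = f"
    and dom: "\<And>f. f \<in> Arr C \<Longrightarrow> Dom E (Fa f) = Fo (Dom C f)"
    and cod: "\<And>f. f \<in> Arr C \<Longrightarrow> Cod E (Fa f) = Fo (Cod C f)"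
    and ident: "\<And>A. A \<in> Obj C \<Longrightarrow> Ident E (Fo A) = Fa (Ident C A)"
    and comp: "\<And>f g. f \<in> Arr C \<Longrightarrow> g \<in> Arr C \<Longrightarrow> Dom C g = Cod C f \<Longrightarrow>
      Comp E (Fa g) (Fa f) = Fa (Comp C g f)"
  shows "isomorphic_categories C E"
proof -
  interpret C: category C by (rule C)
  have in_homE: "\<exists>f. h = Fa f \<and> in_hom C f (Dom C f) (Cod C f) \<and> f \<in> Arr C \<and> A = Fo (Dom C f) \<and> B = Fo (Cod C f)"
    if "in_hom E h A B" for h A B
    using that by (auto simp: in_hom_def arr dom cod)
  have in_homI: "in_hom E (Fa f) (Fo A) (Fo B)" if "in_hom C f A B" for f A B
    using that by (auto simp: in_hom_def arr dom cod)
  \<comment> \<open>Composability in \<open>E\<close> has to be pulled back to \<open>C\<close>,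
    which requires injectivity on objects; it comes from the left inverse \<open>Go\<close>.\<close>
  have inj: "A = B" if "Fo A = Fo B" "A \<in> Obj C" "B \<in> Obj C" for A B
    using GF(1)[OF that(2)] GF(1)[OF that(3)] that(1) by metis
  have compI: "Comp C g f \<in> Arr C" "Dom C (Comp C g f) = Dom C f" "Cod C (Comp C g f) = Cod C g"
    if "f \<in> Arr C" "g \<in> Arr C" "Dom C g = Cod C f" for f g
    using C.comp_in_hom[of f "Dom C f" "Cod C f" g "Cod C g"] that by (auto simp: in_hom_def)
  have E: "category E"
  proof
    fix f assume "f \<in> Arr E"
    then show "Dom E f \<in> Obj E" "Cod E f \<in> Obj E"
      by (auto simp: arr obj dom cod C.dom_closed C.cod_closed)
  next
    fix A assume "A \<in> Obj E"
    then show "in_hom E (Ident E A) A A"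
      using in_homI[OF C.id_in_hom] by (auto simp: obj ident)
  next
    fix f A B g F assume f: "in_hom E f A B" and g: "in_hom E g B F"
    obtain f' where f': "f = Fa f'" "f' \<in> Arr C" "A = Fo (Dom C f')" "B = Fo (Cod C f')"
      using in_homE[OF f] by blast
    obtain g' where g': "g = Fa g'" "g' \<in> Arr C" "B = Fo (Dom C g')" "F = Fo (Cod C g')"
      using in_homE[OF g] by blast
    have eq: "Dom C g' = Cod C f'"
      using inj f' g' C.dom_closed C.cod_closed by metis
    show "in_hom E (Comp E g f) A F"
      using compI[OF f'(2) g'(2) eq] f' g' comp[OF f'(2) g'(2) eq]
      by (auto simp: in_hom_def arr dom cod)
  next
    fix f A B g F h G assume f: "in_hom E f A B" and g: "in_hom E g B F" and h: "in_hom E h F G"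
    obtain f' where f': "f = Fa f'" "f' \<in> Arr C" "A = Fo (Dom C f')" "B = Fo (Cod C f')"
      using in_homE[OF f] by blast
    obtain g' where g': "g = Fa g'" "g' \<in> Arr C" "B = Fo (Dom C g')" "F = Fo (Cod C g')"
      using in_homE[OF g] by blast
    obtain h' where h': "h = Fa h'" "h' \<in> Arr C" "F = Fo (Dom C h')" "G = Fo (Cod C h')"
      using in_homE[OF h] by blast
    have eq: "Dom C g' = Cod C f'" "Dom C h' = Cod C g'"
      using inj f' g' h' C.dom_closed C.cod_closed by metis+
    show "Comp E (Comp E h g) f = Comp E h (Comp E g f)"
      using f' g' h' eq compI C.comp_assoc[of f' "Dom C f'" "Cod C f'" g' "Cod C g'" h' "Cod C h'"]
      by (simp add: comp in_hom_def)
  next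
    fix f A B assume f: "in_hom E f A B"
    obtain f' where f': "f = Fa f'" "f' \<in> Arr C" "A = Fo (Dom C f')" "B = Fo (Cod C f')" "in_hom C f' (Dom C f') (Cod C f')"
      using in_homE[OF f] by blast
    show "Comp E (Ident E B) f = f"
      using f' C.comp_id_left[OF f'(5)] C.id_in_hom[OF C.cod_closed[OF f'(2)]] C.cod_closed
      by (simp add: ident comp in_hom_def)
    show "Comp E f (Ident E A) = f"
      using f' C.comp_id_right[OF f'(5)] C.id_in_hom[OF C.dom_closed[OF f'(2)]] C.dom_closed
      by (simp add: ident comp in_hom_def)
  qed
  have F: "is_functor C E Fo Fa"
    unfolding is_functor_def by (auto simp: obj ident comp in_hom_def arr dom cod)
  have G: "is_functor E C Go Ga"
    unfolding is_functor_def
  proof (intro conjI ballI impI)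
    fix A assume "A \<in> Obj E"
    then obtain A' where A': "A = Fo A'" "A' \<in> Obj C" by (auto simp: obj)
    then show "Go A \<in> Obj C" "Ga (Ident E A) = Ident C (Go A)"
      using C.id_in_hom[OF A'(2)] by (simp_all add: ident GF in_hom_def)
  next
    fix f assume "f \<in> Arr E"
    then obtain f' where "f = Fa f'" "f' \<in> Arr C" by (auto simp: arr)
    then show "in_hom C (Ga f) (Go (Dom E f)) (Go (Cod E f))"
      by (simp add: in_hom_def GF dom cod C.dom_closed C.cod_closed)
  next
    fix f g assume f: "f \<in> Arr E" and g: "g \<in> Arr E" and eq: "Dom E g = Cod E f"
    obtain f' where f': "f = Fa f'" "f' \<in> Arr C" using f by (auto simp: arr)
    obtain g' where g': "g = Fa g'" "g' \<in> Arr C" using g by (auto simp: arr)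
    have eq': "Dom C g' = Cod C f'"
      by (rule inj) (use eq f' g' in \<open>simp_all add: dom cod C.dom_closed C.cod_closed\<close>)
    show "Ga (Comp E g f) = Comp C (Ga g) (Ga f)"
      using f' g' eq' compI by (simp add: comp GF)
  qed
  have "\<forall>A\<in>Obj C. Go (Fo A) = A" "\<forall>f\<in>Arr C. Ga (Fa f) = f"
    "\<forall>B\<in>Obj E. Fo (Go B) = B" "\<forall>g\<in>Arr E. Fa (Ga g) = g"
    using GF by (auto simp: obj arr)
  then show ?thesis
    unfolding isomorphic_categories_def using C E F G by blast
qed

lemma weak_left_center_simps:
  "Obj (weak_left_center C) = {(M, \<sigma>). M \<in> Obj C \<and> half_braiding C M \<sigma>}"
  "Arr (weak_left_center C) = {Arrow (M, \<sigma>) (M', \<sigma>') \<theta> | M \<sigma> M' \<sigma>' \<theta>.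
    M \<in> Obj C \<and> half_braiding C M \<sigma> \<and> M' \<in> Obj C \<and> half_braiding C M' \<sigma>' \<and> in_hom C \<theta> M M' \<and>
    (\<forall>X\<in>Obj C. Comp C (tens_arr C (Ident C X) \<theta>) (\<sigma> X) = Comp C (\<sigma>' X) (tens_arr C \<theta> (Ident C X)))}"
  "Dom (weak_left_center C) = src" "Cod (weak_left_center C) = tgt"
  "Ident (weak_left_center C) A = Arrow A A (Ident C (fst A))"
  "Comp (weak_left_center C) g f = Arrow (src f) (tgt g) (Comp C (mor g) (mor f))"
  by (simp_all add: weak_left_center_def)

lemma full_subcategory_all:
  assumes "\<And>A. A \<in> Obj C \<Longrightarrow> P A"
    and "\<And>f. f \<in> Arr C \<Longrightarrow> Dom C f \<in> Obj C \<and> Cod C f \<in> Obj C"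
  shows "full_subcategory C P = C"
proof -
  have "{A \<in> Obj C. P A} = Obj C" "{f \<in> Arr C. P (Dom C f) \<and> P (Cod C f)} = Arr C"
    using assms by auto
  then show ?thesis unfolding full_subcategory_def by simp
qed

section \<open>Matching the objects and arrows of the two categories\<close>

context weak_bialg
begin

abbreviation YD where "YD \<equiv> yetter_drinfeld_module k H"
abbreviation hom2 where "hom2 \<equiv> H_linear_colinear_maps k H"

lemma hom2_iff: "f \<in> hom2 (M, \<rho>) (M', \<rho>') \<longleftrightarrow> f \<in> hom M M' \<and>
    (\<forall>m\<in>carrier M. tl H M (H \<boxtimes> M') (\<lambda>h n. tens k H M' h (f n)) (\<rho> m) = \<rho>' (f m))"
  unfolding H_linear_colinear_maps_def split_conv R_cong by simp

lemma category_YD: "category (yetter_drinfeld_modules k H)"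
  unfolding yetter_drinfeld_modules_def
proof (rule category_concrete)
  fix A B f assume "A \<in> {A. YD A}" "f \<in> hom2 A B"
  then show "f \<in> extensional (carrier (fst A)) \<and> f \<in> carrier (fst A) \<rightarrow> carrier (fst B)"
    by (cases A; cases B) (auto simp: hom2_iff hom_D)
next
  fix A assume "A \<in> {A. YD A}"
  then obtain M \<rho> where A: "A = (M, \<rho>)" "ydm k H M \<rho>" by (cases A) (auto simp: yd_iff)
  interpret ydm k H M \<rho> by (rule A)
  have "tl H M (H \<boxtimes> M) (\<lambda>h n. tens k H M h ((\<lambda>x\<in>carrier M. x) n)) (\<rho> m) = \<rho> m" if m: "m \<in> carrier M" for m
  proof -
    have "tl H M (H \<boxtimes> M) (\<lambda>h n. tens k H M h ((\<lambda>x\<in>carrier M. x) n)) (\<rho> m) = tl H M (H \<boxtimes> M) (tens k H M) (\<rho> m)"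
      by (rule tlift_cong) simp
    also have "\<dots> = \<rho> m" by (rule tl_tens_id) (assumption | rule tc m)+
    finally show ?thesis .
  qed
  then show "(\<lambda>x\<in>carrier (fst A). x) \<in> hom2 A A"
    by (simp add: A hom2_iff id_hom LM_M)
next
  fix A B E f g
  assume "A \<in> {A. YD A}" "B \<in> {A. YD A}" "E \<in> {A. YD A}" and f: "f \<in> hom2 A B" and g: "g \<in> hom2 B E"
  then obtain M \<rho> M' \<rho>' M'' \<rho>'' where A: "A = (M, \<rho>)" "ydm k H M \<rho>" and B: "B = (M', \<rho>')" "ydm k H M' \<rho>'"
    and E: "E = (M'', \<rho>'')" "ydm k H M'' \<rho>''"
    by (cases A; cases B; cases E) (auto simp: yd_iff)
  interpret A: ydm k H M \<rho> by (rule A)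
  interpret B: ydm k H M' \<rho>' by (rule B)
  interpret E: ydm k H M'' \<rho>'' by (rule E)
  have fh: "f \<in> hom M M'" and gh: "g \<in> hom M' M''"
    and fc: "\<And>m. m \<in> carrier M \<Longrightarrow> tl H M (H \<boxtimes> M') (\<lambda>h n. tens k H M' h (f n)) (\<rho> m) = \<rho>' (f m)"
    and gc: "\<And>m. m \<in> carrier M' \<Longrightarrow> tl H M' (H \<boxtimes> M'') (\<lambda>h n. tens k H M'' h (g n)) (\<rho>' m) = \<rho>'' (g m)"
    using f g by (auto simp: A B E hom2_iff)
  note lf = hom_D(2)[OF fh] and lg = hom_D(2)[OF gh]
  note tcs = tc lin_comp[OF lf] lin_comp[OF lg]
  have "tl H M (H \<boxtimes> M'') (\<lambda>h n. tens k H M'' h (compose (carrier M) g f n)) (\<rho> m) = \<rho>'' (compose (carrier M) g f m)"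
    if m: "m \<in> carrier M" for m
  proof -
    have "tl H M (H \<boxtimes> M'') (\<lambda>h n. tens k H M'' h (compose (carrier M) g f n)) (\<rho> m)
      = tl H M (H \<boxtimes> M'') (\<lambda>h n. tl H M' (H \<boxtimes> M'') (\<lambda>h n. tens k H M'' h (g n)) (tens k H M' h (f n))) (\<rho> m)"
    proof (rule tlift_cong)
      fix h n assume h: "h \<in> carrier H" and n: "n \<in> carrier M"
      have "tl H M' (H \<boxtimes> M'') (\<lambda>h n. tens k H M'' h (g n)) (tens k H M' h (f n)) = tens k H M'' h (g (f n))"
        by (rule tlift_tens) (assumption | rule tcs h hom_D(4)[OF fh n] | erule hom_D(4)[OF gh])+
      then show "tens k H M'' h (compose (carrier M) g f n) =
          tl H M' (H \<boxtimes> M'') (\<lambda>h n. tens k H M'' h (g n)) (tens k H M' h (f n))"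
        using n by (simp add: compose_def)
    qed
    also have "\<dots> = tl H M' (H \<boxtimes> M'') (\<lambda>h n. tens k H M'' h (g n)) (tl H M (H \<boxtimes> M') (\<lambda>h n. tens k H M' h (f n)) (\<rho> m))"
      by (rule tl_push[symmetric, where g = "\<lambda>u. tl H M' (H \<boxtimes> M'') (\<lambda>h n. tens k H M'' h (g n)) u"])
        (assumption | rule tcs A.lin_rho' A.rho_in m | erule hom_D(4)[OF gh] hom_D(4)[OF fh])+
    also have "\<dots> = \<rho>'' (compose (carrier M) g f m)"
      using m fc[OF m] gc[OF hom_D(4)[OF fh m]] by (simp add: compose_def)
    finally show ?thesis .
  qed
  then show "compose (carrier (fst A)) g f \<in> hom2 A E"
    using compose_hom[OF A.LM_M fh gh] by (simp add: A E hom2_iff)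
qed

text \<open>Colinearity gives the commuting squares on pure tensors of the full
  \<open>M \<boxtimes> X\<close>. Conversely, the square for the regular module at the projection of
  \<open>m \<otimes> \<one>\<close> returns the coactions themselves, by
  \<open>sg_R_one\<close>.\<close>

lemma colinear_iff:
  assumes "ydm k H M \<rho>" "ydm k H M' \<rho>'" and f: "f \<in> hom M M'"
  shows "(\<forall>m\<in>carrier M. tl H M (H \<boxtimes> M') (\<lambda>h n. tens k H M' h (f n)) (\<rho> m) = \<rho>' (f m)) \<longleftrightarrow>
    (\<forall>X\<in>Obj CM. Comp CM (tens_arr CM (Ident CM X) (Arrow M M' f)) (sigma M \<rho> X) =
      Comp CM (sigma M' \<rho>' X) (tens_arr CM (Arrow M M' f) (Ident CM X)))"
    (is "?col \<longleftrightarrow> ?comm")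
proof -
  interpret A: ydm k H M \<rho> by fact
  interpret B: ydm k H M' \<rho>' by fact
  note lf = hom_D(2)[OF f]
  let ?id = "\<lambda>X. \<lambda>x\<in>carrier X. x"
  let ?t = "\<lambda>X. tm M X M' X f (?id X)"
  let ?t' = "\<lambda>X. tm X M X M' (?id X) f"
  have comm: "?comm \<longleftrightarrow> (\<forall>X. LM X \<longrightarrow> (\<forall>w\<in>carrier (M \<otimes>\<^sub>t X). ?t' X (sg M \<rho> X w) = sg M' \<rho>' X (?t X w)))"
  proof -
    have "Comp CM (tens_arr CM (Ident CM X) (Arrow M M' f)) (sigma M \<rho> X) =
      Comp CM (sigma M' \<rho>' X) (tens_arr CM (Arrow M M' f) (Ident CM X)) \<longleftrightarrow>
      (\<forall>w\<in>carrier (M \<otimes>\<^sub>t X). ?t' X (sg M \<rho> X w) = sg M' \<rho>' X (?t X w))" if X: "LM X" for X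
    proof -
      have t: "?t X w \<in> carrier (M' \<otimes>\<^sub>t X)" if "w \<in> carrier (M \<otimes>\<^sub>t X)" for w
        by (rule tm_in[OF A.LM_M X B.LM_M X f id_hom[OF X] that])
      have s: "sg M \<rho> X w \<in> carrier (X \<otimes>\<^sub>t M)" if "w \<in> carrier (M \<otimes>\<^sub>t X)" for w
        by (rule A.sg_tt[OF X tt_D(1)[OF A.LM_M X that]])
      have 1: "Comp CM (tens_arr CM (Ident CM X) (Arrow M M' f)) (sigma M \<rho> X) =
          Arrow (M \<otimes>\<^sub>t X) (X \<otimes>\<^sub>t M') (\<lambda>w\<in>carrier (M \<otimes>\<^sub>t X). ?t' X (sg M \<rho> X w))"
        by (simp add: sigma_def X tensor_t_arr_eq compose_def) (rule restrict_ext, simp add: s)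
      have 2: "Comp CM (sigma M' \<rho>' X) (tens_arr CM (Arrow M M' f) (Ident CM X)) =
          Arrow (M \<otimes>\<^sub>t X) (X \<otimes>\<^sub>t M') (\<lambda>w\<in>carrier (M \<otimes>\<^sub>t X). sg M' \<rho>' X (?t X w))"
        by (simp add: sigma_def X tensor_t_arr_eq compose_def) (rule restrict_ext, simp add: t)
      show ?thesis
        unfolding 1 2 by (auto simp: fun_eq_iff restrict_def)
    qed
    then show ?thesis by simp
  qed
  show ?thesis
  proof
    assume col: ?col
    have "?t' X (sg M \<rho> X w) = sg M' \<rho>' X (?t X w)" if X: "LM X" and w: "w \<in> carrier (M \<boxtimes> X)" for X w
    proof -
      note li = hom_D(2)[OF id_hom[OF X]]
      note l1 = lin_tm[OF X A.LM_M X B.LM_M li lf] and l2 = lin_tm[OF A.LM_M X B.LM_M X lf li]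
      note tcs = tc X A.LM_M B.LM_M lin_comp[OF lf] lin_comp[OF l1] lin_comp[OF l2]
        A.lin_sg B.lin_sg A.rho_in A.lin_rho'
      show ?thesis
      proof (rule lin_ext[where P = "X \<boxtimes> M'" and f = "\<lambda>w. ?t' X (sg M \<rho> X w)"
            and g = "\<lambda>w. sg M' \<rho>' X (?t X w)", OF _ _ _ _ _ _ w])
        let ?P = "X \<boxtimes> M'"
        fix m x assume m: "m \<in> carrier M" and x: "x \<in> carrier X"
        note fm = hom_D(4)[OF f m]
        note tcs = tcs m x fm
        let ?F = "\<lambda>h n. tens k X M' (act X h x) n"
        have "?t' X (A.CO (X \<boxtimes> M) (\<lambda>h n. tens k X M (act X h x) n) m) =
            A.CO ?P (\<lambda>h n. ?t' X (tens k X M (act X h x) n)) m"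
          by (rule A.CO_push[OF l1]) (assumption | rule tcs)+
        also have "\<dots> = A.CO ?P (\<lambda>h n. ?F h (f n)) m"
          by (rule tlift_cong) (simp add: tm_tens[OF X A.LM_M X B.LM_M li lf] act_in X x)
        also have "\<dots> = A.CO ?P (\<lambda>h n. tl H M' ?P ?F (tens k H M' h (f n))) m"
          by (rule tlift_cong, rule tlift_tens[symmetric]) (assumption | rule tcs | erule hom_D(4)[OF f])+
        also have "\<dots> = tl H M' ?P ?F (A.CO (H \<boxtimes> M') (\<lambda>h n. tens k H M' h (f n)) m)"
          by (rule A.CO_push[where g = "\<lambda>u. tl H M' ?P ?F u", symmetric]) (assumption | rule tcs | erule hom_D(4)[OF f])+
        also have "\<dots> = tl H M' ?P ?F (\<rho>' (f m))" using col m by simp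
        finally show "?t' X (sg M \<rho> X (tens k M X m x)) = sg M' \<rho>' X (?t X (tens k M X m x))"
          by (simp add: A.sg_tens B.sg_tens X m x fm tm_tens[OF A.LM_M X B.LM_M X lf li])
      qed (assumption | rule tcs)+
    qed
    then show ?comm unfolding comm using tt_D(1)[OF A.LM_M] by blast
  next
    assume ?comm
    then have c: "?t' R (sg M \<rho> R w) = sg M' \<rho>' R (?t R w)" if "w \<in> carrier (M \<otimes>\<^sub>t R)" for w
      unfolding comm using LM_R that by blast
    show ?col
    proof
      fix m assume m: "m \<in> carrier M"
      note fm = hom_D(4)[OF f m] and ih = id_hom[OF LM_R]
      have t: "tens k M R m \<one> \<in> carrier (M \<boxtimes> R)" by (assumption | rule tc A.LM_M m)+
      have w: "dact M R \<one> (tens k M R m \<one>) \<in> carrier (M \<otimes>\<^sub>t R)" by (assumption | rule tc A.LM_M t)+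
      have "?t R (dact M R \<one> (tens k M R m \<one>)) = dact M' R \<one> (?t R (tens k M R m \<one>))"
        by (rule tm_dact[OF A.LM_M LM_R B.LM_M LM_R f ih one_in t])
      also have "?t R (tens k M R m \<one>) = tens k M' R (f m) \<one>"
        using tm_tens[OF A.LM_M LM_R B.LM_M LM_R lf hom_D(2)[OF ih] m in_R[OF one_in]]
        by (simp add: carrier_R one_in)
      finally have 1: "?t R (dact M R \<one> (tens k M R m \<one>)) = dact M' R \<one> (tens k M' R (f m) \<one>)" .
      have "?t' R (\<rho> m) = \<rho>' (f m)"
        using c[OF w] unfolding 1 sg_R_one[OF assms(1) m] sg_R_one[OF assms(2) fm] .
      moreover have "?t' R (\<rho> m) = tl H M (H \<boxtimes> M') (\<lambda>h n. tens k H M' h (f n)) (\<rho> m)"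
        unfolding tm_def R_cong by (rule tlift_cong) (simp add: carrier_R)
      ultimately show "tl H M (H \<boxtimes> M') (\<lambda>h n. tens k H M' h (f n)) (\<rho> m) = \<rho>' (f m)" by simp
    qed
  qed
qed

definition Fo where "Fo A = (fst A, sigma (fst A) (snd A))"
text \<open>The nesting is forced: an arrow of the center carries as its \<open>mor\<close> an arrow
  of the category of modules, whereas an arrow of Yetter-Drinfeld modules carries the bare
  function.\<close>

definition Fa where "Fa f = Arrow (Fo (src f)) (Fo (tgt f)) (Arrow (fst (src f)) (fst (tgt f)) (mor f))"
definition Go where "Go B = (fst B, rho_of (fst B) (snd B))"
definition Ga where "Ga g = Arrow (Go (src g)) (Go (tgt g)) (mor (mor g))"

lemma Go_Fo: "YD A \<Longrightarrow> Go (Fo A) = A"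
  by (cases A) (simp add: Go_def Fo_def yd_iff rho_of_sigma)

lemma Obj_W: "Obj (weak_left_center CM) = Fo ` {A. YD A}"
proof (intro equalityI subsetI)
  fix B assume "B \<in> Obj (weak_left_center CM)"
  then obtain M \<sigma> where B: "B = (M, \<sigma>)" "LM M" "half_braiding CM M \<sigma>"
    by (auto simp: weak_left_center_simps)
  have "YD (M, rho_of M \<sigma>)"
    using ydm_of_half_braiding(1)[OF B(2,3)] by (simp add: yd_iff rho_of_def)
  moreover have "B = Fo (M, rho_of M \<sigma>)"
    using ydm_of_half_braiding(2)[OF B(2,3)] B by (simp add: Fo_def)
  ultimately show "B \<in> Fo ` {A. YD A}" by blast
next
  fix B assume "B \<in> Fo ` {A. YD A}"
  then obtain M \<rho> where B: "B = (M, sigma M \<rho>)" "ydm k H M \<rho>"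
    by (auto simp: Fo_def yd_iff)
  interpret ydm k H M \<rho> by (rule B)
  show "B \<in> Obj (weak_left_center CM)"
    using half_braiding_sigma LM_M by (simp add: B weak_left_center_simps)
qed

lemma Arr_W:
  "Arr (weak_left_center CM) = Fa ` Arr (yetter_drinfeld_modules k H)"
proof (intro equalityI subsetI)
  fix g assume "g \<in> Arr (weak_left_center CM)"
  then obtain M \<sigma> M' \<sigma>' \<theta> where g: "g = Arrow (M, \<sigma>) (M', \<sigma>') \<theta>"
    and B: "(M, \<sigma>) \<in> Obj (weak_left_center CM)" "(M', \<sigma>') \<in> Obj (weak_left_center CM)"
    and \<theta>: "in_hom CM \<theta> M M'"
    and comm: "\<forall>X\<in>Obj CM. Comp CM (tens_arr CM (Ident CM X) \<theta>) (\<sigma> X) = Comp CM (\<sigma>' X) (tens_arr CM \<theta> (Ident CM X))"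
    unfolding weak_left_center_simps by blast
  obtain \<rho> where r: "YD (M, \<rho>)" "\<sigma> = sigma M \<rho>" using B(1) unfolding Obj_W Fo_def by auto
  obtain \<rho>' where r': "YD (M', \<rho>')" "\<sigma>' = sigma M' \<rho>'" using B(2) unfolding Obj_W Fo_def by auto
  obtain f where f: "\<theta> = Arrow M M' f" "f \<in> hom M M'" using \<theta> by (auto simp: in_hom_CM)
  have y: "ydm k H M \<rho>" "ydm k H M' \<rho>'" using r(1) r'(1) by (simp_all add: yd_iff)
  have "f \<in> hom2 (M, \<rho>) (M', \<rho>')"
    unfolding hom2_iff using f(2) iffD2[OF colinear_iff[OF y f(2)] comm[unfolded r(2) r'(2) f(1)]] by blast
  then have "Arrow (M, \<rho>) (M', \<rho>') f \<in> Arr (yetter_drinfeld_modules k H)"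
    using r r' by (simp add: yetter_drinfeld_modules_def concrete_category_def)
  moreover have "g = Fa (Arrow (M, \<rho>) (M', \<rho>') f)"
    by (simp add: g Fa_def Fo_def r r' f)
  ultimately show "g \<in> Fa ` Arr (yetter_drinfeld_modules k H)" by blast
next
  fix g assume "g \<in> Fa ` Arr (yetter_drinfeld_modules k H)"
  then obtain M \<rho> M' \<rho>' f where g: "g = Fa (Arrow (M, \<rho>) (M', \<rho>') f)"
    and r: "YD (M, \<rho>)" "YD (M', \<rho>')" and f2: "f \<in> hom2 (M, \<rho>) (M', \<rho>')"
    by (auto simp: yetter_drinfeld_modules_def concrete_category_def)
  have y: "ydm k H M \<rho>" "ydm k H M' \<rho>'" using r by (simp_all add: yd_iff)
  interpret A: ydm k H M \<rho> by (rule y)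
  interpret B: ydm k H M' \<rho>' by (rule y)
  have f: "f \<in> hom M M'" and col: "\<forall>m\<in>carrier M. tl H M (H \<boxtimes> M') (\<lambda>h n. tens k H M' h (f n)) (\<rho> m) = \<rho>' (f m)"
    using f2 by (simp_all add: hom2_iff)
  note comm = iffD1[OF colinear_iff[OF y f] col]
  have th: "in_hom CM (Arrow M M' f) M M'" using f A.LM_M B.LM_M by (simp add: in_hom_CM)
  have O: "M \<in> Obj CM" "M' \<in> Obj CM" using A.LM_M B.LM_M by simp_all
  have "g = Arrow (M, sigma M \<rho>) (M', sigma M' \<rho>') (Arrow M M' f)" by (simp add: g Fa_def Fo_def)
  then show "g \<in> Arr (weak_left_center CM)"
    unfolding weak_left_center_simps
    using O A.half_braiding_sigma B.half_braiding_sigma th comm by blast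
qed

lemma isomorphic_YD_weak_left_center:
  "isomorphic_categories (yetter_drinfeld_modules k H) (weak_left_center CM)"
proof (rule isomorphic_categoriesI[OF category_YD, where Fo = Fo and Fa = Fa and Go = Go and Ga = Ga])
  show "Obj (weak_left_center CM) = Fo ` Obj (yetter_drinfeld_modules k H)"
    using Obj_W by (simp add: yetter_drinfeld_modules_def concrete_category_def)
  show "Arr (weak_left_center CM) = Fa ` Arr (yetter_drinfeld_modules k H)" by (rule Arr_W)
qed (auto simp: yetter_drinfeld_modules_def concrete_category_def weak_left_center_simps(3-) Go_Fo Fa_def Ga_def, auto simp: Fo_def)

end

lemma (in weak_hopf_bij) left_center_eq: "left_center CM = weak_left_center CM"
proof -
  let ?P = "\<lambda>(M, \<sigma>). \<forall>X\<in>Obj CM. is_iso CM (\<sigma> X)"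
  have P: "?P B" if BW: "B \<in> Obj (weak_left_center CM)" for B
  proof -
    obtain M \<rho> where B: "B = (M, sigma M \<rho>)" "ydm k H M \<rho>"
      using BW unfolding Obj_W by (auto simp: Fo_def yd_iff)
    interpret ydm k H M \<rho> by (rule B)
    interpret ydm_hopf k H M \<rho> S ..
    show ?thesis using is_iso_sigma by (simp add: B)
  qed
  have "Dom (weak_left_center CM) f \<in> Obj (weak_left_center CM) \<and> Cod (weak_left_center CM) f \<in> Obj (weak_left_center CM)"
    if "f \<in> Arr (weak_left_center CM)" for f
    using that unfolding weak_left_center_simps by force
  then show ?thesis
    unfolding left_center_def by (intro full_subcategory_all P)
qed

theorem theorem2p6:
  fixes k :: "'u ring" and H :: "'u bialgebra"
  assumes "infinite (UNIV :: 'u set)"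
    and "cring k"
    and "weak_bialgebra k H"
  shows "isomorphic_categories (yetter_drinfeld_modules k H) (weak_left_center (left_modules k H)) \<and>
    (\<forall>S. weak_hopf_algebra k H S \<and> bij_betw S (carrier H) (carrier H) \<longrightarrow>
      isomorphic_categories (yetter_drinfeld_modules k H) (left_center (left_modules k H)))"
proof (intro conjI allI impI)
  interpret weak_bialg k H
    using assms by (intro weak_bialg.intro tensor_base.intro weak_bialg_axioms.intro)
  show iso: "isomorphic_categories (yetter_drinfeld_modules k H) (weak_left_center (left_modules k H))"
    by (rule isomorphic_YD_weak_left_center)
  fix S assume S: "weak_hopf_algebra k H S \<and> bij_betw S (carrier H) (carrier H)"
  interpret weak_hopf_bij k H S
    using S by unfold_locales (simp_all add: weak_hopf_algebra_def)
  show "isomorphic_categories (yetter_drinfeld_modules k H) (left_center (left_modules k H))"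
    unfolding left_center_eq by (rule iso)
qed

end
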